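(* Let $X$ be a complex submanifold of an open subset of $\mathbb{C}^m$ with $n=\dim X\ge 1$, let $a\in X$ and let $d\in\mathbb{N}$. The following conditions are equivalent; moreover in each of them "for all local parametrisations" may equivalently be replaced by "for some local parametrisation". (1) $a$ is a $D$-invariant point of degree $d$, i.e. $\mathbb{C}[\Phi]^d_b{\downarrow}$ is $D$-invariant in $\mathbb{C}[\tau]$ for all local parametrisations $\Phi$ of $X$ at $a$. (2) $(\mathbb{C}[\Phi]^d_b{\downarrow})^{\bot_n}$ is an ideal of $\mathcal{O}_{n,b}$ for all local parametrisations $\Phi$ of $X$ at $a$. (3) $\ker T_a^{\varphi,d}=(D_a^{\varphi,d})^{\bot_X}$ is an ideal of $\mathcal{O}_{X,a}$ for all local parametrisations $\Phi$ of $X$ at $a$. (4) $D_a^{\varphi,d}$ is $D$-invariant in $\mathbb{C}[\xi]$ for all local parametrisations $\Phi$ of $X$ at $a$. If, for a local parametrisation $\Phi:(\mathbb{C}^n,b)\to(\mathbb{C}^m,a)$ of $X$ at $a$, the point $b$ is a bundle point of all the jet spaces of $\mathbb{C}[\Phi]^d$, then all of these conditions hold.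
   Context: $\mathcal{O}_{n,b}=\mathbb{C}\{t-b\}$ is the ring of germs of holomorphic functions at $b\in\mathbb{C}^n$, $\mathcal{O}_{m,a}=\mathbb{C}\{x-a\}$ likewise, and $\mathcal{O}_{X,a}=\mathcal{O}_{m,a}/I_a$ is the ring of germs at $a$ of holomorphic functions on $X$, $I_a$ being the ideal of germs vanishing on $X$. Dual variables are $\tau=(\tau_1,\dots,\tau_n)$ and $\xi=(\xi_1,\dots,\xi_m)$. A local parametrisation of $X$ at $a$ is a holomorphic map germ $\Phi=(\Phi_1,\dots,\Phi_m):(\mathbb{C}^n,b)\to(\mathbb{C}^m,a)$ (for some $b\in\mathbb{C}^n$) inducing a biholomorphic germ $(\mathbb{C}^n,b)\to(X,a)$; $\varphi:\mathcal{O}_{m,a}\to\mathcal{O}_{n,b}$, $\varphi(F)=F\circ\Phi$, is the corresponding epimorphism. $\mathbb{C}[x]^d$ is the space of polynomials of degree $\le d$ in $x_1,\dots,x_m$; $\mathbb{C}[\Phi]^d=\varphi(\mathbb{C}[x]^d)\subset\mathcal{O}_{n,b}$; $P^d(X_a)\subset\mathcal{O}_{X,a}$ is the image of $\mathbb{C}[x]^d$. Least space: for $0\ne f=\sum c_\nu(t-b)^\nu\in\mathcal{O}_{n,b}$, with $k$ the smallest $|\nu|$ such that $c_\nu\ne0$, $f_b{\downarrow}=\sum_{|\nu|=k}c_\nu\tau^\nu$; $0_b{\downarrow}=0$; for a subspace $Z$, $Z_b{\downarrow}=\mathrm{Span}_{\mathbb{C}}\{f_b{\downarrow}:f\in Z\}\subset\mathbb{C}[\tau]$.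 A subspace of a polynomial ring is $D$-invariant if it is closed under all first-order partial derivatives. Sesquilinear forms: $S_{n,b}:\mathbb{C}[\tau]\times\mathcal{O}_{n,b}\to\mathbb{C}$, $S_{n,b}\langle\sum a_\nu\tau^\nu\,|\,\sum b_\mu(t-b)^\mu\rangle=\sum_\nu\nu!\,a_\nu\overline{b_\nu}$, and $S_{m,a}:\mathbb{C}[\xi]\times\mathcal{O}_{m,a}\to\mathbb{C}$ by the same formula. For $L\subset\mathbb{C}[\tau]$, $L^{\bot_n}=\{f\in\mathcal{O}_{n,b}:S_{n,b}\langle p\,|\,f\rangle=0\ \forall p\in L\}$. The adjoint ${}^s\varphi:\mathbb{C}[\tau]\to\mathbb{C}[\xi]$ is the linear map determined by $S_{m,a}\langle{}^s\varphi(p)\,|\,F\rangle=S_{n,b}\langle p\,|\,\varphi(F)\rangle$ for all $p\in\mathbb{C}[\tau]$, $F\in\mathcal{O}_{m,a}$. Bos–Calvi tangents: $D_a^{\varphi,d}={}^s\varphi(\mathbb{C}[\Phi]^d_b{\downarrow})\subset\mathbb{C}[\xi]$. It lies in $D_a={}^s\varphi(\mathbb{C}[\tau])$, and $S_{X,a}:D_a\times\mathcal{O}_{X,a}\to\mathbb{C}$ is $S_{X,a}\langle{}^s\varphi(p)\,|\,f\rangle=S_{n,b}\langle p\,|\,f\circ\Phi\rangle$. For $L\subset D_a$, $L^{\bot_X}=\{f\in\mathcal{O}_{X,a}:S_{X,a}\langle q\,|\,f\rangle=0\ \forall q\in L\}$. The form $S_{X,a}$ restricts to a non-degenerate form on $D_a^{\varphi,d}\times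 P^d(X_a)$, and the $\varphi$-Taylor projector $T_a^{\varphi,d}:\mathcal{O}_{X,a}\to P^d(X_a)$ is the linear map sending $f$ to the unique $p\in P^d(X_a)$ with $S_{X,a}\langle q\,|\,f-p\rangle=0$ for all $q\in D_a^{\varphi,d}$. Bundle points: let $Z$ be a finite-dimensional space of holomorphic functions on a connected open neighbourhood $W$ of $b$ (here representatives of $\mathbb{C}[\Phi]^d$). For $t\in W$ put $R_k(t)=\{(\tfrac1{\nu!}\tfrac{\partial^{|\nu|}f}{\partial t^\nu}(t))_{|\nu|\le k}:f\in Z\}$. The point $b$ is a bundle point of all the jet spaces of $Z$ if for every $k\ge0$, $\dim R_k(b)=\max_{t\in W}\dim R_k(t)$ (independent of the choice of $W$). *)

theory Defs
  imports
    "HOL-Analysis.Analysis"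
    "HOL-Algebra.QuotRing"
    "HOL-Library.Poly_Mapping"
begin

section \<open>Polynomials\<close>

text \<open>Multi-indices are finitely supported functions \<open>'n \<Rightarrow>\<^sub>0 nat\<close>, and a polynomial is its finitely
  supported family of coefficients.\<close>

type_synonym 'n cpoly = "('n \<Rightarrow>\<^sub>0 nat) \<Rightarrow>\<^sub>0 complex"

definition mdeg :: "('n::finite \<Rightarrow>\<^sub>0 nat) \<Rightarrow> nat"
  where "mdeg \<nu> = (\<Sum>i\<in>UNIV. Poly_Mapping.lookup \<nu> i)"

definition mfact :: "('n::finite \<Rightarrow>\<^sub>0 nat) \<Rightarrow> complex"
  where "mfact \<nu> = (\<Prod>i\<in>UNIV. fact (Poly_Mapping.lookup \<nu> i))"

definition poly_eval :: "'n::finite cpoly \<Rightarrow> complex ^ 'n \<Rightarrow> complex"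
  where "poly_eval p z = (\<Sum>\<nu>\<in>Poly_Mapping.keys p. Poly_Mapping.lookup p \<nu> *
    (\<Prod>i\<in>UNIV. (z $ i) ^ Poly_Mapping.lookup \<nu> i))"

definition polys_le :: "nat \<Rightarrow> 'n::finite cpoly set"
  where "polys_le d = {p. \<forall>\<nu>\<in>Poly_Mapping.keys p. mdeg \<nu> \<le> d}"

text \<open>In the summands with \<open>\<nu>\<^sub>i = 0\<close> the truncated subtraction is harmless, as the coefficient
  vanishes.\<close>

definition poly_deriv :: "'n::finite \<Rightarrow> 'n cpoly \<Rightarrow> 'n cpoly"
  where "poly_deriv i p = (\<Sum>\<nu>\<in>Poly_Mapping.keys p. Poly_Mapping.single (\<nu> - Poly_Mapping.single i 1)
    (of_nat (Poly_Mapping.lookup \<nu> i) * Poly_Mapping.lookup p \<nu>))"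

definition D_invariant :: "'n::finite cpoly set \<Rightarrow> bool"
  where "D_invariant L \<longleftrightarrow> (\<forall>i. \<forall>p\<in>L. poly_deriv i p \<in> L)"

definition poly_scale :: "complex \<Rightarrow> 'n cpoly \<Rightarrow> 'n cpoly"
  where "poly_scale c p = Poly_Mapping.map ((*) c) p"

lemma lookup_poly_scale [simp]:
  "Poly_Mapping.lookup (poly_scale c p) \<nu> = c * Poly_Mapping.lookup p \<nu>"
  unfolding poly_scale_def by (simp add: Poly_Mapping.map.rep_eq when_def)

global_interpretation cpoly: vector_space "poly_scale :: complex \<Rightarrow> 'n cpoly \<Rightarrow> 'n cpoly"
  by unfold_locales (auto intro!: poly_mapping_eqI simp: lookup_add algebra_simps)


section \<open>Holomorphic functions and maps of several variables\<close>

definition complex_diff_at :: "(complex ^ 'n \<Rightarrow> complex) \<Rightarrow> complex ^ 'n \<Rightarrow> bool"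
  where "complex_diff_at f z \<longleftrightarrow> (\<exists>D. (f has_derivative D) (at z) \<and> (\<forall>c v. D (c *s v) = c * D v))"

definition holo_at :: "(complex ^ 'n \<Rightarrow> complex) \<Rightarrow> complex ^ 'n \<Rightarrow> bool"
  where "holo_at f b \<longleftrightarrow> (\<forall>\<^sub>F z in nhds b. complex_diff_at f z)"

definition holo_map_on :: "(complex ^ 'n \<Rightarrow> complex ^ 'm) \<Rightarrow> (complex ^ 'n) set \<Rightarrow> bool"
  where "holo_map_on F W \<longleftrightarrow> (\<forall>j. \<forall>z\<in>W. complex_diff_at (\<lambda>t. F t $ j) z)"

definition pdiff :: "'n \<Rightarrow> (complex ^ 'n \<Rightarrow> complex) \<Rightarrow> complex ^ 'n \<Rightarrow> complex"
  where "pdiff i f z = deriv (\<lambda>w. f (z + axis i w)) 0"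

text \<open>For holomorphic functions the order of the partial derivatives is immaterial, so an
  arbitrary enumeration of the coordinates is used.\<close>

definition coord_list :: "'n::finite list"
  where "coord_list = (SOME is. distinct is \<and> set is = UNIV)"

definition mdiff :: "('n::finite \<Rightarrow>\<^sub>0 nat) \<Rightarrow> (complex ^ 'n \<Rightarrow> complex) \<Rightarrow> complex ^ 'n \<Rightarrow> complex"
  where "mdiff \<nu> f = foldr (\<lambda>i. pdiff i ^^ Poly_Mapping.lookup \<nu> i) coord_list f"

text \<open>The coefficient of \<open>(t - b)\<^sup>\<nu>\<close> in the power series expansion of \<open>f\<close> at \<open>b\<close>.\<close>

definition taylor_coeff :: "(complex ^ 'n::finite \<Rightarrow> complex) \<Rightarrow> complex ^ 'n \<Rightarrow> ('n \<Rightarrow>\<^sub>0 nat) \<Rightarrow> complex"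
  where "taylor_coeff f b \<nu> = mdiff \<nu> f b / mfact \<nu>"


section \<open>Rings of germs\<close>

text \<open>The ring of germs at \<open>b\<close> is the ring of all functions holomorphic near \<open>b\<close> modulo the ideal of
  those vanishing near \<open>b\<close>; so a germ is the set of its representatives.\<close>

definition holo_ring :: "complex ^ 'n \<Rightarrow> (complex ^ 'n \<Rightarrow> complex) ring"
  where "holo_ring b = \<lparr>carrier = {f. holo_at f b}, mult = (\<lambda>f g z. f z * g z), one = (\<lambda>_. 1),
    zero = (\<lambda>_. 0), add = (\<lambda>f g z. f z + g z)\<rparr>"

definition null_funs :: "complex ^ 'n \<Rightarrow> (complex ^ 'n \<Rightarrow> complex) set"
  where "null_funs b = {f. holo_at f b \<and> (\<forall>\<^sub>F z in nhds b. f z = 0)}"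

definition germ_ring :: "complex ^ 'n \<Rightarrow> (complex ^ 'n \<Rightarrow> complex) set ring"
  where "germ_ring b = holo_ring b Quot null_funs b"

definition germ :: "complex ^ 'n \<Rightarrow> (complex ^ 'n \<Rightarrow> complex) \<Rightarrow> (complex ^ 'n \<Rightarrow> complex) set"
  where "germ b f = null_funs b +>\<^bsub>holo_ring b\<^esub> f"

definition germ_coeff :: "complex ^ 'n::finite \<Rightarrow> (complex ^ 'n \<Rightarrow> complex) set \<Rightarrow> ('n \<Rightarrow>\<^sub>0 nat) \<Rightarrow> complex"
  where "germ_coeff b A = taylor_coeff (SOME f. f \<in> A) b"

definition vanishing_ideal ::
    "(complex ^ 'm) set \<Rightarrow> complex ^ 'm \<Rightarrow> (complex ^ 'm \<Rightarrow> complex) set set"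
  where "vanishing_ideal X a =
    {A \<in> carrier (germ_ring a). \<forall>F\<in>A. \<forall>\<^sub>F x in nhds a. x \<in> X \<longrightarrow> F x = 0}"

definition X_germ_ring ::
    "(complex ^ 'm) set \<Rightarrow> complex ^ 'm \<Rightarrow> (complex ^ 'm \<Rightarrow> complex) set set ring"
  where "X_germ_ring X a = germ_ring a Quot vanishing_ideal X a"


section \<open>Submanifolds and local parametrisations\<close>

definition complex_submanifold :: "nat \<Rightarrow> (complex ^ 'm::finite) set \<Rightarrow> (complex ^ 'm) set \<Rightarrow> bool"
  where "complex_submanifold n \<Omega> X \<longleftrightarrow> open \<Omega> \<and> X \<subseteq> \<Omega> \<and>
    (\<forall>p\<in>X. \<exists>U V \<psi> \<psi>' J. open U \<and> p \<in> U \<and> U \<subseteq> \<Omega> \<and> open V \<and>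
       homeomorphism U V \<psi> \<psi>' \<and> holo_map_on \<psi> U \<and> holo_map_on \<psi>' V \<and>
       card J = n \<and> \<psi> ` (X \<inter> U) = V \<inter> {w::complex ^ 'm. \<forall>j. j \<notin> J \<longrightarrow> w $ j = 0})"

text \<open>A map germ is represented by a function, of which only the values near \<open>b\<close> matter. Holomorphy of
  the inverse on \<open>X\<close> means, as for the ring of germs on \<open>X\<close>, that it is locally the restriction of a
  holomorphic map on an open set of the ambient space.\<close>

definition local_parametrisation ::
    "(complex ^ 'm) set \<Rightarrow> complex ^ 'm \<Rightarrow> complex ^ 'n \<Rightarrow> (complex ^ 'n \<Rightarrow> complex ^ 'm) \<Rightarrow> bool"
  where "local_parametrisation X a b \<Phi> \<longleftrightarrow> \<Phi> b = a \<and>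
    (\<exists>W U \<Psi>. open W \<and> b \<in> W \<and> open U \<and> a \<in> U \<and> holo_map_on \<Phi> W \<and> holo_map_on \<Psi> U \<and>
       homeomorphism W (X \<inter> U) \<Phi> \<Psi>)"

text \<open>The homomorphism \<open>\<phi>\<close>, and the map it induces on germs on \<open>X\<close>.\<close>

definition pullback ::
    "complex ^ 'n \<Rightarrow> (complex ^ 'n \<Rightarrow> complex ^ 'm) \<Rightarrow> (complex ^ 'm \<Rightarrow> complex) set
      \<Rightarrow> (complex ^ 'n \<Rightarrow> complex) set"
  where "pullback b \<Phi> A = germ b ((SOME F. F \<in> A) \<circ> \<Phi>)"

definition X_pullback ::
    "complex ^ 'n \<Rightarrow> (complex ^ 'n \<Rightarrow> complex ^ 'm) \<Rightarrow> (complex ^ 'm \<Rightarrow> complex) set set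
      \<Rightarrow> (complex ^ 'n \<Rightarrow> complex) set"
  where "X_pullback b \<Phi> f = pullback b \<Phi> (SOME A. A \<in> f)"

text \<open>The spaces \<open>\<complex>[\<Phi>]\<^sup>d\<close> and \<open>P\<^sup>d(X\<^sub>a)\<close>.\<close>

definition Phi_polys ::
    "complex ^ 'm::finite \<Rightarrow> complex ^ 'n \<Rightarrow> (complex ^ 'n \<Rightarrow> complex ^ 'm) \<Rightarrow> nat
      \<Rightarrow> (complex ^ 'n \<Rightarrow> complex) set set"
  where "Phi_polys a b \<Phi> d = (\<lambda>p. pullback b \<Phi> (germ a (poly_eval p))) ` polys_le d"

definition X_polys ::
    "(complex ^ 'm::finite) set \<Rightarrow> complex ^ 'm \<Rightarrow> nat \<Rightarrow> (complex ^ 'm \<Rightarrow> complex) set set set"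
  where "X_polys X a d =
    (\<lambda>p. vanishing_ideal X a +>\<^bsub>germ_ring a\<^esub> germ a (poly_eval p)) ` polys_le d"


section \<open>Least spaces, sesquilinear forms and Bos--Calvi tangents\<close>

definition least_part :: "complex ^ 'n::finite \<Rightarrow> (complex ^ 'n \<Rightarrow> complex) set \<Rightarrow> 'n cpoly"
  where "least_part b A = (if A = \<zero>\<^bsub>germ_ring b\<^esub> then 0 else
    (let k = (LEAST k. \<exists>\<nu>. mdeg \<nu> = k \<and> germ_coeff b A \<nu> \<noteq> 0)
     in \<Sum>\<nu> | mdeg \<nu> = k. Poly_Mapping.single \<nu> (germ_coeff b A \<nu>)))"

definition least_space :: "complex ^ 'n::finite \<Rightarrow> (complex ^ 'n \<Rightarrow> complex) set set \<Rightarrow> 'n cpoly set"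
  where "least_space b Z = cpoly.span (least_part b ` Z)"

definition sform :: "complex ^ 'n::finite \<Rightarrow> 'n cpoly \<Rightarrow> (complex ^ 'n \<Rightarrow> complex) set \<Rightarrow> complex"
  where "sform b p A =
    (\<Sum>\<nu>\<in>Poly_Mapping.keys p. mfact \<nu> * Poly_Mapping.lookup p \<nu> * cnj (germ_coeff b A \<nu>))"

definition perp :: "complex ^ 'n::finite \<Rightarrow> 'n cpoly set \<Rightarrow> (complex ^ 'n \<Rightarrow> complex) set set"
  where "perp b L = {A \<in> carrier (germ_ring b). \<forall>p\<in>L. sform b p A = 0}"

definition adjoint_map ::
    "complex ^ 'm::finite \<Rightarrow> complex ^ 'n::finite \<Rightarrow> (complex ^ 'n \<Rightarrow> complex ^ 'm) \<Rightarrow> 'n cpoly \<Rightarrow> 'm cpoly"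
  where "adjoint_map a b \<Phi> p =
    (THE q. \<forall>F\<in>carrier (germ_ring a). sform a q F = sform b p (pullback b \<Phi> F))"

definition bos_calvi ::
    "complex ^ 'm::finite \<Rightarrow> complex ^ 'n::finite \<Rightarrow> (complex ^ 'n \<Rightarrow> complex ^ 'm) \<Rightarrow> nat \<Rightarrow> 'm cpoly set"
  where "bos_calvi a b \<Phi> d = adjoint_map a b \<Phi> ` least_space b (Phi_polys a b \<Phi> d)"

text \<open>Meaningful for \<open>q\<close> in the range of the adjoint, which is injective because \<open>\<phi>\<close> is surjective.\<close>

definition X_sform ::
    "complex ^ 'm::finite \<Rightarrow> complex ^ 'n::finite \<Rightarrow> (complex ^ 'n \<Rightarrow> complex ^ 'm) \<Rightarrow> 'm cpoly
      \<Rightarrow> (complex ^ 'm \<Rightarrow> complex) set set \<Rightarrow> complex"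
  where "X_sform a b \<Phi> q f = (THE s. \<exists>p. q = adjoint_map a b \<Phi> p \<and> s = sform b p (X_pullback b \<Phi> f))"

definition X_perp ::
    "(complex ^ 'm::finite) set \<Rightarrow> complex ^ 'm \<Rightarrow> complex ^ 'n::finite \<Rightarrow> (complex ^ 'n \<Rightarrow> complex ^ 'm)
      \<Rightarrow> 'm cpoly set \<Rightarrow> (complex ^ 'm \<Rightarrow> complex) set set set"
  where "X_perp X a b \<Phi> L = {f \<in> carrier (X_germ_ring X a). \<forall>q\<in>L. X_sform a b \<Phi> q f = 0}"

definition taylor_projector ::
    "(complex ^ 'm::finite) set \<Rightarrow> complex ^ 'm \<Rightarrow> complex ^ 'n::finite \<Rightarrow> (complex ^ 'n \<Rightarrow> complex ^ 'm)
      \<Rightarrow> nat \<Rightarrow> (complex ^ 'm \<Rightarrow> complex) set set \<Rightarrow> (complex ^ 'm \<Rightarrow> complex) set set"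
  where "taylor_projector X a b \<Phi> d f =
    (THE p. p \<in> X_polys X a d \<and>
       (\<forall>q\<in>bos_calvi a b \<Phi> d. X_sform a b \<Phi> q (f \<ominus>\<^bsub>X_germ_ring X a\<^esub> p) = 0))"

definition taylor_kernel ::
    "(complex ^ 'm::finite) set \<Rightarrow> complex ^ 'm \<Rightarrow> complex ^ 'n::finite \<Rightarrow> (complex ^ 'n \<Rightarrow> complex ^ 'm)
      \<Rightarrow> nat \<Rightarrow> (complex ^ 'm \<Rightarrow> complex) set set set"
  where "taylor_kernel X a b \<Phi> d =
    {f \<in> carrier (X_germ_ring X a). taylor_projector X a b \<Phi> d f = \<zero>\<^bsub>X_germ_ring X a\<^esub>}"


section \<open>Bundle points\<close>

text \<open>The tuple \<open>(c\<^sub>\<nu>)\<close> with \<open>|\<nu>| \<le> k\<close> is encoded as a finitely supported family, so that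
  \<open>cpoly.dim\<close> is the complex dimension of the space of these tuples.\<close>

definition jet_space ::
    "(complex ^ 'n::finite \<Rightarrow> complex) set \<Rightarrow> nat \<Rightarrow> complex ^ 'n \<Rightarrow> 'n cpoly set"
  where "jet_space Z k t =
    (\<lambda>f. \<Sum>\<nu> | mdeg \<nu> \<le> k. Poly_Mapping.single \<nu> (taylor_coeff f t \<nu>)) ` Z"

definition bundle_point_on ::
    "(complex ^ 'n::finite) set \<Rightarrow> (complex ^ 'n \<Rightarrow> complex) set \<Rightarrow> complex ^ 'n \<Rightarrow> bool"
  where "bundle_point_on W Z b \<longleftrightarrow>
    (\<forall>k. cpoly.dim (jet_space Z k b) = Max ((\<lambda>t. cpoly.dim (jet_space Z k t)) ` W))"

definition bundle_point_param ::
    "complex ^ 'n::finite \<Rightarrow> (complex ^ 'n \<Rightarrow> complex ^ 'm::finite) \<Rightarrow> nat \<Rightarrow> bool"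
  where "bundle_point_param b \<Phi> d \<longleftrightarrow>
    (\<exists>W. open W \<and> connected W \<and> b \<in> W \<and> holo_map_on \<Phi> W \<and>
       bundle_point_on W ((\<lambda>p. poly_eval p \<circ> \<Phi>) ` polys_le d) b)"

end

(* Write ord f for the order of vanishing at b, and Z for the space of the functions p o Phi with
   deg p <= d. Multiplication by t_i - b_i is adjoint to the derivative with respect to tau_i, so a
   graded or finite-dimensional space of polynomials is D-invariant iff its annihilator is an
   ideal; as phi is surjective, annihilators correspond under the adjoint, and (1)-(4) are
   equivalent for a fixed parametrisation. Independence of the parametrisation rests on a
   coordinate-free reformulation: the least space of Z is D-invariant iff for all f in Z with
   ord f >= k + 1 every partial derivative of f agrees with an element of Z up to order k + 1.
   The chain rule shows that this survives a change of coordinates.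
   If b is a bundle point, suppose ord f >= k + 1 and the k-jet at b of a partial derivative of f is
   not a k-jet of Z. This jet is the limit of the k-jets of f / s at b + s e_i as s tends to 0; since
   linear independence is an open condition, the k-jets of Z at b + s e_i would span a larger space
   than those at b. *)
theory Submission
  imports Defs "HOL-Complex_Analysis.Cauchy_Integral_Formula"
begin

subsection \<open>Partial derivatives of holomorphic functions\<close>

text \<open>The work is done on functions, and statements about germs are translated at the end: a
  germ enters through its Taylor coefficients and its order of vanishing. Taylor series are never
  summed. A polynomial pairs with finitely many coefficients, so a Taylor polynomial with a
  remainder of high order suffices. The one place where an infinite jet must determine the function
  is the identity theorem; it makes flat functions zero germs, which settles the least parts of
  germs and the uniqueness of the Taylor projection. The obstacle to independence of the
  parametrisation is that Z is only a vector space, whereas the chain rule has functions as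
  coefficients. The orders in the reformulation allow these coefficients to be frozen at the base
  point: the first derivatives of f have order k, the variation of a Jacobian entry has order 1, and
  the product disappears in the tolerated error of order k + 1.\<close>

lemma scaleC_axis: "axis i (c * w) = c *s axis i (w::complex)"
  by (simp add: vec_eq_iff axis_def)

lemma clinear_expand:
  fixes D :: "complex ^ 'n::finite \<Rightarrow> complex"
  assumes "linear D" "\<And>c v. D (c *s v) = c * D v"
  shows "D v = (\<Sum>i\<in>UNIV. v $ i * D (axis i 1))"
proof -
  have "D v = D (\<Sum>i\<in>UNIV. (v $ i) *s axis i 1)"
    by (simp add: basis_expansion)
  also have "\<dots> = (\<Sum>i\<in>UNIV. D ((v $ i) *s axis i 1))"
    by (rule linear_sum[OF assms(1)])
  finally show ?thesis by (simp add: assms(2))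
qed

lemma bounded_linear_axis: "bounded_linear (axis i :: complex \<Rightarrow> complex ^ 'n::finite)"
  by (rule linear_conv_bounded_linear[THEN iffD1], rule linearI)
     (auto simp: vec_eq_iff axis_def)

lemma axis_zero [simp]: "axis i 0 = 0"
  by (simp add: vec_eq_iff axis_def)

lemma norm_axis_complex [simp]: "norm (axis i (w::complex) :: complex ^ 'n::finite) = norm w"
  by (simp add: norm_eq_sqrt_inner inner_axis_axis)

lemma has_derivative_axis_line:
  fixes f :: "complex ^ 'n::finite \<Rightarrow> complex"
  assumes "(f has_derivative D) (at (z + axis i w))" "\<And>c v. D (c *s v) = c * D v"
  shows "((\<lambda>w. f (z + axis i w)) has_field_derivative D (axis i 1)) (at w)"
proof -
  have "((\<lambda>w. z + axis i w) has_derivative (\<lambda>w. axis i w)) (at w)"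
    by (auto intro!: derivative_eq_intros bounded_linear.has_derivative[OF bounded_linear_axis])
  from has_derivative_compose[OF this, of f D] assms(1)
  have "((\<lambda>w. f (z + axis i w)) has_derivative (\<lambda>w. D (axis i w))) (at w)" by simp
  moreover have "(\<lambda>w. D (axis i w)) = (*) (D (axis i 1))"
  proof
    fix w show "D (axis i w) = D (axis i 1) * w"
    using assms(2)[of w "axis i 1"] scaleC_axis[of i w 1] by (metis mult.commute mult.right_neutral)
  qed
  ultimately show ?thesis unfolding has_field_derivative_def by argo
qed

lemma pdiff_eqI:
  fixes f :: "complex ^ 'n::finite \<Rightarrow> complex"
  assumes "(f has_derivative D) (at z)" "\<And>c v. D (c *s v) = c * D v"
  shows "pdiff i f z = D (axis i 1)"
proof -
  have [simp]: "axis i 0 = (0 :: complex ^ 'n)" by simp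
  show ?thesis
    unfolding pdiff_def by (rule DERIV_imp_deriv) (rule has_derivative_axis_line, use assms in auto)
qed

lemma complex_diff_at_has_derivative:
  fixes f :: "complex ^ 'n::finite \<Rightarrow> complex"
  assumes "complex_diff_at f z"
  shows "(f has_derivative (\<lambda>v. \<Sum>i\<in>UNIV. v $ i * pdiff i f z)) (at z)"
proof -
  obtain D where D: "(f has_derivative D) (at z)" "\<And>c v. D (c *s v) = c * D v"
    using assms by (auto simp: complex_diff_at_def)
  have "D = (\<lambda>v. \<Sum>i\<in>UNIV. v $ i * pdiff i f z)"
    unfolding pdiff_eqI[OF D] by (rule ext) (rule clinear_expand[OF has_derivative_linear[OF D(1)] D(2)])
  with D(1) show ?thesis by argo
qed

lemma complex_diff_atI:
  assumes "(f has_derivative D) (at z)" "\<And>c v. D (c *s v) = c * D v"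
  shows "complex_diff_at f z"
  using assms by (auto simp: complex_diff_at_def)

lemma clinear_pdiff:
  "(\<Sum>i\<in>UNIV. (c *s v) $ i * p i) = (c::complex) * (\<Sum>i\<in>UNIV. v $ i * p i)"
  by (simp add: sum_distrib_left mult.assoc)

lemma sum_axis: "(\<Sum>i\<in>UNIV. (axis j 1 :: complex ^ 'n::finite) $ i * p i) = p j"
  by (simp add: axis_def if_distrib[of "\<lambda>x. x * _"] cong: if_cong)

lemma complex_diff_at_continuous:
  fixes f :: "complex ^ 'n::finite \<Rightarrow> complex"
  shows "complex_diff_at f z \<Longrightarrow> isCont f z"
  by (auto simp: complex_diff_at_def intro: has_derivative_continuous)

lemma complex_diff_at_const [simp]: "complex_diff_at (\<lambda>_. c) z"
  by (rule complex_diff_atI[where D = "\<lambda>_. 0"]) auto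

lemma complex_diff_at_nth [simp]: "complex_diff_at (\<lambda>z::complex^'n::finite. z $ i) z"
  by (rule complex_diff_atI[where D = "\<lambda>v. v $ i"])
     (auto intro: bounded_linear_imp_has_derivative)

lemma complex_diff_at_add:
  fixes f g :: "complex ^ 'n::finite \<Rightarrow> complex"
  assumes "complex_diff_at f z" "complex_diff_at g z"
  shows "complex_diff_at (\<lambda>z. f z + g z) z" "pdiff i (\<lambda>z. f z + g z) z = pdiff i f z + pdiff i g z"
proof -
  note D = has_derivative_add[OF assms[THEN complex_diff_at_has_derivative]]
  show "complex_diff_at (\<lambda>z. f z + g z) z"
    by (rule complex_diff_atI[OF D]) (simp add: clinear_pdiff del: vector_smult_component, simp add: algebra_simps)
  show "pdiff i (\<lambda>z. f z + g z) z = pdiff i f z + pdiff i g z"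
    by (subst pdiff_eqI[OF D])
       (simp_all add: sum_axis clinear_pdiff distrib_left del: vector_smult_component)
qed

lemma complex_diff_at_mult:
  fixes f g :: "complex ^ 'n::finite \<Rightarrow> complex"
  assumes "complex_diff_at f z" "complex_diff_at g z"
  shows "complex_diff_at (\<lambda>z. f z * g z) z"
    "pdiff i (\<lambda>z. f z * g z) z = pdiff i f z * g z + f z * pdiff i g z"
proof -
  note D = has_derivative_mult[OF assms[THEN complex_diff_at_has_derivative]]
  show "complex_diff_at (\<lambda>z. f z * g z) z"
    by (rule complex_diff_atI[OF D]) (simp add: clinear_pdiff del: vector_smult_component, simp add: algebra_simps)
  show "pdiff i (\<lambda>z. f z * g z) z = pdiff i f z * g z + f z * pdiff i g z"
    by (subst pdiff_eqI[OF D])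
       (simp_all only: sum_axis clinear_pdiff, simp_all add: algebra_simps)
qed

lemma pdiff_const [simp]: "pdiff i (\<lambda>_. c) = (\<lambda>_. 0)"
  by (simp add: pdiff_def fun_eq_iff)

lemma complex_diff_at_cmult:
  fixes f :: "complex ^ 'n::finite \<Rightarrow> complex"
  assumes "complex_diff_at f z"
  shows "complex_diff_at (\<lambda>z. c * f z) z" "pdiff i (\<lambda>z. c * f z) z = c * pdiff i f z"
  using complex_diff_at_mult[OF complex_diff_at_const assms] by auto

lemma complex_diff_at_sum:
  fixes f :: "'a \<Rightarrow> complex ^ 'n::finite \<Rightarrow> complex"
  assumes "\<And>j. j \<in> J \<Longrightarrow> complex_diff_at (f j) z"
  shows "complex_diff_at (\<lambda>z. \<Sum>j\<in>J. f j z) z \<and> pdiff i (\<lambda>z. \<Sum>j\<in>J. f j z) z = (\<Sum>j\<in>J. pdiff i (f j) z)"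
  using assms by (induction J rule: infinite_finite_induct) (auto simp: complex_diff_at_add)

lemma pdiff_nth: "pdiff i (\<lambda>z::complex^'n::finite. z $ j) z = (if i = j then 1 else 0)"
  by (subst pdiff_eqI[where D = "\<lambda>v. v $ j"])
     (auto intro: bounded_linear_imp_has_derivative simp: axis_def)

lemma has_derivative_vecI:
  fixes \<Phi> :: "'a::real_normed_vector \<Rightarrow> complex ^ 'm::finite"
  assumes "\<And>j. ((\<lambda>t. \<Phi> t $ j) has_derivative (\<lambda>v. D v $ j)) (at z)"
  shows "(\<Phi> has_derivative D) (at z)"
proof -
  have "((\<lambda>t. \<Sum>j\<in>UNIV. axis j (\<Phi> t $ j)) has_derivative (\<lambda>v. \<Sum>j\<in>UNIV. axis j (D v $ j))) (at z)"
    by (intro has_derivative_sum bounded_linear.has_derivative[OF bounded_linear_axis] assms)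
  moreover have "(\<Sum>j\<in>UNIV. axis j (x $ j)) = x" for x :: "complex ^ 'm"
    by (simp add: vec_eq_iff axis_def if_distrib cong: if_cong)
  ultimately show ?thesis by simp
qed

lemma complex_diff_at_compose:
  fixes F :: "complex ^ 'm::finite \<Rightarrow> complex" and \<Phi> :: "complex ^ 'n::finite \<Rightarrow> complex ^ 'm"
  assumes "complex_diff_at F (\<Phi> z)" "\<And>j. complex_diff_at (\<lambda>t. \<Phi> t $ j) z"
  shows "complex_diff_at (\<lambda>t. F (\<Phi> t)) z"
    "pdiff i (\<lambda>t. F (\<Phi> t)) z = (\<Sum>j\<in>UNIV. pdiff j F (\<Phi> z) * pdiff i (\<lambda>t. \<Phi> t $ j) z)"
proof -
  \<comment> \<open>\<open>A\<close> is the complex Jacobian of \<Phi> at \<open>z\<close>.\<close>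
  define A where "A v = (\<chi> j. \<Sum>i\<in>UNIV. v $ i * pdiff i (\<lambda>t. \<Phi> t $ j) z)" for v
  have "(\<Phi> has_derivative A) (at z)"
    by (rule has_derivative_vecI) (simp add: A_def complex_diff_at_has_derivative assms)
  from has_derivative_compose[OF this complex_diff_at_has_derivative[OF assms(1)]]
  have D: "((\<lambda>t. F (\<Phi> t)) has_derivative (\<lambda>v. \<Sum>j\<in>UNIV. A v $ j * pdiff j F (\<Phi> z))) (at z)" .
  have A: "A (c *s v) = c *s A v" for c v
    by (simp add: A_def vec_eq_iff sum_distrib_left mult.assoc)
  show "complex_diff_at (\<lambda>t. F (\<Phi> t)) z"
    by (rule complex_diff_atI[OF D]) (simp add: A sum_distrib_left mult.assoc)
  show "pdiff i (\<lambda>t. F (\<Phi> t)) z = (\<Sum>j\<in>UNIV. pdiff j F (\<Phi> z) * pdiff i (\<lambda>t. \<Phi> t $ j) z)"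
    by (subst pdiff_eqI[OF D])
       (simp add: A sum_distrib_left mult.assoc, simp add: A_def sum_axis mult.commute)
qed

lemma pdiff_cong_open:
  fixes f g :: "complex ^ 'n::finite \<Rightarrow> complex"
  assumes "open W" "\<And>z. z \<in> W \<Longrightarrow> f z = g z" "z \<in> W"
  shows "pdiff i f z = pdiff i g z"
  unfolding pdiff_def
proof (rule deriv_cong_ev)
  have "((\<lambda>w. z + axis i w) \<longlongrightarrow> z + axis i 0) (nhds (0::complex))"
    by (intro tendsto_intros bounded_linear.tendsto[OF bounded_linear_axis] filterlim_ident)
  moreover have "\<forall>\<^sub>F x in nhds (z + axis i 0). x \<in> W"
    using assms by (intro eventually_nhds_in_open) auto
  ultimately have "\<forall>\<^sub>F w in nhds (0::complex). z + axis i w \<in> W"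
    by (rule eventually_compose_filterlim[rotated])
  then show "\<forall>\<^sub>F w in nhds 0. f (z + axis i w) = g (z + axis i w)"
    by eventually_elim (use assms in auto)
qed auto

lemma complex_diff_at_cong_open:
  fixes f g :: "complex ^ 'n::finite \<Rightarrow> complex"
  assumes "open W" "\<And>z. z \<in> W \<Longrightarrow> f z = g z" "z \<in> W" "complex_diff_at f z"
  shows "complex_diff_at g z"
proof -
  obtain D where "(f has_derivative D) (at z)" "\<And>c v. D (c *s v) = c * D v"
    using assms(4) by (auto simp: complex_diff_at_def)
  then show ?thesis
    by (intro complex_diff_atI[where D = D] has_derivative_transform_within_open[of f D z UNIV W g])
       (use assms(1-3) in auto)
qed

section \<open>Holomorphic functions on open sets and Cauchy's formula\<close>

definition holo_fun_on :: "(complex ^ 'n::finite \<Rightarrow> complex) \<Rightarrow> (complex ^ 'n) set \<Rightarrow> bool"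
  where "holo_fun_on f W \<longleftrightarrow> (\<forall>z\<in>W. complex_diff_at f z)"

lemma holo_fun_on_continuous: "holo_fun_on f W \<Longrightarrow> continuous_on W f"
  by (auto simp: holo_fun_on_def continuous_at_imp_continuous_on complex_diff_at_continuous)

lemma holo_fun_on_line:
  assumes "holo_fun_on f W" "open W"
  shows "(\<lambda>w. f (z + axis i w)) holomorphic_on {w. z + axis i w \<in> W}"
proof -
  have "\<exists>f'. ((\<lambda>w. f (z + axis i w)) has_field_derivative f') (at w)" if "z + axis i w \<in> W" for w
    using that assms(1) has_derivative_axis_line[of f _ z i w]
    unfolding holo_fun_on_def complex_diff_at_def by blast
  then show ?thesis
    by (auto simp: holomorphic_on_def field_differentiable_def intro: has_field_derivative_at_within)
qed

text \<open>Cauchy's formula on a circle of fixed radius; the kernel depends on the radius only, so the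
  formula can be differentiated with respect to the centre.\<close>

definition circ :: "real \<Rightarrow> real \<Rightarrow> complex"
  where "circ r s = of_real r * exp (2 * of_real pi * \<i> * of_real s)"

definition kern :: "real \<Rightarrow> real \<Rightarrow> complex"
  where "kern r s = exp (- (2 * of_real pi * \<i> * of_real s)) / of_real r"

lemma continuous_on_circ [continuous_intros]: "continuous_on A (circ r)"
  unfolding circ_def by (intro continuous_intros)

lemma continuous_on_kern [continuous_intros]: "continuous_on A (kern r)"
  unfolding kern_def divide_inverse by (intro continuous_intros)

lemma norm_circ: "r \<ge> 0 \<Longrightarrow> norm (circ r s) = r"
  by (simp add: circ_def norm_mult norm_exp_eq_Re)

text \<open>Cauchy's formula for the first derivative: along the circle u = \<open>circ r s\<close>
  the factors 1/(2 pi i), 1/u^2 and du/ds combine to exp(-2 pi i s)/r, which is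
  \<open>kern r s\<close>.\<close>

lemma deriv_circle_integral:
  assumes "r > 0" "h holomorphic_on U" "open U" "cball 0 r \<subseteq> U"
  shows "((\<lambda>s. h (circ r s) * kern r s) has_integral deriv h 0) {0..1}"
proof -
  have *: "continuous_on (cball 0 r) h" "h holomorphic_on ball 0 r"
    using assms ball_subset_cball[of 0 r]
    by (meson holomorphic_on_subset holomorphic_on_imp_continuous_on order_trans)+
  have "((\<lambda>u. h u / (u - 0) ^ Suc 1) has_contour_integral ((2 * pi * \<i>) / (fact 1) * (deriv ^^ 1) h 0))
           (circlepath 0 r)"
    by (rule Cauchy_has_contour_integral_higher_derivative_circlepath) (use * assms in auto)
  then have "((\<lambda>s. h (circlepath 0 r s) / (circlepath 0 r s)^2 * (2 * pi * \<i> * r * exp (2 * of_real pi * \<i> * s)))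
       has_integral 2 * pi * \<i> * deriv h 0) {0..1}"
    unfolding has_contour_integral
    by (simp add: vector_derivative_circlepath power2_eq_square cong: has_integral_cong)
      (simp add: eval_nat_numeral)?
  from has_integral_mult_right[OF this, of "1 / (2 * pi * \<i>)"]
  have "((\<lambda>s. 1 / (2 * pi * \<i>) * (h (circlepath 0 r s) / (circlepath 0 r s)^2 * (2 * pi * \<i> * r * exp (2 * of_real pi * \<i> * s))))
       has_integral deriv h 0) {0..1}"
    by simp
  moreover have "1 / (2 * pi * \<i>) * (h (circlepath 0 r s) / (circlepath 0 r s)^2 * (2 * pi * \<i> * r * exp (2 * of_real pi * \<i> * s)))
     = h (circ r s) * kern r s" for s
    using assms(1) by (simp add: circlepath_def part_circlepath_def circ_def kern_def linepath_def exp_minus field_simps power2_eq_square)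
  ultimately show ?thesis by simp
qed

lemma pdiff_circle_integral:
  fixes z :: "complex ^ 'n::finite"
  assumes "r > 0" "holo_fun_on f W" "open W" "cball z r \<subseteq> W"
  shows "((\<lambda>s. f (z + axis i (circ r s)) * kern r s) has_integral pdiff i f z) {0..1}"
  unfolding pdiff_def
proof (rule deriv_circle_integral[OF assms(1) holo_fun_on_line[OF assms(2,3)]])
  show "open {w. z + axis i w \<in> W}"
  proof -
    have "continuous_on UNIV (\<lambda>w. z + axis i w)"
      by (intro continuous_on_add continuous_on_const bounded_linear.continuous_on[OF bounded_linear_axis] continuous_on_id)
    from open_vimage[OF assms(3) this] show ?thesis by (simp add: vimage_def)
  qed
  have "dist z (z + axis i w) \<le> r" if "norm w \<le> r" for w :: complex
    using that by (simp add: dist_norm)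
  then show "cball 0 r \<subseteq> {w. z + axis i w \<in> W}"
    using assms(4) by (auto simp: subset_iff)
qed

text \<open>A closed ball of radius 2r leaves room for moving the centre by less than r while the
  circle of radius r stays in \<open>W\<close>, so one radius serves all centres near
  \<open>z0\<close>.\<close>

lemma circle_in:
  assumes "r > 0" "cball z0 (2 * r) \<subseteq> W" "z \<in> ball z0 r"
  shows "cball z r \<subseteq> W" "z + axis i (circ r s) \<in> (W :: (complex ^ 'n::finite) set)"
proof -
  show *: "cball z r \<subseteq> W"
  proof
    fix x assume "x \<in> cball z r"
    then have "dist z0 x \<le> 2 * r"
      using assms(3) dist_triangle[of z0 x z] by auto
    then show "x \<in> W" using assms(2) by auto
  qed
  have "dist z (z + axis i (circ r s)) \<le> r"
    using assms(1) by (simp add: dist_norm norm_circ)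
  then show "z + axis i (circ r s) \<in> W" using * by auto
qed

lemma continuous_on_shift_axis:
  assumes "r > 0" "cball z0 (2 * r) \<subseteq> (W :: (complex ^ 'n::finite) set)" "continuous_on W g"
  shows "continuous_on (ball z0 r \<times> cbox 0 1) (\<lambda>(z, s). g (z + axis i (circ r s)) * kern r s)"
proof -
  have *: "continuous_on (ball z0 r \<times> cbox 0 1) (\<lambda>p. g (fst p + axis i (circ r (snd p))))"
    by (rule continuous_on_compose2[OF assms(3)])
       (use circle_in(2)[OF assms(1,2)] in \<open>auto intro!: continuous_intros bounded_linear.continuous_on[OF bounded_linear_axis]
         continuous_on_compose2[OF continuous_on_circ]\<close>)
  show ?thesis unfolding case_prod_unfold
    by (intro continuous_intros * continuous_on_compose2[OF continuous_on_kern]) auto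
qed

text \<open>The circle integral depends continuously on its centre. Differentiation under the
  integral sign, used next, asks for this continuity of the derivative of the integrand.\<close>

lemma pdiff_continuous:
  fixes W :: "(complex ^ 'n::finite) set"
  assumes "open W" "holo_fun_on f W"
  shows "continuous_on W (pdiff i f)"
proof (rule continuous_at_imp_continuous_on, rule ballI)
  fix z0 assume "z0 \<in> W"
  then obtain e where "e > 0" "cball z0 e \<subseteq> W"
    using assms(1) open_contains_cball by blast
  then obtain r where r: "r > 0" "cball z0 (2 * r) \<subseteq> W"
    by (metis field_sum_of_halves half_gt_zero mult_2)
  have "continuous_on (ball z0 r) (\<lambda>z. integral (cbox 0 1) (\<lambda>s. f (z + axis i (circ r s)) * kern r s))"
    by (intro integral_continuous_on_param continuous_on_shift_axis[OF r] holo_fun_on_continuous[OF assms(2)])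
  moreover have "integral (cbox 0 1) (\<lambda>s. f (z + axis i (circ r s)) * kern r s) = pdiff i f z"
    if "z \<in> ball z0 r" for z
    using integral_unique[OF pdiff_circle_integral[OF r(1) assms(2,1) circle_in(1)[OF r that]]] by simp
  ultimately have "continuous_on (ball z0 r) (pdiff i f)"
    using continuous_on_cong by (metis (mono_tags, lifting))
  then show "isCont (pdiff i f) z0"
    using r(1) by (simp add: continuous_on_eq_continuous_at)
qed

text \<open>Cauchy's formula is differentiated under the integral sign. The integral for the second
  derivatives is kept in the conclusion because commutation is read off from it.\<close>

lemma pdiff_holo_commute_aux:
  fixes W :: "(complex ^ 'n::finite) set"
  assumes "open W" "holo_fun_on f W" "z0 \<in> W"
  obtains r where "r > 0" "cball z0 (2 * r) \<subseteq> W" "complex_diff_at (pdiff i f) z0"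
    "\<And>j. pdiff j (pdiff i f) z0 = integral {0..1} (\<lambda>s. pdiff j f (z0 + axis i (circ r s)) * kern r s)"
proof -
  obtain e where "e > 0" "cball z0 e \<subseteq> W"
    using assms(1,3) open_contains_cball by blast
  then obtain r where r: "r > 0" "cball z0 (2 * r) \<subseteq> W"
    by (metis field_sum_of_halves half_gt_zero mult_2)
  define U where "U = ball z0 r"
  \<comment> \<open>\<open>G z s\<close> is the derivative in z of the integrand at parameter s. Its
    components are continuous in (z, s), so it is a continuous family of bounded operators.\<close>
  define G where "G z s v = (\<Sum>j\<in>UNIV. v $ j * (pdiff j f (z + axis i (circ r s)) * kern r s))" for z s v
  have G_bl: "bounded_linear (G z s)" for z s
    unfolding G_def
    by (intro bounded_linear_sum bounded_linear_compose[OF bounded_linear_mult_left] bounded_linear_vec_nth)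
  have G_der: "((\<lambda>z. f (z + axis i (circ r s)) * kern r s) has_derivative blinfun_apply (Blinfun (G z s))) (at z)"
    if "z \<in> U" for z s
  proof -
    have "complex_diff_at f (z + axis i (circ r s))"
      using assms(2) circle_in(2)[OF r] that by (auto simp: holo_fun_on_def U_def)
    note df = complex_diff_at_has_derivative[OF this]
    have "((\<lambda>z. z + axis i (circ r s)) has_derivative (\<lambda>v. v)) (at z)"
      by (auto intro!: derivative_eq_intros)
    note has_derivative_compose[OF this df]
    then have "((\<lambda>z. f (z + axis i (circ r s)) * kern r s) has_derivative
      (\<lambda>v. (\<Sum>j\<in>UNIV. v $ j * pdiff j f (z + axis i (circ r s))) * kern r s)) (at z)"
      by (intro has_derivative_mult_left) simp
    moreover have "(\<lambda>v. (\<Sum>j\<in>UNIV. v $ j * pdiff j f (z + axis i (circ r s))) * kern r s) = G z s"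
      by (auto simp: G_def sum_distrib_right mult.assoc)
    ultimately show ?thesis by (simp add: bounded_linear_Blinfun_apply G_bl)
  qed
  have pc: "continuous_on W (pdiff j f)" for j by (rule pdiff_continuous[OF assms(1,2)])
  have G_cont: "continuous_on (U \<times> cbox 0 1) (\<lambda>(z, s). Blinfun (G z s))"
  proof (rule continuous_on_blinfun_componentwise)
    fix v :: "complex ^ 'n"
    have "continuous_on (U \<times> cbox 0 1) (\<lambda>p. \<Sum>j\<in>UNIV. v $ j * (case p of (z, s) \<Rightarrow> pdiff j f (z + axis i (circ r s)) * kern r s))"
      unfolding U_def by (intro continuous_intros continuous_on_shift_axis[OF r] pc)
    then show "continuous_on (U \<times> cbox 0 1) (\<lambda>p. blinfun_apply (case p of (z, s) \<Rightarrow> Blinfun (G z s)) v)"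
      by (simp add: case_prod_unfold bounded_linear_Blinfun_apply G_bl G_def)
  qed
  have z0: "z0 \<in> U" using r by (simp add: U_def)
  have f_eq: "integral (cbox 0 1) (\<lambda>s. f (z + axis i (circ r s)) * kern r s) = pdiff i f z" if "z \<in> U" for z
    using integral_unique[OF pdiff_circle_integral[OF r(1) assms(2,1) circle_in(1)[OF r]]] that
    by (simp add: U_def)
  have "((\<lambda>z. integral (cbox 0 1) (\<lambda>s. f (z + axis i (circ r s)) * kern r s)) has_derivative
      integral (cbox 0 1) (\<lambda>s. Blinfun (G z0 s))) (at z0 within U)"
  proof (rule leibniz_rule)
    fix z assume "z \<in> U"
    then show "(\<lambda>s. f (z + axis i (circ r s)) * kern r s) integrable_on cbox 0 1"
      using pdiff_circle_integral[OF r(1) assms(2,1) circle_in(1)[OF r], of z i]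
      by (auto simp: U_def integrable_on_def)
  qed (use G_der G_cont z0 in \<open>auto simp: U_def intro: has_derivative_at_withinI\<close>)
  then have "((\<lambda>z. integral (cbox 0 1) (\<lambda>s. f (z + axis i (circ r s)) * kern r s)) has_derivative
      integral (cbox 0 1) (\<lambda>s. Blinfun (G z0 s))) (at z0)"
    using at_within_open[OF z0] by (simp add: U_def)
  then have D: "(pdiff i f has_derivative integral (cbox 0 1) (\<lambda>s. Blinfun (G z0 s))) (at z0)"
    by (rule has_derivative_transform_within_open[of _ _ _ _ U]) (use z0 f_eq in \<open>auto simp: U_def\<close>)
  have "(\<lambda>s. (z0, s)) ` cbox 0 1 \<subseteq> U \<times> cbox (0::real) 1" using z0 by auto
  then have "continuous_on (cbox 0 1) (\<lambda>s. Blinfun (G z0 s))"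
    using continuous_on_compose2[OF G_cont continuous_on_Pair[OF continuous_on_const[of _ z0] continuous_on_id]]
    by simp
  then have int: "(\<lambda>s. Blinfun (G z0 s)) integrable_on cbox 0 1"
    by (rule integrable_continuous)
  have app: "blinfun_apply (integral (cbox 0 1) (\<lambda>s. Blinfun (G z0 s))) v = integral (cbox 0 1) (\<lambda>s. G z0 s v)" for v
    unfolding blinfun_apply_integral[OF int] by (simp add: bounded_linear_Blinfun_apply G_bl)
  have G_lin: "G z0 s (c *s v) = c * G z0 s v" for s c v
    by (simp add: G_def sum_distrib_left mult.assoc)
  have lin: "blinfun_apply (integral (cbox 0 1) (\<lambda>s. Blinfun (G z0 s))) (c *s v) =
     c * blinfun_apply (integral (cbox 0 1) (\<lambda>s. Blinfun (G z0 s))) v" for c v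
    unfolding app G_lin by simp
  show thesis
  proof (rule that[OF r complex_diff_atI[OF D lin]])
    fix j
    show "pdiff j (pdiff i f) z0 = integral {0..1} (\<lambda>s. pdiff j f (z0 + axis i (circ r s)) * kern r s)"
      by (subst pdiff_eqI[OF D lin]) (unfold app, simp add: G_def sum_axis)
  qed
qed

lemma pdiff_holo:
  assumes "open W" "holo_fun_on f W"
  shows "holo_fun_on (pdiff i f) W"
  using pdiff_holo_commute_aux[OF assms] unfolding holo_fun_on_def by metis

text \<open>One circle integral of \<open>pdiff j f\<close> in direction i represents both sides:
  the left one by differentiating Cauchy's formula for \<open>pdiff i f\<close>, the right one as
  Cauchy's formula for the function \<open>pdiff j f\<close>.\<close>

lemma pdiff_commute:
  assumes "open W" "holo_fun_on f W" "z \<in> W"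
  shows "pdiff j (pdiff i f) z = pdiff i (pdiff j f) z"
proof -
  obtain r where r: "r > 0" "cball z (2 * r) \<subseteq> W"
    "pdiff j (pdiff i f) z = integral {0..1} (\<lambda>s. pdiff j f (z + axis i (circ r s)) * kern r s)"
    using pdiff_holo_commute_aux[OF assms, of i] by metis
  have "z \<in> ball z r" using r by simp
  from integral_unique[OF pdiff_circle_integral[OF r(1) pdiff_holo[OF assms(1,2)] assms(1) circle_in(1)[OF r(1,2) this]]] r(3)
  show ?thesis by simp
qed

section \<open>Functions and maps holomorphic near a point\<close>

lemma holo_atE:
  assumes "holo_at f b"
  obtains W where "open W" "b \<in> W" "holo_fun_on f W"
  using assms unfolding holo_at_def eventually_nhds holo_fun_on_def by blast

lemma holo_atI: "open W \<Longrightarrow> b \<in> W \<Longrightarrow> holo_fun_on f W \<Longrightarrow> holo_at f b"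
  unfolding holo_at_def eventually_nhds holo_fun_on_def by blast

lemma holo_at_diff: "holo_at f b \<Longrightarrow> complex_diff_at f b"
  unfolding holo_at_def by (rule eventually_nhds_x_imp_x)

lemma holo_at_const [simp]: "holo_at (\<lambda>_::complex^'n::finite. c) b"
  by (simp add: holo_at_def)

lemma holo_at_nth [simp]: "holo_at (\<lambda>z::complex^'n::finite. z $ i) b"
  by (simp add: holo_at_def)

lemma holo_at_add: "holo_at f b \<Longrightarrow> holo_at g b \<Longrightarrow> holo_at (\<lambda>z. f z + g z) (b::complex^'n::finite)"
  unfolding holo_at_def by (auto elim: eventually_elim2 intro: complex_diff_at_add)

lemma holo_at_mult: "holo_at f b \<Longrightarrow> holo_at g b \<Longrightarrow> holo_at (\<lambda>z. f z * g z) (b::complex^'n::finite)"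
  unfolding holo_at_def by (auto elim: eventually_elim2 intro: complex_diff_at_mult)

lemma holo_at_cmult: "holo_at f b \<Longrightarrow> holo_at (\<lambda>z. c * f z) (b::complex^'n::finite)"
  by (rule holo_at_mult) auto

lemma holo_at_sub: "holo_at f b \<Longrightarrow> holo_at g b \<Longrightarrow> holo_at (\<lambda>z. f z - g z) (b::complex^'n::finite)"
  using holo_at_add[of f b "\<lambda>z. (-1) * g z"] holo_at_cmult[of g b "-1"] by simp

lemma holo_at_sum: "(\<And>j. j \<in> J \<Longrightarrow> holo_at (f j) b) \<Longrightarrow> holo_at (\<lambda>z. \<Sum>j\<in>J. f j z) (b::complex^'n::finite)"
  by (induction J rule: infinite_finite_induct) (auto intro: holo_at_add)

lemma holo_at_prod: "(\<And>j. j \<in> J \<Longrightarrow> holo_at (f j) b) \<Longrightarrow> holo_at (\<lambda>z. \<Prod>j\<in>J. f j z) (b::complex^'n::finite)"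
  by (induction J rule: infinite_finite_induct) (auto intro: holo_at_mult)

lemma holo_at_power: "holo_at f b \<Longrightarrow> holo_at (\<lambda>z. f z ^ k) (b::complex^'n::finite)"
  by (induction k) (auto intro: holo_at_mult)

lemma holo_at_cong:
  fixes b :: "complex^'n::finite"
  assumes "holo_at f b" "\<forall>\<^sub>F z in nhds b. f z = g z"
  shows "holo_at g b"
proof -
  have "\<forall>\<^sub>F z in nhds b. \<forall>\<^sub>F w in nhds z. f w = g w"
    using assms(2) by (simp add: eventually_eventually)
  with assms(1) show ?thesis unfolding holo_at_def
  proof eventually_elim
    case (elim z)
    then obtain W where "open W" "z \<in> W" "\<And>w. w \<in> W \<Longrightarrow> f w = g w"
      by (auto simp: eventually_nhds)
    then show ?case using complex_diff_at_cong_open elim(1) by blast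
  qed
qed

lemma pdiff_cong_ev:
  fixes b :: "complex^'n::finite"
  assumes "\<forall>\<^sub>F z in nhds b. f z = g z"
  shows "\<forall>\<^sub>F z in nhds b. pdiff i f z = pdiff i g z"
proof -
  have "\<forall>\<^sub>F z in nhds b. \<forall>\<^sub>F w in nhds z. f w = g w"
    using assms(1) by (simp add: eventually_eventually)
  then show ?thesis
  proof eventually_elim
    case (elim z)
    then obtain W where "open W" "z \<in> W" "\<And>w. w \<in> W \<Longrightarrow> f w = g w"
      by (auto simp: eventually_nhds)
    then show ?case using pdiff_cong_open by blast
  qed
qed

lemma holo_at_pdiff: "holo_at f b \<Longrightarrow> holo_at (pdiff i f) (b::complex^'n::finite)"
  by (elim holo_atE, rule holo_atI) (auto intro: pdiff_holo)

lemma pdiff_add_ev: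
  fixes b :: "complex^'n::finite"
  assumes "holo_at f b" "holo_at g b"
  shows "\<forall>\<^sub>F z in nhds b. pdiff i (\<lambda>z. f z + g z) z = pdiff i f z + pdiff i g z"
  using assms unfolding holo_at_def by eventually_elim (rule complex_diff_at_add)

lemma pdiff_mult_ev:
  fixes b :: "complex^'n::finite"
  assumes "holo_at f b" "holo_at g b"
  shows "\<forall>\<^sub>F z in nhds b. pdiff i (\<lambda>z. f z * g z) z = pdiff i f z * g z + f z * pdiff i g z"
  using assms unfolding holo_at_def by eventually_elim (rule complex_diff_at_mult)

lemma pdiff_cmult_ev:
  fixes b :: "complex^'n::finite"
  assumes "holo_at f b"
  shows "\<forall>\<^sub>F z in nhds b. pdiff i (\<lambda>z. c * f z) z = c * pdiff i f z"
  using assms unfolding holo_at_def by eventually_elim (rule complex_diff_at_cmult)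

definition holo_map_at :: "(complex ^ 'n::finite \<Rightarrow> complex ^ 'm::finite) \<Rightarrow> complex ^ 'n \<Rightarrow> bool"
  where "holo_map_at \<Phi> b \<longleftrightarrow> (\<forall>j. holo_at (\<lambda>t. \<Phi> t $ j) b)"

lemma holo_map_at_isCont:
  assumes "holo_map_at \<Phi> b"
  shows "isCont \<Phi> b"
proof -
  have "(\<Phi> has_derivative (\<lambda>v. \<chi> j. \<Sum>i\<in>UNIV. v $ i * pdiff i (\<lambda>t. \<Phi> t $ j) b)) (at b)"
    using assms by (intro has_derivative_vecI) (simp add: holo_map_at_def complex_diff_at_has_derivative holo_at_diff)
  then show ?thesis by (rule has_derivative_continuous)
qed

lemma holo_map_at_eventually:
  "holo_map_at \<Phi> b \<Longrightarrow> \<forall>\<^sub>F z in nhds (\<Phi> b). P z \<Longrightarrow> \<forall>\<^sub>F t in nhds b. P (\<Phi> t)"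
  using holo_map_at_isCont[of \<Phi> b]
  by (auto simp: isCont_def tendsto_at_iff_tendsto_nhds intro: eventually_compose_filterlim)

lemma holo_at_compose:
  assumes "holo_at F (\<Phi> b)" "holo_map_at \<Phi> b"
  shows "holo_at (\<lambda>t. F (\<Phi> t)) b"
    and "\<forall>\<^sub>F t in nhds b. pdiff i (\<lambda>t. F (\<Phi> t)) t = (\<Sum>j\<in>UNIV. pdiff j F (\<Phi> t) * pdiff i (\<lambda>t. \<Phi> t $ j) t)"
proof -
  have 1: "\<forall>\<^sub>F t in nhds b. complex_diff_at F (\<Phi> t)"
    using holo_map_at_eventually[OF assms(2)] assms(1) unfolding holo_at_def by blast
  have 2: "\<forall>\<^sub>F t in nhds b. \<forall>j. complex_diff_at (\<lambda>t. \<Phi> t $ j) t"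
    using assms(2) unfolding holo_map_at_def holo_at_def by (simp add: eventually_all_finite)
  from 1 2 show "holo_at (\<lambda>t. F (\<Phi> t)) b"
    unfolding holo_at_def by eventually_elim (auto intro: complex_diff_at_compose)
  from 1 2 show "\<forall>\<^sub>F t in nhds b. pdiff i (\<lambda>t. F (\<Phi> t)) t = (\<Sum>j\<in>UNIV. pdiff j F (\<Phi> t) * pdiff i (\<lambda>t. \<Phi> t $ j) t)"
    by eventually_elim (auto intro: complex_diff_at_compose)
qed

subsection \<open>Multi-indices\<close>

definition unit_index :: "'n \<Rightarrow> ('n \<Rightarrow>\<^sub>0 nat)"
  where "unit_index i = Poly_Mapping.single i 1"

lemma lookup_unit_index [simp]: "Poly_Mapping.lookup (unit_index i) j = (if j = i then 1 else 0)"
  by (auto simp: unit_index_def lookup_single when_def)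

lemma mdeg_zero [simp]: "mdeg 0 = 0"
  by (simp add: mdeg_def)

lemma mdeg_add [simp]: "mdeg (\<nu> + \<mu>) = mdeg \<nu> + mdeg \<mu>"
  by (simp add: mdeg_def lookup_add sum.distrib)

lemma mdeg_unit [simp]: "mdeg (unit_index i) = 1"
  by (simp add: mdeg_def)

lemma mdeg_eq_0 [simp]: "mdeg \<nu> = 0 \<longleftrightarrow> \<nu> = 0"
  by (auto simp: mdeg_def intro: poly_mapping_eqI)

lemma unit_index_minus_add: "Poly_Mapping.lookup \<nu> i \<noteq> 0 \<Longrightarrow> \<nu> - unit_index i + unit_index i = \<nu>"
  by (rule poly_mapping_eqI) (auto simp: lookup_add lookup_minus)

text \<open>Adding one unit at a time matches the recursions of \<open>mdiff\<close>,
  \<open>mfact\<close> and \<open>shift_monom\<close>.\<close>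

lemma mindex_induct [case_names zero add]:
  fixes \<nu> :: "'n::finite \<Rightarrow>\<^sub>0 nat"
  assumes "P 0" "\<And>\<nu> i. P \<nu> \<Longrightarrow> P (\<nu> + unit_index i)"
  shows "P \<nu>"
proof (induction "mdeg \<nu>" arbitrary: \<nu>)
  case 0
  then show ?case using assms(1) by simp
next
  case (Suc k)
  then have "\<nu> \<noteq> 0" by auto
  then obtain i where i: "Poly_Mapping.lookup \<nu> i \<noteq> 0"
    by (metis lookup_zero poly_mapping_eqI)
  have "mdeg (\<nu> - unit_index i) = k"
    using Suc(2) arg_cong[OF unit_index_minus_add[OF i], of mdeg] by simp
  then have "P (\<nu> - unit_index i)" using Suc(1) by blast
  from assms(2)[OF this, of i] show ?case by (simp only: unit_index_minus_add[OF i])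
qed

lemma mfact_zero [simp]: "mfact 0 = 1"
  by (simp add: mfact_def)

lemma mfact_add_unit:
  "mfact (\<nu> + unit_index i) = of_nat (Suc (Poly_Mapping.lookup \<nu> i)) * mfact \<nu>"
proof -
  have "fact (Poly_Mapping.lookup (\<nu> + unit_index i) j) =
      (if j = i then of_nat (Suc (Poly_Mapping.lookup \<nu> i)) else 1) * (fact (Poly_Mapping.lookup \<nu> j) :: complex)" for j
    by (auto simp: lookup_add)
  then show ?thesis by (simp add: mfact_def prod.distrib del: of_nat_Suc)
qed

lemma mfact_nonzero [simp]: "mfact \<nu> \<noteq> 0"
  by (simp add: mfact_def)

lemma mfact_real: "mfact \<nu> = of_real (\<Prod>i\<in>UNIV. fact (Poly_Mapping.lookup \<nu> i))"
  by (simp add: mfact_def)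

lemma finite_mdeg_le [simp]: "finite {\<nu>::'n::finite \<Rightarrow>\<^sub>0 nat. mdeg \<nu> \<le> N}"
proof -
  have "inj_on Poly_Mapping.lookup {\<nu>::'n \<Rightarrow>\<^sub>0 nat. mdeg \<nu> \<le> N}"
    by (auto intro!: inj_onI poly_mapping_eqI)
  moreover have "Poly_Mapping.lookup \<nu> i \<le> mdeg \<nu>" for \<nu> :: "'n \<Rightarrow>\<^sub>0 nat" and i
    unfolding mdeg_def by (rule member_le_sum) auto
  then have "Poly_Mapping.lookup ` {\<nu>::'n \<Rightarrow>\<^sub>0 nat. mdeg \<nu> \<le> N} \<subseteq> PiE UNIV (\<lambda>_. {..N})"
    by (auto simp: PiE_def Pi_def) (use order_trans in blast)
  then have "finite (Poly_Mapping.lookup ` {\<nu>::'n \<Rightarrow>\<^sub>0 nat. mdeg \<nu> \<le> N})"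
    by (rule finite_subset) (auto intro: finite_PiE)
  ultimately show ?thesis by (rule finite_imageD[rotated])
qed

lemma finite_mdeg_eq [simp]: "finite {\<nu>::'n::finite \<Rightarrow>\<^sub>0 nat. mdeg \<nu> = N}"
  by (rule finite_subset[OF _ finite_mdeg_le[of N]]) auto

subsection \<open>Iterated partial derivatives\<close>

lemma pdiff_funpow_holo: "open W \<Longrightarrow> holo_fun_on f W \<Longrightarrow> holo_fun_on ((pdiff j ^^ k) f) W"
  by (induction k) (auto intro: pdiff_holo)

lemma pdiff_funpow_cong:
  "open W \<Longrightarrow> (\<And>z. z \<in> W \<Longrightarrow> f z = g z) \<Longrightarrow> z \<in> W \<Longrightarrow> (pdiff j ^^ k) f z = (pdiff j ^^ k) g z"
  by (induction k arbitrary: z) (auto intro: pdiff_cong_open)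

lemma pdiff_funpow_commute:
  assumes "open W" "holo_fun_on f W" "z \<in> W"
  shows "pdiff i ((pdiff j ^^ k) f) z = (pdiff j ^^ k) (pdiff i f) z"
  using assms(3)
proof (induction k arbitrary: z)
  case (Suc k)
  have "pdiff i ((pdiff j ^^ Suc k) f) z = pdiff j (pdiff i ((pdiff j ^^ k) f)) z"
    using pdiff_commute[OF assms(1) pdiff_funpow_holo[OF assms(1,2)] Suc.prems] by simp
  also have "\<dots> = pdiff j ((pdiff j ^^ k) (pdiff i f)) z"
    by (rule pdiff_cong_open[OF assms(1)]) (use Suc in auto)
  finally show ?case by simp
qed simp

text \<open>\<open>mdiff\<close> along an arbitrary list of coordinates, which makes induction on
  the list possible.\<close>

definition ldiff :: "'n list \<Rightarrow> ('n::finite \<Rightarrow>\<^sub>0 nat) \<Rightarrow> (complex ^ 'n \<Rightarrow> complex) \<Rightarrow> complex ^ 'n \<Rightarrow> complex"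
  where "ldiff xs \<nu> f = foldr (\<lambda>i. pdiff i ^^ Poly_Mapping.lookup \<nu> i) xs f"

lemma ldiff_simps [simp]:
  "ldiff [] \<nu> f = f" "ldiff (x # xs) \<nu> f = (pdiff x ^^ Poly_Mapping.lookup \<nu> x) (ldiff xs \<nu> f)"
  by (simp_all add: ldiff_def)

lemma ldiff_holo: "open W \<Longrightarrow> holo_fun_on f W \<Longrightarrow> holo_fun_on (ldiff xs \<nu> f) W"
  by (induction xs) (auto intro: pdiff_funpow_holo)

lemma ldiff_cong:
  "open W \<Longrightarrow> (\<And>z. z \<in> W \<Longrightarrow> f z = g z) \<Longrightarrow> z \<in> W \<Longrightarrow> ldiff xs \<nu> f z = ldiff xs \<nu> g z"
  by (induction xs arbitrary: z) (auto intro: pdiff_funpow_cong)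

lemma pdiff_ldiff:
  assumes "open W" "holo_fun_on f W" "z \<in> W"
  shows "pdiff i (ldiff xs \<nu> f) z = ldiff xs \<nu> (pdiff i f) z"
  using assms(3)
proof (induction xs arbitrary: z)
  case (Cons x xs)
  have "pdiff i (ldiff (x # xs) \<nu> f) z = (pdiff x ^^ Poly_Mapping.lookup \<nu> x) (pdiff i (ldiff xs \<nu> f)) z"
    using pdiff_funpow_commute[OF assms(1) ldiff_holo[OF assms(1,2)] Cons.prems] by simp
  also have "\<dots> = (pdiff x ^^ Poly_Mapping.lookup \<nu> x) (ldiff xs \<nu> (pdiff i f)) z"
    by (rule pdiff_funpow_cong[OF assms(1)]) (use Cons in auto)
  finally show ?case by simp
qed simp

lemma ldiff_add_unit_notin: "i \<notin> set xs \<Longrightarrow> ldiff xs (\<nu> + unit_index i) f = ldiff xs \<nu> f"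
  by (induction xs) (auto simp: lookup_add)

text \<open>The extra derivative appears in the block of i and is carried inwards past the remaining
  blocks by commutation; distinctness ensures that i has only one block.\<close>

lemma ldiff_add_unit:
  assumes "open W" "holo_fun_on f W" "z \<in> W" "distinct xs" "i \<in> set xs"
  shows "ldiff xs (\<nu> + unit_index i) f z = ldiff xs \<nu> (pdiff i f) z"
  using assms(3-)
proof (induction xs arbitrary: z)
  case (Cons x xs)
  show ?case
  proof (cases "x = i")
    case True
    then have "ldiff (x # xs) (\<nu> + unit_index i) f z = (pdiff i ^^ Suc (Poly_Mapping.lookup \<nu> i)) (ldiff xs \<nu> f) z"
      using Cons.prems by (simp add: ldiff_add_unit_notin lookup_add)
    also have "\<dots> = (pdiff i ^^ Poly_Mapping.lookup \<nu> i) (pdiff i (ldiff xs \<nu> f)) z"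
      by (simp only: funpow_Suc_right o_def)
    also have "\<dots> = (pdiff i ^^ Poly_Mapping.lookup \<nu> i) (ldiff xs \<nu> (pdiff i f)) z"
      by (rule pdiff_funpow_cong[OF assms(1)]) (use Cons.prems pdiff_ldiff[OF assms(1,2)] in auto)
    finally show ?thesis using True by simp
  next
    case False
    then have "ldiff (x # xs) (\<nu> + unit_index i) f z = (pdiff x ^^ Poly_Mapping.lookup \<nu> x) (ldiff xs (\<nu> + unit_index i) f) z"
      by (simp add: lookup_add)
    also have "\<dots> = (pdiff x ^^ Poly_Mapping.lookup \<nu> x) (ldiff xs \<nu> (pdiff i f)) z"
      by (rule pdiff_funpow_cong[OF assms(1)]) (use Cons False in auto)
    finally show ?thesis by simp
  qed
qed simp

lemma coord_list: "distinct (coord_list :: 'n::finite list)" "set (coord_list :: 'n list) = UNIV"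
proof -
  have "\<exists>xs :: 'n list. distinct xs \<and> set xs = UNIV"
    using finite_distinct_list[of "UNIV :: 'n set"] by auto
  from someI_ex[OF this] show "distinct (coord_list :: 'n::finite list)" "set (coord_list :: 'n list) = UNIV"
    by (auto simp: coord_list_def)
qed

lemma mdiff_ldiff: "mdiff \<nu> f = ldiff coord_list \<nu> f"
  by (simp add: mdiff_def ldiff_def)

lemma mdiff_zero [simp]: "mdiff 0 f = f"
proof -
  have "ldiff xs 0 f = f" for xs by (induction xs) auto
  then show ?thesis by (simp add: mdiff_ldiff)
qed

lemma mdiff_holo: "open W \<Longrightarrow> holo_fun_on f W \<Longrightarrow> holo_fun_on (mdiff \<nu> f) W"
  by (simp add: mdiff_ldiff ldiff_holo)

lemma mdiff_add_unit:
  assumes "holo_at f b"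
  shows "mdiff (\<nu> + unit_index i) f b = mdiff \<nu> (pdiff i f) b"
  using assms by (auto elim!: holo_atE simp: mdiff_ldiff coord_list intro: ldiff_add_unit)

lemma pdiff_mdiff:
  assumes "holo_at f b"
  shows "pdiff i (mdiff \<nu> f) b = mdiff \<nu> (pdiff i f) b"
  using assms by (auto elim!: holo_atE simp: mdiff_ldiff intro: pdiff_ldiff)

lemma mdiff_cong:
  assumes "\<forall>\<^sub>F z in nhds b. f z = g z"
  shows "mdiff \<nu> f b = mdiff \<nu> g b"
  using assms unfolding eventually_nhds mdiff_ldiff by (blast intro: ldiff_cong)

lemma mdiff_add:
  assumes "holo_at f b" "holo_at g b"
  shows "mdiff \<nu> (\<lambda>z. f z + g z) b = mdiff \<nu> f b + mdiff \<nu> g b"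
  using assms
proof (induction \<nu> arbitrary: f g rule: mindex_induct)
  case (add \<nu> i)
  then show ?case
    by (simp add: mdiff_add_unit holo_at_add mdiff_cong[OF pdiff_add_ev] holo_at_pdiff)
qed simp

lemma mdiff_cmult:
  assumes "holo_at f b"
  shows "mdiff \<nu> (\<lambda>z. c * f z) b = c * mdiff \<nu> f b"
  using assms
proof (induction \<nu> arbitrary: f rule: mindex_induct)
  case (add \<nu> i)
  then show ?case
    by (simp add: mdiff_add_unit holo_at_cmult mdiff_cong[OF pdiff_cmult_ev] holo_at_pdiff)
qed simp

lemma mdiff_const_zero: "mdiff \<nu> (\<lambda>_. 0) b = 0"
  using mdiff_cmult[of "\<lambda>_. 0" b \<nu> 0] by simp

lemma mdiff_sum:
  assumes "\<And>j. j \<in> J \<Longrightarrow> holo_at (f j) b"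
  shows "mdiff \<nu> (\<lambda>z. \<Sum>j\<in>J. f j z) b = (\<Sum>j\<in>J. mdiff \<nu> (f j) b)"
  using assms
  by (induction J rule: infinite_finite_induct) (auto simp: mdiff_add holo_at_sum mdiff_const_zero)

text \<open>Leibniz' rule for a linear factor that vanishes at b: only terms in which this factor is
  differentiated exactly once survive. For \<nu>_i = 0 the truncated subtraction is masked by the
  factor 0.\<close>

lemma mdiff_shift_mult:
  assumes "holo_at f b"
  shows "mdiff \<nu> (\<lambda>z. (z $ i - b $ i) * f z) b = of_nat (Poly_Mapping.lookup \<nu> i) * mdiff (\<nu> - unit_index i) f b"
  using assms
proof (induction \<nu> arbitrary: f rule: mindex_induct)
  case (add \<nu> j)
  have h: "holo_at (\<lambda>z. z $ i - b $ i) b" by (intro holo_at_sub) auto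
  have d: "pdiff j (\<lambda>z. z $ i - b $ i) z = (if i = j then 1 else 0)" for z
    using complex_diff_at_add(2)[of "\<lambda>z. z $ i" z "\<lambda>_. - b $ i" j] by (simp add: pdiff_nth)
  have "mdiff (\<nu> + unit_index j) (\<lambda>z. (z $ i - b $ i) * f z) b
      = mdiff \<nu> (\<lambda>z. (if i = j then 1 else 0) * f z + (z $ i - b $ i) * pdiff j f z) b"
    using mdiff_cong[OF pdiff_mult_ev[OF h add.prems]]
    by (simp add: mdiff_add_unit holo_at_mult h add.prems d)
  also have "\<dots> = (if i = j then 1 else 0) * mdiff \<nu> f b
      + of_nat (Poly_Mapping.lookup \<nu> i) * mdiff (\<nu> - unit_index i) (pdiff j f) b"
    using add by (simp add: mdiff_add mdiff_cmult holo_at_mult holo_at_cmult h holo_at_pdiff del: mult_1_left mult_zero_left)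
  also have "mdiff (\<nu> - unit_index i) (pdiff j f) b = mdiff (\<nu> - unit_index i + unit_index j) f b"
    by (simp add: mdiff_add_unit add.prems)
  also have "(if i = j then 1 else 0) * mdiff \<nu> f b + of_nat (Poly_Mapping.lookup \<nu> i) * \<dots>
     = of_nat (Poly_Mapping.lookup (\<nu> + unit_index j) i) * mdiff (\<nu> + unit_index j - unit_index i) f b"
  proof (cases "Poly_Mapping.lookup \<nu> i = 0")
    case True
    then show ?thesis by (auto simp: lookup_add)
  next
    case False
    then have "\<nu> + unit_index j - unit_index i = \<nu> - unit_index i + unit_index j"
      by (intro poly_mapping_eqI) (auto simp: lookup_add lookup_minus)
    then show ?thesis using unit_index_minus_add[OF False]
      by (auto simp: lookup_add  algebra_simps)
  qed
  finally show ?case .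
qed simp

subsection \<open>Order of vanishing\<close>

text \<open>Recursion on first derivatives instead of a condition on coefficients: in this form the
  product rule and the chain rule give the behaviour of the order by induction on k.\<close>

primrec ord_ge :: "nat \<Rightarrow> (complex ^ 'n::finite \<Rightarrow> complex) \<Rightarrow> complex ^ 'n \<Rightarrow> bool" where
  "ord_ge 0 f b \<longleftrightarrow> True"
| "ord_ge (Suc k) f b \<longleftrightarrow> f b = 0 \<and> (\<forall>i. ord_ge k (pdiff i f) b)"

lemma ord_ge_iff_mdiff:
  fixes b :: "complex ^ 'n::finite"
  assumes "holo_at f b"
  shows "ord_ge k f b \<longleftrightarrow> (\<forall>\<nu>. mdeg \<nu> < k \<longrightarrow> mdiff \<nu> f b = 0)"
  using assms
proof (induction k arbitrary: f)
  case (Suc k)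
  show ?case
  proof
    assume *: "ord_ge (Suc k) f b"
    show "\<forall>\<nu>. mdeg \<nu> < Suc k \<longrightarrow> mdiff \<nu> f b = 0"
    proof (intro allI impI)
      fix \<nu> :: "'n \<Rightarrow>\<^sub>0 nat" assume "mdeg \<nu> < Suc k"
      then show "mdiff \<nu> f b = 0"
        using * Suc by (induction \<nu> rule: mindex_induct) (auto simp: mdiff_add_unit holo_at_pdiff)
    qed
  next
    assume *: "\<forall>\<nu>. mdeg \<nu> < Suc k \<longrightarrow> mdiff \<nu> f b = 0"
    have "mdiff \<nu> (pdiff i f) b = 0" if "mdeg \<nu> < k" for \<nu> :: "'n \<Rightarrow>\<^sub>0 nat" and i
      using *[rule_format, of "\<nu> + unit_index i"] that by (simp add: mdiff_add_unit Suc.prems)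
    then show "ord_ge (Suc k) f b"
      using *[rule_format, of 0] Suc by (simp add: holo_at_pdiff)
  qed
qed simp

lemma ord_ge_cong: "\<forall>\<^sub>F z in nhds b. f z = g z \<Longrightarrow> ord_ge k f b \<longleftrightarrow> ord_ge k g b"
proof (induction k arbitrary: f g)
  case (Suc k)
  then show ?case using pdiff_cong_ev[OF Suc.prems] eventually_nhds_x_imp_x[OF Suc.prems] by auto
qed simp

lemma ord_ge_mono: "ord_ge k f b \<Longrightarrow> j \<le> k \<Longrightarrow> ord_ge j f b"
proof (induction k arbitrary: f j)
  case (Suc k)
  then show ?case by (cases j) auto
qed simp

lemma ord_ge_add:
  "holo_at f b \<Longrightarrow> holo_at g b \<Longrightarrow> ord_ge k f b \<Longrightarrow> ord_ge k g b \<Longrightarrow> ord_ge k (\<lambda>z. f z + g z) b"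
  by (simp add: ord_ge_iff_mdiff holo_at_add mdiff_add)

lemma ord_ge_cmult: "holo_at f b \<Longrightarrow> ord_ge k f b \<Longrightarrow> ord_ge k (\<lambda>z. c * f z) b"
  by (simp add: ord_ge_iff_mdiff holo_at_cmult mdiff_cmult)

lemma ord_ge_zero [simp]: "ord_ge k (\<lambda>_. 0) b"
  by (simp add: ord_ge_iff_mdiff mdiff_const_zero)

lemma ord_ge_sum:
  assumes "\<And>j. j \<in> J \<Longrightarrow> holo_at (f j) b" "\<And>j. j \<in> J \<Longrightarrow> ord_ge k (f j) b"
  shows "ord_ge k (\<lambda>z. \<Sum>j\<in>J. f j z) b"
  using assms by (simp add: ord_ge_iff_mdiff holo_at_sum mdiff_sum)

text \<open>Induction on the sum of the two orders: in each summand of the product rule one factor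
  loses one order. If the differentiated factor has prescribed order 0, it has nothing to lose, and
  the order of the other factor is lowered instead.\<close>

lemma ord_ge_mult:
  assumes "holo_at f b" "holo_at g b" "ord_ge k f b" "ord_ge l g b"
  shows "ord_ge (k + l) (\<lambda>z. f z * g z) b"
  using assms
proof (induction "k + l" arbitrary: k l f g)
  case (Suc n)
  have "ord_ge n (pdiff i (\<lambda>z. f z * g z)) b" for i
  proof -
    have "ord_ge n (\<lambda>z. pdiff i f z * g z) b"
    proof (cases k)
      case 0
      then have "l = Suc n" using Suc.hyps(2) by simp
      then have "ord_ge n g b" using Suc.prems(4) ord_ge_mono[of "Suc n" g b n] by simp
      then show ?thesis using Suc.hyps(1)[of 0 n "pdiff i f" g] Suc.prems
        by (simp add: holo_at_pdiff)
    next
      case (Suc k')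
      then show ?thesis using Suc.hyps(1)[of k' l "pdiff i f" g] Suc.hyps(2) Suc.prems
        by (simp add: holo_at_pdiff)
    qed
    moreover have "ord_ge n (\<lambda>z. f z * pdiff i g z) b"
    proof (cases l)
      case 0
      then have "k = Suc n" using Suc.hyps(2) by simp
      then have "ord_ge n f b" using Suc.prems(3) ord_ge_mono[of "Suc n" f b n] by simp
      then show ?thesis using Suc.hyps(1)[of n 0 f "pdiff i g"] Suc.prems
        by (simp add: holo_at_pdiff)
    next
      case (Suc l')
      then show ?thesis using Suc.hyps(1)[of k l' f "pdiff i g"] Suc.hyps(2) Suc.prems
        by (simp add: holo_at_pdiff)
    qed
    ultimately have "ord_ge n (\<lambda>z. pdiff i f z * g z + f z * pdiff i g z) b"
      using Suc.prems by (intro ord_ge_add holo_at_mult holo_at_pdiff)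
    then show ?thesis
      using ord_ge_cong[OF pdiff_mult_ev[OF Suc.prems(1,2)]] by blast
  qed
  moreover have "f b * g b = 0"
    using Suc.prems(3,4) Suc.hyps(2) by (cases k; cases l) auto
  ultimately show ?case using Suc.hyps(2)[symmetric] by simp
qed simp

text \<open>Induction through the chain rule: \<open>pdiff j F\<close> has order one less, and the
  Jacobian factor enters with order 0.\<close>

lemma ord_ge_compose:
  assumes "holo_at F (\<Phi> b)" "holo_map_at \<Phi> b" "ord_ge k F (\<Phi> b)"
  shows "ord_ge k (\<lambda>t. F (\<Phi> t)) b"
  using assms(1,3)
proof (induction k arbitrary: F)
  case (Suc k)
  have hol: "holo_at (\<lambda>t. pdiff j F (\<Phi> t)) b" "holo_at (pdiff i (\<lambda>t. \<Phi> t $ j)) b" for i j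
    using holo_at_compose(1)[OF holo_at_pdiff[OF Suc.prems(1)] assms(2)] assms(2)
    by (auto simp: holo_map_at_def holo_at_pdiff)
  have "ord_ge k (pdiff i (\<lambda>t. F (\<Phi> t))) b" for i
  proof -
    have "ord_ge k (\<lambda>t. \<Sum>j\<in>UNIV. pdiff j F (\<Phi> t) * pdiff i (\<lambda>t. \<Phi> t $ j) t) b"
    proof (intro ord_ge_sum holo_at_mult hol)
      fix j
      have "ord_ge k (\<lambda>t. pdiff j F (\<Phi> t)) b"
        using Suc by (auto intro: holo_at_pdiff)
      then show "ord_ge k (\<lambda>t. pdiff j F (\<Phi> t) * pdiff i (\<lambda>t. \<Phi> t $ j) t) b"
        using ord_ge_mult[OF hol, where l = 0] by auto
    qed
    then show ?thesis using ord_ge_cong[OF holo_at_compose(2)[OF Suc.prems(1) assms(2)]] by blast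
  qed
  then show ?case using Suc.prems by auto
qed simp

section \<open>The identity theorem\<close>

lemma bounded_linear_scale_vec: "bounded_linear (\<lambda>w. w *s (u :: complex ^ 'n::finite))"
  by (rule linear_conv_bounded_linear[THEN iffD1], rule linearI) (auto simp: vec_eq_iff algebra_simps)

lemma has_field_derivative_line:
  fixes f :: "complex ^ 'n::finite \<Rightarrow> complex"
  assumes "complex_diff_at f (b + w *s u)"
  shows "((\<lambda>w. f (b + w *s u)) has_field_derivative (\<Sum>i\<in>UNIV. u $ i * pdiff i f (b + w *s u))) (at w)"
proof -
  have l: "((\<lambda>w. b + w *s u) has_derivative (\<lambda>w. w *s u)) (at w)"
    using bounded_linear_imp_has_derivative[OF bounded_linear_scale_vec]
    by (auto intro!: derivative_eq_intros)
  from has_derivative_compose[OF l complex_diff_at_has_derivative[OF assms]]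
  have "((\<lambda>w. f (b + w *s u)) has_derivative (\<lambda>v. \<Sum>i\<in>UNIV. (v *s u) $ i * pdiff i f (b + w *s u))) (at w)" .
  moreover have "(\<lambda>v. \<Sum>i\<in>UNIV. (v *s u) $ i * pdiff i f (b + w *s u)) = (*) (\<Sum>i\<in>UNIV. u $ i * pdiff i f (b + w *s u))"
    by (rule ext) (simp only: clinear_pdiff, simp add: mult.commute)
  ultimately show ?thesis unfolding has_field_derivative_def by argo
qed

text \<open>The restriction of \<open>f\<close> to a complex line through \<open>b\<close> has vanishing derivatives of all orders
  at \<open>b\<close>, which reduces the identity theorem to one variable.\<close>

lemma higher_deriv_line_zero:
  assumes "open W" "open S" "\<And>w. w \<in> S \<Longrightarrow> b + w *s u \<in> W" "0 \<in> S"
    "holo_fun_on f W" "\<And>k. ord_ge k f b"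
  shows "(deriv ^^ k) (\<lambda>w. f (b + w *s u)) 0 = 0"
  using assms(5,6)
proof (induction k arbitrary: f)
  case 0
  from 0(2)[of 1] show ?case by simp
next
  case (Suc k)
  have b: "b \<in> W" using assms(3)[OF assms(4)] by simp
  \<comment> \<open>The derivative of \<open>f\<close> in direction \<open>u\<close>. It is again
    flat at b, and on the line it is the derivative of the restriction of \<open>f\<close>, so the
    induction hypothesis applies to it.\<close>
  define h where "h z = (\<Sum>i\<in>UNIV. u $ i * pdiff i f z)" for z
  have D: "((\<lambda>w. f (b + w *s u)) has_field_derivative h (b + w *s u)) (at w)" if "w \<in> S" for w
    using has_field_derivative_line[of f b w u] Suc.prems(1) assms(3)[OF that]
    by (simp add: holo_fun_on_def h_def)
  have "(deriv ^^ Suc k) (\<lambda>w. f (b + w *s u)) 0 = (deriv ^^ k) (deriv (\<lambda>w. f (b + w *s u))) 0"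
    by (simp only: funpow_Suc_right o_def)
  also have "\<dots> = (deriv ^^ k) (\<lambda>w. h (b + w *s u)) 0"
  proof (rule higher_deriv_cong_ev)
    show "\<forall>\<^sub>F w in nhds 0. deriv (\<lambda>w. f (b + w *s u)) w = h (b + w *s u)"
      unfolding eventually_nhds using assms(2,4) D by (blast intro: DERIV_imp_deriv)
  qed simp
  also have "\<dots> = 0"
  proof (rule Suc.IH)
    show "holo_fun_on h W"
      unfolding h_def holo_fun_on_def
      using complex_diff_at_sum[of UNIV "\<lambda>i z. u $ i * pdiff i f z"] pdiff_holo[OF assms(1) Suc.prems(1)]
      by (auto simp: holo_fun_on_def complex_diff_at_cmult)
    have hol: "holo_at f b" using assms(1) b Suc.prems(1) by (rule holo_atI)
    show "ord_ge k h b" for k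
      unfolding h_def using Suc.prems(2)[of "Suc k"]
      by (intro ord_ge_sum ord_ge_cmult holo_at_cmult holo_at_pdiff hol) auto
  qed
  finally show ?case .
qed

text \<open>A point z near b is reached at parameter 1 on the complex line through b with direction
  z - b. The parameters for which the line stays in the ball form a convex set, so the one-variable
  theorem carries vanishing from 0 to 1.\<close>

lemma identity_theorem:
  assumes "holo_at f b" "\<And>k. ord_ge k f b"
  shows "\<forall>\<^sub>F z in nhds b. f z = 0"
proof -
  obtain W where W: "open W" "b \<in> W" "holo_fun_on f W"
    using assms(1) by (rule holo_atE)
  then obtain r where r: "r > 0" "ball b r \<subseteq> W" by (meson openE)
  have "f z = 0" if z: "z \<in> ball b r" for z
  proof -
    define u where "u = z - b"
    define S where "S = (\<lambda>w. b + w *s u) -` ball b r"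
    note bl = bounded_linear_scale_vec[of u]
    have "continuous_on UNIV (\<lambda>w. b + w *s u)"
      by (intro continuous_on_add continuous_on_const bounded_linear.continuous_on[OF bl] continuous_on_id)
    then have S: "open S" unfolding S_def using open_vimage by blast
    have "linear (\<lambda>w. w *s u)" using bl by (rule bounded_linear.linear)
    then have "convex ((\<lambda>w. w *s u) -` ball 0 r)" by (rule convex_linear_vimage) simp
    moreover have "(\<lambda>w. w *s u) -` ball 0 r = S"
      by (auto simp: S_def dist_norm)
    ultimately have conn: "connected S" by (simp add: convex_connected)
    have S01: "0 \<in> S" "1 \<in> S" using r(1) z by (auto simp: S_def u_def)
    have SW: "\<And>w. w \<in> S \<Longrightarrow> b + w *s u \<in> W" using r(2) by (auto simp: S_def)
    have hol: "(\<lambda>w. f (b + w *s u)) holomorphic_on S"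
      unfolding holomorphic_on_def field_differentiable_def
    proof (intro ballI exI)
      fix w assume "w \<in> S"
      then have "complex_diff_at f (b + w *s u)" using W(3) SW by (simp add: holo_fun_on_def)
      then show "((\<lambda>w. f (b + w *s u)) has_field_derivative (\<Sum>i\<in>UNIV. u $ i * pdiff i f (b + w *s u))) (at w within S)"
        by (rule has_field_derivative_at_within[OF has_field_derivative_line[of f b w u]])
    qed
    have "(\<lambda>w. f (b + w *s u)) 1 = 0"
      by (rule holomorphic_fun_eq_0_on_connected[OF hol S conn _ S01])
         (rule higher_deriv_line_zero[OF W(1) S SW S01(1) W(3) assms(2)])
    then show ?thesis by (simp add: u_def)
  qed
  then show ?thesis
    unfolding eventually_nhds using r(1) by (intro exI[of _ "ball b r"]) auto
qed

subsection \<open>Taylor coefficients\<close>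

definition shift_monom :: "complex ^ 'n::finite \<Rightarrow> ('n \<Rightarrow>\<^sub>0 nat) \<Rightarrow> complex ^ 'n \<Rightarrow> complex"
  where "shift_monom b \<mu> z = (\<Prod>i\<in>UNIV. (z $ i - b $ i) ^ Poly_Mapping.lookup \<mu> i)"

lemma shift_monom_zero [simp]: "shift_monom b 0 = (\<lambda>_. 1)"
  by (simp add: shift_monom_def fun_eq_iff)

lemma shift_monom_add_unit: "shift_monom b (\<mu> + unit_index i) z = (z $ i - b $ i) * shift_monom b \<mu> z"
proof -
  have "(z $ j - b $ j) ^ Poly_Mapping.lookup (\<mu> + unit_index i) j =
     (if j = i then z $ i - b $ i else 1) * (z $ j - b $ j) ^ Poly_Mapping.lookup \<mu> j" for j
    by (auto simp: lookup_add)
  then show ?thesis by (simp add: shift_monom_def prod.distrib)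
qed

lemma holo_at_shift_monom [simp]: "holo_at (shift_monom b \<mu>) c"
  unfolding shift_monom_def by (intro holo_at_prod holo_at_power holo_at_sub) auto

lemma mdiff_shift_monom: "mdiff \<nu> (shift_monom b \<mu>) b = (if \<nu> = \<mu> then mfact \<mu> else 0)"
proof (induction \<mu> arbitrary: \<nu> rule: mindex_induct)
  case zero
  show ?case
  proof (induction \<nu> rule: mindex_induct)
    case (add \<nu> i)
    have "\<nu> + unit_index i \<noteq> 0"
      by (metis add_is_0 mdeg_add mdeg_unit mdeg_zero zero_neq_one)
    then show ?case by (simp add: mdiff_add_unit mdiff_const_zero)
  qed simp
next
  case (add \<mu> i)
  have "mdiff \<nu> (shift_monom b (\<mu> + unit_index i)) b
      = of_nat (Poly_Mapping.lookup \<nu> i) * mdiff (\<nu> - unit_index i) (shift_monom b \<mu>) b"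
    using mdiff_shift_mult[of "shift_monom b \<mu>" b \<nu> i] by (simp add: shift_monom_add_unit[abs_def])
  also have "\<dots> = (if \<nu> = \<mu> + unit_index i then mfact (\<mu> + unit_index i) else 0)"
  proof (cases "Poly_Mapping.lookup \<nu> i = 0")
    case True
    then have "\<nu> \<noteq> \<mu> + unit_index i" by (auto simp: lookup_add)
    then show ?thesis using True by simp
  next
    case False
    then have "\<nu> - unit_index i = \<mu> \<longleftrightarrow> \<nu> = \<mu> + unit_index i"
      using unit_index_minus_add[OF False] by auto
    then show ?thesis by (auto simp: add mfact_add_unit lookup_add)
  qed
  finally show ?case .
qed

lemma taylor_coeff_cong: "\<forall>\<^sub>F z in nhds b. f z = g z \<Longrightarrow> taylor_coeff f b \<nu> = taylor_coeff g b \<nu>"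
  by (simp add: taylor_coeff_def mdiff_cong)

lemma taylor_coeff_add:
  "holo_at f b \<Longrightarrow> holo_at g b \<Longrightarrow> taylor_coeff (\<lambda>z. f z + g z) b \<nu> = taylor_coeff f b \<nu> + taylor_coeff g b \<nu>"
  by (simp add: taylor_coeff_def mdiff_add add_divide_distrib)

lemma taylor_coeff_cmult:
  "holo_at f b \<Longrightarrow> taylor_coeff (\<lambda>z. c * f z) b \<nu> = c * taylor_coeff f b \<nu>"
  by (simp add: taylor_coeff_def mdiff_cmult)

lemma taylor_coeff_diff:
  "holo_at f b \<Longrightarrow> holo_at g b \<Longrightarrow> taylor_coeff (\<lambda>z. f z - g z) b \<nu> = taylor_coeff f b \<nu> - taylor_coeff g b \<nu>"
  using taylor_coeff_add[of f b "\<lambda>z. (-1) * g z"] taylor_coeff_cmult[of g b "-1"] holo_at_cmult[of g b "-1"]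
  by simp

lemma taylor_coeff_sum:
  "(\<And>j. j \<in> J \<Longrightarrow> holo_at (f j) b) \<Longrightarrow> taylor_coeff (\<lambda>z. \<Sum>j\<in>J. f j z) b \<nu> = (\<Sum>j\<in>J. taylor_coeff (f j) b \<nu>)"
  by (simp add: taylor_coeff_def mdiff_sum sum_divide_distrib)

lemma taylor_coeff_shift_monom: "taylor_coeff (shift_monom b \<mu>) b \<nu> = (if \<nu> = \<mu> then 1 else 0)"
  by (simp add: taylor_coeff_def mdiff_shift_monom)

lemma ord_ge_iff_taylor:
  "holo_at f b \<Longrightarrow> ord_ge k f b \<longleftrightarrow> (\<forall>\<nu>. mdeg \<nu> < k \<longrightarrow> taylor_coeff f b \<nu> = 0)"
  by (simp add: taylor_coeff_def ord_ge_iff_mdiff)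

lemma taylor_coeff_pdiff:
  "holo_at f b \<Longrightarrow> taylor_coeff (pdiff i f) b \<nu>
    = of_nat (Suc (Poly_Mapping.lookup \<nu> i)) * taylor_coeff f b (\<nu> + unit_index i)"
  by (simp add: taylor_coeff_def mdiff_add_unit mfact_add_unit field_simps del: of_nat_Suc)

definition taylor_trunc :: "nat \<Rightarrow> (complex ^ 'n::finite \<Rightarrow> complex) \<Rightarrow> complex ^ 'n \<Rightarrow> complex ^ 'n \<Rightarrow> complex"
  where "taylor_trunc N f b z = (\<Sum>\<mu> | mdeg \<mu> \<le> N. taylor_coeff f b \<mu> * shift_monom b \<mu> z)"

lemma holo_at_taylor_trunc [simp]: "holo_at (taylor_trunc N f b) c"
  unfolding taylor_trunc_def by (intro holo_at_sum holo_at_cmult) simp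

lemma taylor_coeff_lincomb:
  "finite A \<Longrightarrow> taylor_coeff (\<lambda>z. \<Sum>\<mu>\<in>A. c \<mu> * shift_monom b \<mu> z) b \<nu> = (if \<nu> \<in> A then c \<nu> else 0)"
  by (simp add: taylor_coeff_sum holo_at_cmult taylor_coeff_cmult taylor_coeff_shift_monom
      if_distrib[of "\<lambda>x. _ * x"] cong: if_cong)

lemma taylor_coeff_taylor_trunc:
  "taylor_coeff (taylor_trunc N f b) b \<nu> = (if mdeg \<nu> \<le> N then taylor_coeff f b \<nu> else 0)"
  unfolding taylor_trunc_def[abs_def] by (simp add: taylor_coeff_lincomb)

text \<open>This replaces convergence of the Taylor series: a polynomial of degree at most N does
  not see a remainder of order above N.\<close>

lemma ord_ge_taylor_remainder:
  "holo_at f b \<Longrightarrow> ord_ge (Suc N) (\<lambda>z. f z - taylor_trunc N f b z) b"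
  by (simp add: ord_ge_iff_taylor holo_at_sub taylor_coeff_diff taylor_coeff_taylor_trunc del: ord_ge.simps)

subsection \<open>The sesquilinear pairing\<close>

text \<open>The second argument is a bare family of coefficients, so that the same pairing takes the
  Taylor coefficients of a function and the coefficients of a polynomial. In the latter case it is
  the Fischer inner product.\<close>

definition pair :: "'n::finite cpoly \<Rightarrow> (('n \<Rightarrow>\<^sub>0 nat) \<Rightarrow> complex) \<Rightarrow> complex"
  where "pair p c = (\<Sum>\<nu>\<in>Poly_Mapping.keys p. mfact \<nu> * Poly_Mapping.lookup p \<nu> * cnj (c \<nu>))"

lemma pair_superset:
  assumes "finite K" "Poly_Mapping.keys p \<subseteq> K"
  shows "pair p c = (\<Sum>\<nu>\<in>K. mfact \<nu> * Poly_Mapping.lookup p \<nu> * cnj (c \<nu>))"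
  unfolding pair_def by (rule sum.mono_neutral_left) (use assms in \<open>auto simp: in_keys_iff\<close>)

lemma pair_zero [simp]: "pair 0 c = 0"
  by (simp add: pair_def)

lemma pair_add: "pair (p + q) c = pair p c + pair q c"
proof -
  have "Poly_Mapping.keys (p + q) \<subseteq> Poly_Mapping.keys p \<union> Poly_Mapping.keys q"
    by (rule keys_add)
  then show ?thesis
    by (simp add: pair_superset[of "Poly_Mapping.keys p \<union> Poly_Mapping.keys q"] lookup_add
        sum.distrib[symmetric] algebra_simps)
qed

lemma pair_scale: "pair (poly_scale a p) c = a * pair p c"
proof -
  have "Poly_Mapping.keys (poly_scale a p) \<subseteq> Poly_Mapping.keys p"
    by (auto simp: in_keys_iff)
  then show ?thesis
    by (simp add: pair_superset[of "Poly_Mapping.keys p"] sum_distrib_left algebra_simps)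
qed

lemma pair_sum: "pair (\<Sum>j\<in>J. p j) c = (\<Sum>j\<in>J. pair (p j) c)"
  by (induction J rule: infinite_finite_induct) (auto simp: pair_add)

lemma pair_single: "pair (Poly_Mapping.single \<nu> a) c = mfact \<nu> * a * cnj (c \<nu>)"
  by (simp add: pair_def)

lemma pair_add_right: "pair p (\<lambda>\<nu>. c \<nu> + e \<nu>) = pair p c + pair p e"
  by (simp add: pair_def sum.distrib algebra_simps)

lemma pair_diff_right: "pair p (\<lambda>\<nu>. c \<nu> - e \<nu>) = pair p c - pair p e"
  by (simp add: pair_def sum_subtractf algebra_simps)

lemma pair_scale_right: "pair p (\<lambda>\<nu>. a * c \<nu>) = cnj a * pair p c"
  by (simp add: pair_def sum_distrib_left algebra_simps)

lemma pair_sum_right: "pair p (\<lambda>\<nu>. \<Sum>j\<in>J. c j \<nu>) = (\<Sum>j\<in>J. pair p (c j))"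
  by (simp add: pair_def sum_distrib_left sum_distrib_right cnj_sum) (rule sum.swap)

lemma pair_cong: "(\<And>\<nu>. \<nu> \<in> Poly_Mapping.keys p \<Longrightarrow> c \<nu> = e \<nu>) \<Longrightarrow> pair p c = pair p e"
  by (simp add: pair_def)

lemma pair_eq_zero: "(\<And>\<nu>. \<nu> \<in> Poly_Mapping.keys p \<Longrightarrow> c \<nu> = 0) \<Longrightarrow> pair p c = 0"
  by (simp add: pair_def)

text \<open>The weights \<nu>! are positive, so a polynomial paired with its own coefficients gives
  a sum of nonnegative terms.\<close>

lemma pair_self_eq_0:
  assumes "pair p (Poly_Mapping.lookup p) = 0"
  shows "p = 0"
proof -
  define r where "r \<nu> = (\<Prod>i\<in>UNIV. fact (Poly_Mapping.lookup \<nu> i)) * (norm (Poly_Mapping.lookup p \<nu>))\<^sup>2" for \<nu>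
  have "mfact \<nu> * Poly_Mapping.lookup p \<nu> * cnj (Poly_Mapping.lookup p \<nu>) = of_real (r \<nu>)" for \<nu>
    by (simp add: r_def mfact_real mult.assoc complex_norm_square[symmetric] del: of_real_prod)
  then have "of_real (\<Sum>\<nu>\<in>Poly_Mapping.keys p. r \<nu>) = (0 :: complex)"
    using assms by (simp add: pair_def)
  then have "(\<Sum>\<nu>\<in>Poly_Mapping.keys p. r \<nu>) = 0" by (simp only: of_real_eq_0_iff)
  moreover have "r \<nu> \<ge> 0" for \<nu> by (simp add: r_def prod_nonneg)
  ultimately have "\<forall>\<nu>\<in>Poly_Mapping.keys p. r \<nu> = 0"
    by (subst (asm) sum_nonneg_eq_0_iff) auto
  then show ?thesis by (intro poly_mapping_eqI) (auto simp: r_def in_keys_iff)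
qed

lemma pair_span_zero:
  assumes "\<And>q. q \<in> B \<Longrightarrow> pair q c = 0" "q \<in> cpoly.span B"
  shows "pair q c = 0"
  using assms(2) by (induction rule: cpoly.span_induct_alt) (auto simp: pair_add pair_scale assms(1))

text \<open>Gram-Schmidt, one vector at a time. The family \<open>c\<close> that is projected may
  have infinite support, since elements of the span meet only finitely many of its entries.\<close>

lemma pair_projection:
  assumes "finite B"
  shows "\<exists>z\<in>cpoly.span B. \<forall>q\<in>cpoly.span B. pair q (\<lambda>\<nu>. c \<nu> - Poly_Mapping.lookup z \<nu>) = 0"
  using assms
proof (induction B arbitrary: c)
  case empty
  then show ?case by simp
next
  case (insert b B)
  obtain z where z: "z \<in> cpoly.span B" "\<And>q. q \<in> cpoly.span B \<Longrightarrow> pair q (\<lambda>\<nu>. c \<nu> - Poly_Mapping.lookup z \<nu>) = 0"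
    using insert.IH[of c] by blast
  obtain w where w: "w \<in> cpoly.span B"
    "\<And>q. q \<in> cpoly.span B \<Longrightarrow> pair q (\<lambda>\<nu>. Poly_Mapping.lookup b \<nu> - Poly_Mapping.lookup w \<nu>) = 0"
    using insert.IH[of "Poly_Mapping.lookup b"] by blast
  define e where "e = b - w"
  have e: "pair q (Poly_Mapping.lookup e) = 0" if "q \<in> cpoly.span B" for q
    using w(2)[OF that] by (simp add: e_def lookup_minus[abs_def])
  show ?case
  proof (cases "e = 0")
    case True
    then have "b \<in> cpoly.span B" using w(1) by (simp add: e_def)
    then show ?thesis using z by (metis cpoly.span_redundant)
  next
    case False
    \<comment> \<open>Chosen so that the new residual pairs to 0 with \<open>b\<close>. The
      conjugate compensates for conjugate-linearity in the second argument; the denominator is the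
      squared norm of \<open>e\<close>, because \<open>w\<close> is orthogonal to
      \<open>e\<close>.\<close>
    define \<alpha> where "\<alpha> = cnj (pair b (\<lambda>\<nu>. c \<nu> - Poly_Mapping.lookup z \<nu>) / pair b (Poly_Mapping.lookup e))"
    have "b = e + w" by (simp add: e_def)
    then have "pair b (Poly_Mapping.lookup e) = pair e (Poly_Mapping.lookup e) + pair w (Poly_Mapping.lookup e)"
      by (metis pair_add)
    also have "pair w (Poly_Mapping.lookup e) = 0" using e w(1) by blast
    finally have ne: "pair b (Poly_Mapping.lookup e) \<noteq> 0" using pair_self_eq_0 False by auto
    define z' where "z' = z + poly_scale \<alpha> e"
    have B: "cpoly.span B \<subseteq> cpoly.span (insert b B)" by (rule cpoly.span_mono) auto
    have "z' \<in> cpoly.span (insert b B)"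
      unfolding z'_def e_def using z(1) w(1) B
      by (intro cpoly.span_add cpoly.span_scale cpoly.span_diff) (auto intro: cpoly.span_base)
    moreover have eq: "pair q (\<lambda>\<nu>. c \<nu> - Poly_Mapping.lookup z' \<nu>)
       = pair q (\<lambda>\<nu>. c \<nu> - Poly_Mapping.lookup z \<nu>) - cnj \<alpha> * pair q (Poly_Mapping.lookup e)" for q
      by (simp add: z'_def lookup_add pair_diff_right pair_add_right pair_scale_right)
    have "pair q (\<lambda>\<nu>. c \<nu> - Poly_Mapping.lookup z' \<nu>) = 0" if "q \<in> insert b B" for q
      using that eq[of q] z(2)[of q] e[of q] ne by (auto simp: \<alpha>_def cpoly.span_base)
    ultimately show ?thesis using pair_span_zero by blast
  qed
qed

text \<open>The separating element is what remains of \<open>q\<close> after projection onto the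
  span; it pairs with \<open>q\<close> as with itself.\<close>

lemma pair_separate:
  assumes "finite B" "q \<notin> cpoly.span B"
  obtains f where "\<And>p. p \<in> cpoly.span B \<Longrightarrow> pair p (Poly_Mapping.lookup f) = 0"
    "pair q (Poly_Mapping.lookup f) \<noteq> 0"
proof -
  obtain z where z: "z \<in> cpoly.span B"
    "\<And>p. p \<in> cpoly.span B \<Longrightarrow> pair p (\<lambda>\<nu>. Poly_Mapping.lookup q \<nu> - Poly_Mapping.lookup z \<nu>) = 0"
    using pair_projection[OF assms(1)] by blast
  define f where "f = q - z"
  have f: "pair p (Poly_Mapping.lookup f) = 0" if "p \<in> cpoly.span B" for p
    using z(2)[OF that] by (simp add: f_def lookup_minus[abs_def])
  have "q = f + z" by (simp add: f_def)
  then have "pair q (Poly_Mapping.lookup f) = pair f (Poly_Mapping.lookup f) + pair z (Poly_Mapping.lookup f)"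
    by (metis pair_add)
  moreover have "pair z (Poly_Mapping.lookup f) = 0" using f z(1) by blast
  moreover have "f \<noteq> 0" using assms(2) z(1) by (auto simp: f_def)
  ultimately have "pair q (Poly_Mapping.lookup f) \<noteq> 0" using pair_self_eq_0[of f] by auto
  with f show thesis by (rule that)
qed

definition trunc_poly :: "('n \<Rightarrow>\<^sub>0 nat) set \<Rightarrow> (('n::finite \<Rightarrow>\<^sub>0 nat) \<Rightarrow> complex) \<Rightarrow> 'n cpoly"
  where "trunc_poly K c = (\<Sum>\<nu>\<in>K. Poly_Mapping.single \<nu> (c \<nu>))"

lemma lookup_trunc_poly:
  "finite K \<Longrightarrow> Poly_Mapping.lookup (trunc_poly K c) \<nu> = (if \<nu> \<in> K then c \<nu> else 0)"
  by (simp add: trunc_poly_def lookup_sum lookup_single when_def)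

lemma keys_trunc_poly: "finite K \<Longrightarrow> Poly_Mapping.keys (trunc_poly K c) \<subseteq> K"
  by (auto simp: in_keys_iff lookup_trunc_poly split: if_splits)

lemma pair_trunc_poly: "finite K \<Longrightarrow> pair (trunc_poly K c) e = (\<Sum>\<nu>\<in>K. mfact \<nu> * c \<nu> * cnj (e \<nu>))"
  by (simp add: trunc_poly_def pair_sum pair_single)

lemma polys_le_span_finite:
  "polys_le N \<subseteq> cpoly.span ((\<lambda>\<nu>. Poly_Mapping.single \<nu> 1) ` {\<nu>::'n::finite \<Rightarrow>\<^sub>0 nat. mdeg \<nu> \<le> N})"
proof
  fix p :: "'n cpoly" assume "p \<in> polys_le N"
  then have "p = (\<Sum>\<nu> | mdeg \<nu> \<le> N. poly_scale (Poly_Mapping.lookup p \<nu>) (Poly_Mapping.single \<nu> 1))"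
    by (intro poly_mapping_eqI) (auto simp: lookup_sum lookup_single when_def polys_le_def in_keys_iff
        if_distrib[of "\<lambda>x. _ * x"] cong: if_cong)
  then show "p \<in> cpoly.span ((\<lambda>\<nu>. Poly_Mapping.single \<nu> 1) ` {\<nu>. mdeg \<nu> \<le> N})"
    by (smt (verit) cpoly.span_base cpoly.span_scale cpoly.span_sum image_eqI)
qed

lemma subspace_polys_le_finite_span:
  assumes "cpoly.subspace L" "L \<subseteq> polys_le N"
  obtains B where "finite B" "L = cpoly.span B"
proof -
  obtain B where B: "B \<subseteq> L" "cpoly.independent B" "L \<subseteq> cpoly.span B"
    using cpoly.maximal_independent_subset[of L] by blast
  have "finite B"
    using cpoly.independent_span_bound[of "(\<lambda>\<nu>. Poly_Mapping.single \<nu> 1) ` {\<nu>. mdeg \<nu> \<le> N}" B]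
      B assms(2) polys_le_span_finite[of N] by auto
  moreover have "L = cpoly.span B"
    using B assms(1) by (meson cpoly.span_minimal subset_antisym)
  ultimately show thesis using that by blast
qed

lemma subspace_polys_le: "cpoly.subspace (polys_le N :: 'n::finite cpoly set)"
proof (rule cpoly.subspaceI)
  fix x y :: "'n cpoly" assume "x \<in> polys_le N" "y \<in> polys_le N"
  then show "x + y \<in> polys_le N"
    using keys_add[of x y] unfolding polys_le_def by blast
qed (auto simp: polys_le_def in_keys_iff)

section \<open>Polynomials as functions of t - b, and the adjoint of differentiation\<close>

definition shift_poly :: "complex ^ 'n::finite \<Rightarrow> 'n cpoly \<Rightarrow> complex ^ 'n \<Rightarrow> complex"
  where "shift_poly b q z = (\<Sum>\<mu>\<in>Poly_Mapping.keys q. Poly_Mapping.lookup q \<mu> * shift_monom b \<mu> z)"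

lemma holo_at_shift_poly [simp]: "holo_at (shift_poly b q) c"
  unfolding shift_poly_def by (intro holo_at_sum holo_at_cmult) simp

lemma taylor_coeff_shift_poly: "taylor_coeff (shift_poly b q) b = Poly_Mapping.lookup q"
proof
  fix \<nu> show "taylor_coeff (shift_poly b q) b \<nu> = Poly_Mapping.lookup q \<nu>"
    unfolding shift_poly_def[abs_def] by (simp add: taylor_coeff_lincomb in_keys_iff)
qed

text \<open>Coefficientwise the truncated subtraction disappears: each \<mu> has the single source
  \<mu> + e_i, and terms with \<nu>_i = 0 carry the factor 0.\<close>

lemma lookup_poly_deriv:
  "Poly_Mapping.lookup (poly_deriv i p) \<mu> = of_nat (Suc (Poly_Mapping.lookup \<mu> i)) * Poly_Mapping.lookup p (\<mu> + unit_index i)"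
proof -
  have "Poly_Mapping.lookup (poly_deriv i p) \<mu> =
    (\<Sum>\<nu>\<in>Poly_Mapping.keys p. (if \<nu> - unit_index i = \<mu> then of_nat (Poly_Mapping.lookup \<nu> i) * Poly_Mapping.lookup p \<nu> else 0))"
    by (simp add: poly_deriv_def lookup_sum lookup_single when_def unit_index_def)
  also have "\<dots> = (\<Sum>\<nu>\<in>Poly_Mapping.keys p. (if \<nu> = \<mu> + unit_index i then of_nat (Suc (Poly_Mapping.lookup \<mu> i)) * Poly_Mapping.lookup p (\<mu> + unit_index i) else 0))"
  proof (rule sum.cong)
    fix \<nu>
    show "(if \<nu> - unit_index i = \<mu> then of_nat (Poly_Mapping.lookup \<nu> i) * Poly_Mapping.lookup p \<nu> else 0) =
      (if \<nu> = \<mu> + unit_index i then of_nat (Suc (Poly_Mapping.lookup \<mu> i)) * Poly_Mapping.lookup p (\<mu> + unit_index i) else 0)"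
    proof (cases "Poly_Mapping.lookup \<nu> i = 0")
      case True
      then have "\<nu> \<noteq> \<mu> + unit_index i" by (auto simp: lookup_add)
      then show ?thesis using True by simp
    next
      case False
      then have "\<nu> - unit_index i = \<mu> \<longleftrightarrow> \<nu> = \<mu> + unit_index i"
        using unit_index_minus_add[OF False] by auto
      then show ?thesis by (auto simp: lookup_add)
    qed
  qed simp
  also have "\<dots> = of_nat (Suc (Poly_Mapping.lookup \<mu> i)) * Poly_Mapping.lookup p (\<mu> + unit_index i)"
    by (simp add: in_keys_iff del: of_nat_Suc)
  finally show ?thesis .
qed

lemma poly_deriv_zero [simp]: "poly_deriv i 0 = 0"
  by (simp add: poly_deriv_def)

lemma poly_deriv_add: "poly_deriv i (p + q) = poly_deriv i p + poly_deriv i q"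
  by (rule poly_mapping_eqI) (simp add: lookup_poly_deriv lookup_add algebra_simps)

lemma poly_deriv_scale: "poly_deriv i (poly_scale c p) = poly_scale c (poly_deriv i p)"
  by (rule poly_mapping_eqI) (simp add: lookup_poly_deriv algebra_simps)

text \<open>The factorial weights are what makes the two operators adjoint: \<nu>! = \<nu>_i (\<nu>
  - e_i)! for \<nu>_i > 0.\<close>

lemma pair_poly_deriv:
  assumes "holo_at f b"
  shows "pair (poly_deriv i p) (taylor_coeff f b) = pair p (taylor_coeff (\<lambda>z. (z $ i - b $ i) * f z) b)"
proof -
  have "pair (poly_deriv i p) (taylor_coeff f b) = (\<Sum>\<nu>\<in>Poly_Mapping.keys p. mfact (\<nu> - unit_index i)
      * (of_nat (Poly_Mapping.lookup \<nu> i) * Poly_Mapping.lookup p \<nu>) * cnj (taylor_coeff f b (\<nu> - unit_index i)))"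
    by (simp add: poly_deriv_def pair_sum pair_single unit_index_def)
  also have "\<dots> = pair p (taylor_coeff (\<lambda>z. (z $ i - b $ i) * f z) b)"
    unfolding pair_def
  proof (rule sum.cong)
    fix \<nu>
    show "mfact (\<nu> - unit_index i) * (of_nat (Poly_Mapping.lookup \<nu> i) * Poly_Mapping.lookup p \<nu>) * cnj (taylor_coeff f b (\<nu> - unit_index i))
      = mfact \<nu> * Poly_Mapping.lookup p \<nu> * cnj (taylor_coeff (\<lambda>z. (z $ i - b $ i) * f z) b \<nu>)"
    proof (cases "Poly_Mapping.lookup \<nu> i = 0")
      case True
      then show ?thesis using mdiff_shift_mult[OF assms, of \<nu> i] by (simp add: taylor_coeff_def)
    next
      case False
      have "mfact \<nu> = of_nat (Poly_Mapping.lookup \<nu> i) * mfact (\<nu> - unit_index i)"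
        using mfact_add_unit[of "\<nu> - unit_index i" i] False
        by (simp add: unit_index_minus_add lookup_minus)
      moreover have "mfact (\<nu> - unit_index i) \<noteq> 0" "of_nat (Poly_Mapping.lookup \<nu> i) \<noteq> (0::complex)"
        using False by auto
      ultimately show ?thesis using mdiff_shift_mult[OF assms, of \<nu> i]
        by (simp add: taylor_coeff_def)
    qed
  qed simp
  finally show ?thesis .
qed

subsection \<open>Annihilators and ideals\<close>

definition fun_perp :: "complex ^ 'n::finite \<Rightarrow> 'n cpoly set \<Rightarrow> (complex ^ 'n \<Rightarrow> complex) set"
  where "fun_perp b L = {f. holo_at f b \<and> (\<forall>p\<in>L. pair p (taylor_coeff f b) = 0)}"

text \<open>Only the absorption property of an ideal; the additive part holds for every
  annihilator.\<close>

definition mult_closed :: "complex ^ 'n::finite \<Rightarrow> (complex ^ 'n \<Rightarrow> complex) set \<Rightarrow> bool"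
  where "mult_closed b M \<longleftrightarrow> (\<forall>f\<in>M. \<forall>g. holo_at g b \<longrightarrow> (\<lambda>z. g z * f z) \<in> M)"

text \<open>By adjointness the annihilator absorbs the linear factors t_i - b_i, hence all monomials
  in t - b. A general multiplier is replaced by a Taylor polynomial whose degree is chosen for each
  p separately.\<close>

lemma D_invariant_imp_mult_closed:
  fixes b :: "complex ^ 'n::finite"
  assumes "D_invariant L"
  shows "mult_closed b (fun_perp b L)"
  unfolding mult_closed_def
proof (intro ballI allI impI)
  fix f g assume f: "f \<in> fun_perp b L" and g: "holo_at g b"
  have hf: "holo_at f b" using f by (simp add: fun_perp_def)
  have mono: "(\<lambda>z. shift_monom b \<mu> z * f z) \<in> fun_perp b L" for \<mu>
  proof (induction \<mu> rule: mindex_induct)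
    case zero
    then show ?case using f by simp
  next
    case (add \<mu> i)
    define h where "h z = shift_monom b \<mu> z * f z" for z
    have h: "h \<in> fun_perp b L" using add by (simp add: h_def[abs_def])
    then have hol: "holo_at h b" by (simp add: fun_perp_def)
    have "pair p (taylor_coeff (\<lambda>z. (z $ i - b $ i) * h z) b) = 0" if "p \<in> L" for p
      using pair_poly_deriv[OF hol, of i p] assms that h by (simp add: D_invariant_def fun_perp_def)
    moreover have "holo_at (\<lambda>z. (z $ i - b $ i) * h z) b"
      using hol by (intro holo_at_mult holo_at_sub) auto
    ultimately have "(\<lambda>z. (z $ i - b $ i) * h z) \<in> fun_perp b L" by (simp add: fun_perp_def)
    then show ?case by (simp add: h_def shift_monom_add_unit mult.assoc)
  qed
  have "pair p (taylor_coeff (\<lambda>z. g z * f z) b) = 0" if p: "p \<in> L" for p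
  proof -
    \<comment> \<open>A bound for the degree of \<open>p\<close>; the inserted 0 covers p = 0. The
      product of \<open>f\<close> with the Taylor remainder of \<open>g\<close> has order above
      \<open>N\<close> and so pairs to zero with \<open>p\<close>.\<close>
    define N where "N = Max (insert 0 (mdeg ` Poly_Mapping.keys p))"
    have N: "mdeg \<nu> \<le> N" if "\<nu> \<in> Poly_Mapping.keys p" for \<nu>
      unfolding N_def using that by (intro Max_ge) auto
    define R where "R z = g z - taylor_trunc N g b z" for z
    have R: "holo_at R b" "ord_ge (Suc N) R b"
      unfolding R_def using g ord_ge_taylor_remainder[OF g, of N] by (auto intro: holo_at_sub)
    have Rf: "ord_ge (Suc N) (\<lambda>z. R z * f z) b"
      using ord_ge_mult[OF R(1) hf R(2), of 0] by simp
    have hRf: "holo_at (\<lambda>z. R z * f z) b" by (intro holo_at_mult R hf)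
    have hm: "holo_at (\<lambda>z. taylor_coeff g b \<mu> * (shift_monom b \<mu> z * f z)) b" for \<mu>
      by (intro holo_at_mult holo_at_cmult hf) simp
    have hm': "holo_at (\<lambda>z. shift_monom b \<mu> z * f z) b" for \<mu>
      by (intro holo_at_mult hf) simp
    have eq: "g z * f z = R z * f z + (\<Sum>\<mu> | mdeg \<mu> \<le> N. taylor_coeff g b \<mu> * (shift_monom b \<mu> z * f z))" for z
      by (simp add: R_def taylor_trunc_def sum_distrib_left algebra_simps)
    have "pair p (taylor_coeff (\<lambda>z. g z * f z) b) =
       pair p (\<lambda>\<nu>. taylor_coeff (\<lambda>z. R z * f z) b \<nu> + (\<Sum>\<mu> | mdeg \<mu> \<le> N. taylor_coeff g b \<mu> * taylor_coeff (\<lambda>z. shift_monom b \<mu> z * f z) b \<nu>))"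
      by (rule pair_cong) (unfold eq, simp add: taylor_coeff_add[OF hRf holo_at_sum[OF hm]] taylor_coeff_sum[OF hm] taylor_coeff_cmult[OF hm'])
    also have "\<dots> = pair p (taylor_coeff (\<lambda>z. R z * f z) b) +
        (\<Sum>\<mu> | mdeg \<mu> \<le> N. cnj (taylor_coeff g b \<mu>) * pair p (taylor_coeff (\<lambda>z. shift_monom b \<mu> z * f z) b))"
      by (simp add: pair_add_right pair_sum_right pair_scale_right)
    also have "pair p (taylor_coeff (\<lambda>z. R z * f z) b) = 0"
      using Rf N by (intro pair_eq_zero) (simp add: ord_ge_iff_taylor[OF hRf] less_Suc_eq_le del: ord_ge.simps)
    also have "(\<Sum>\<mu> | mdeg \<mu> \<le> N. cnj (taylor_coeff g b \<mu>) * pair p (taylor_coeff (\<lambda>z. shift_monom b \<mu> z * f z) b)) = 0"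
      using mono p by (intro sum.neutral) (auto simp: fun_perp_def)
    finally show ?thesis by simp
  qed
  then show "(\<lambda>z. g z * f z) \<in> fun_perp b L"
    using hf g by (simp add: fun_perp_def holo_at_mult)
qed

text \<open>The residual of an orthogonal projection onto \<open>L\<close>, read as a function of t
  - b. The degree bound makes \<open>L\<close> finite-dimensional, so that the projection
  exists.\<close>

lemma fun_perp_separate:
  assumes "cpoly.subspace L" "L \<subseteq> polys_le N" "q \<notin> L"
  obtains f where "f \<in> fun_perp b L" "pair q (taylor_coeff f b) \<noteq> 0"
proof -
  obtain B where B: "finite B" "L = cpoly.span B"
    using subspace_polys_le_finite_span[OF assms(1,2)] by blast
  then obtain f where "\<And>p. p \<in> L \<Longrightarrow> pair p (Poly_Mapping.lookup f) = 0" "pair q (Poly_Mapping.lookup f) \<noteq> 0"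
    using pair_separate[of B q] assms(3) by metis
  then show thesis
    using that[of "shift_poly b f"] by (simp add: fun_perp_def taylor_coeff_shift_poly)
qed

text \<open>If a derivative of p left \<open>L\<close>, some f in the annihilator would detect it,
  and then (t_i - b_i) f would fail to annihilate p.\<close>

lemma mult_closed_imp_D_invariant:
  fixes b :: "complex ^ 'n::finite"
  assumes "cpoly.subspace L" "L \<subseteq> polys_le N" "mult_closed b (fun_perp b L)"
  shows "D_invariant L"
  unfolding D_invariant_def
proof (intro allI ballI, rule ccontr)
  fix i p assume p: "p \<in> L" "poly_deriv i p \<notin> L"
  then obtain f where f: "f \<in> fun_perp b L" "pair (poly_deriv i p) (taylor_coeff f b) \<noteq> 0"
    using fun_perp_separate[OF assms(1,2)] by blast
  have "holo_at (\<lambda>z. z $ i - b $ i) b" by (intro holo_at_sub) auto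
  then have "(\<lambda>z. (z $ i - b $ i) * f z) \<in> fun_perp b L"
    using assms(3) f(1) unfolding mult_closed_def by blast
  then show False
    using f pair_poly_deriv[of f b i p] p(1) by (simp add: fun_perp_def)
qed

lemma D_invariant_iff_mult_closed:
  assumes "cpoly.subspace L" "L \<subseteq> polys_le N"
  shows "D_invariant L \<longleftrightarrow> mult_closed b (fun_perp b L)"
  using assms mult_closed_imp_D_invariant D_invariant_imp_mult_closed by blast

subsection \<open>Least spaces\<close>

text \<open>A space of functions holomorphic near \<open>b\<close>, in which the filtration by the order of vanishing
  at \<open>b\<close> is stationary.\<close>

definition germ_space :: "complex ^ 'n::finite \<Rightarrow> (complex ^ 'n \<Rightarrow> complex) set \<Rightarrow> bool"
  where "germ_space b Z \<longleftrightarrow> (\<forall>f\<in>Z. holo_at f b) \<and> (\<lambda>_. 0) \<in> Z \<and>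
    (\<forall>f\<in>Z. \<forall>g\<in>Z. (\<lambda>z. f z + g z) \<in> Z) \<and> (\<forall>f\<in>Z. \<forall>c. (\<lambda>z. c * f z) \<in> Z) \<and>
    (\<exists>K. \<forall>f\<in>Z. ord_ge K f b \<longrightarrow> (\<forall>k. ord_ge k f b))"

definition hom_part :: "nat \<Rightarrow> (('n::finite \<Rightarrow>\<^sub>0 nat) \<Rightarrow> complex) \<Rightarrow> 'n cpoly"
  where "hom_part k c = trunc_poly {\<nu>. mdeg \<nu> = k} c"

lemma lookup_hom_part: "Poly_Mapping.lookup (hom_part k c) \<nu> = (if mdeg \<nu> = k then c \<nu> else 0)"
  by (simp add: hom_part_def lookup_trunc_poly)

text \<open>Flatness at b stands in for being the zero germ; the identity theorem makes the two
  agree.\<close>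

definition fun_least :: "complex ^ 'n::finite \<Rightarrow> (complex ^ 'n \<Rightarrow> complex) \<Rightarrow> 'n cpoly"
  where "fun_least b f = (if \<forall>k. ord_ge k f b then 0
     else hom_part (LEAST k. \<exists>\<nu>. mdeg \<nu> = k \<and> taylor_coeff f b \<nu> \<noteq> 0) (taylor_coeff f b))"

definition lead_space :: "complex ^ 'n::finite \<Rightarrow> (complex ^ 'n \<Rightarrow> complex) set \<Rightarrow> nat \<Rightarrow> 'n cpoly set"
  where "lead_space b Z k = {hom_part k (taylor_coeff f b) |f. f \<in> Z \<and> ord_ge k f b}"

lemma fun_least_eq:
  fixes b :: "complex ^ 'n::finite"
  assumes "holo_at f b" "ord_ge k f b" "\<not> ord_ge (Suc k) f b"
  shows "fun_least b f = hom_part k (taylor_coeff f b)"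
proof -
  obtain \<nu> where \<nu>: "mdeg \<nu> \<le> k" "taylor_coeff f b \<nu> \<noteq> 0"
    using assms(3) by (auto simp: ord_ge_iff_taylor[OF assms(1)] less_Suc_eq_le simp del: ord_ge.simps)
  have *: "taylor_coeff f b \<mu> = 0" if "mdeg \<mu> < k" for \<mu>
    using assms(2) that by (simp add: ord_ge_iff_taylor[OF assms(1)])
  have "(LEAST k. \<exists>\<nu>. mdeg \<nu> = k \<and> taylor_coeff f b \<nu> \<noteq> 0) = k"
  proof (rule Least_equality)
    show "\<exists>\<nu>. mdeg \<nu> = k \<and> taylor_coeff f b \<nu> \<noteq> 0"
      using \<nu> * by (metis le_neq_implies_less)
    show "k \<le> y" if "\<exists>\<nu>. mdeg \<nu> = y \<and> taylor_coeff f b \<nu> \<noteq> 0" for y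
      using that * by (metis not_less)
  qed
  then show ?thesis using assms(3) by (auto simp: fun_least_def simp del: ord_ge.simps)
qed

lemma ord_ge_exact:
  assumes "\<not> (\<forall>k. ord_ge k f b)"
  obtains k where "ord_ge k f b" "\<not> ord_ge (Suc k) f b"
proof -
  obtain n where n: "\<not> ord_ge n f b" using assms by blast
  have "\<exists>k. ord_ge k f b \<and> \<not> ord_ge (Suc k) f b"
  proof (rule ccontr)
    assume *: "\<not> (\<exists>k. ord_ge k f b \<and> \<not> ord_ge (Suc k) f b)"
    have "ord_ge m f b" for m by (induction m) (use * in \<open>auto simp del: ord_ge.simps(2)\<close>)
    then show False using n by blast
  qed
  then show thesis using that by blast
qed

lemma fun_least_cases:
  assumes "holo_at f b"
  obtains "\<forall>k. ord_ge k f b" "fun_least b f = 0"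
  | k where "ord_ge k f b" "\<not> ord_ge (Suc k) f b" "fun_least b f = hom_part k (taylor_coeff f b)"
proof (cases "\<forall>k. ord_ge k f b")
  case True
  then show thesis using that(1) by (simp add: fun_least_def)
next
  case False
  then obtain k where "ord_ge k f b" "\<not> ord_ge (Suc k) f b" by (rule ord_ge_exact)
  then show thesis using that(2) fun_least_eq[OF assms] by blast
qed

lemma hom_part_eq_0:
  assumes "holo_at f b" "ord_ge (Suc k) f b"
  shows "hom_part k (taylor_coeff f b) = 0"
  using assms(2) by (intro poly_mapping_eqI)
    (auto simp: lookup_hom_part ord_ge_iff_taylor[OF assms(1)] simp del: ord_ge.simps)

text \<open>A coordinate-free form of the \<open>D\<close>-invariance of the least space of \<open>Z\<close>.\<close>

definition deriv_approx :: "complex ^ 'n::finite \<Rightarrow> (complex ^ 'n \<Rightarrow> complex) set \<Rightarrow> bool"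
  where "deriv_approx b Z \<longleftrightarrow> (\<forall>k. \<forall>f\<in>Z. ord_ge (Suc k) f b \<longrightarrow>
     (\<forall>i. \<exists>g\<in>Z. ord_ge (Suc k) (\<lambda>z. pdiff i f z - g z) b))"

context
  fixes b :: "complex ^ 'n::finite" and Z
  assumes Z: "germ_space b Z"
begin

lemma germ_space_holo: "f \<in> Z \<Longrightarrow> holo_at f b"
  and germ_space_zero: "(\<lambda>_. 0) \<in> Z"
  and germ_space_add: "f \<in> Z \<Longrightarrow> g \<in> Z \<Longrightarrow> (\<lambda>z. f z + g z) \<in> Z"
  and germ_space_cmult: "f \<in> Z \<Longrightarrow> (\<lambda>z. c * f z) \<in> Z"
  using Z by (auto simp: germ_space_def)

lemma germ_space_sum: "(\<And>j. j \<in> J \<Longrightarrow> f j \<in> Z) \<Longrightarrow> (\<lambda>z. \<Sum>j\<in>J. f j z) \<in> Z"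
  by (induction J rule: infinite_finite_induct) (auto intro: germ_space_zero germ_space_add)

lemma lead_space_subset: "lead_space b Z k \<subseteq> cpoly.span (fun_least b ` Z)"
proof
  fix q assume "q \<in> lead_space b Z k"
  then obtain f where f: "f \<in> Z" "ord_ge k f b" "q = hom_part k (taylor_coeff f b)"
    by (auto simp: lead_space_def)
  show "q \<in> cpoly.span (fun_least b ` Z)"
  proof (cases "ord_ge (Suc k) f b")
    case True
    then have "q = 0" using f hom_part_eq_0 germ_space_holo by blast
    then show ?thesis by (simp add: cpoly.span_zero)
  next
    case False
    then have "q = fun_least b f" using fun_least_eq[OF germ_space_holo] f by metis
    then show ?thesis using f(1) by (auto intro: cpoly.span_base)
  qed
qed

lemma subspace_lead_space: "cpoly.subspace (lead_space b Z k)"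
proof (rule cpoly.subspaceI)
  show "0 \<in> lead_space b Z k"
    unfolding lead_space_def using germ_space_zero
    by (intro CollectI exI[of _ "\<lambda>_. 0"]) (auto simp: hom_part_eq_0)
next
  fix x y assume "x \<in> lead_space b Z k" "y \<in> lead_space b Z k"
  then obtain f g where fg: "f \<in> Z" "ord_ge k f b" "x = hom_part k (taylor_coeff f b)"
     "g \<in> Z" "ord_ge k g b" "y = hom_part k (taylor_coeff g b)"
    by (auto simp: lead_space_def)
  then have "x + y = hom_part k (taylor_coeff (\<lambda>z. f z + g z) b)"
    by (intro poly_mapping_eqI) (auto simp: lookup_hom_part lookup_add taylor_coeff_add germ_space_holo)
  then show "x + y \<in> lead_space b Z k"
    unfolding lead_space_def using fg germ_space_add ord_ge_add germ_space_holo by blast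
next
  fix x c assume "x \<in> lead_space b Z k"
  then obtain f where f: "f \<in> Z" "ord_ge k f b" "x = hom_part k (taylor_coeff f b)"
    by (auto simp: lead_space_def)
  then have "poly_scale c x = hom_part k (taylor_coeff (\<lambda>z. c * f z) b)"
    by (intro poly_mapping_eqI) (auto simp: lookup_hom_part taylor_coeff_cmult germ_space_holo)
  then show "poly_scale c x \<in> lead_space b Z k"
    unfolding lead_space_def using f germ_space_cmult ord_ge_cmult germ_space_holo by blast
qed

text \<open>The generators are homogeneous, so the least space is graded: passing to degree k keeps
  the generators of degree k and kills the others.\<close>

lemma hom_part_least_span:
  assumes "q \<in> cpoly.span (fun_least b ` Z)"
  shows "hom_part k (Poly_Mapping.lookup q) \<in> lead_space b Z k"
  using assms
proof (induction rule: cpoly.span_induct_alt)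
  case base
  have "hom_part k (Poly_Mapping.lookup 0) = (0 :: 'n cpoly)"
    by (intro poly_mapping_eqI) (simp add: lookup_hom_part)
  then show ?case using subspace_lead_space cpoly.subspace_0 by metis
next
  case (step c x y)
  then obtain f where f: "f \<in> Z" "x = fun_least b f" by blast
  have "hom_part k (Poly_Mapping.lookup x) \<in> lead_space b Z k"
    using germ_space_holo[OF f(1)]
  proof (cases rule: fun_least_cases)
    case 1
    then have "hom_part k (Poly_Mapping.lookup x) = (0 :: 'n cpoly)"
      by (intro poly_mapping_eqI) (simp add: lookup_hom_part f)
    then show ?thesis using subspace_lead_space cpoly.subspace_0 by metis
  next
    case (2 j)
    show ?thesis
    proof (cases "j = k")
      case True
      then have "hom_part k (Poly_Mapping.lookup x) = hom_part k (taylor_coeff f b)"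
        by (intro poly_mapping_eqI) (simp add: lookup_hom_part f 2)
      then show ?thesis using f(1) 2 True by (auto simp: lead_space_def)
    next
      case False
      then have "hom_part k (Poly_Mapping.lookup x) = (0 :: 'n cpoly)"
        by (intro poly_mapping_eqI) (auto simp: lookup_hom_part f 2)
      then show ?thesis using subspace_lead_space cpoly.subspace_0 by metis
    qed
  qed
  moreover have "hom_part k (Poly_Mapping.lookup (poly_scale c x + y)) =
      poly_scale c (hom_part k (Poly_Mapping.lookup x)) + hom_part k (Poly_Mapping.lookup y)"
    by (intro poly_mapping_eqI) (simp add: lookup_hom_part lookup_add)
  ultimately show ?case
    using step.IH subspace_lead_space cpoly.subspace_add cpoly.subspace_scale by metis
qed

text \<open>A function that is not flat has order below \<open>K\<close> by stationarity. The bound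
  \<open>Suc K\<close> leaves room for the zero polynomial, contributed by flat functions, even if
  \<open>K\<close> is 0.\<close>

lemma fun_least_in_lead_space:
  assumes "\<forall>f\<in>Z. ord_ge K f b \<longrightarrow> (\<forall>k. ord_ge k f b)" "f \<in> Z"
  shows "\<exists>k<Suc K. fun_least b f \<in> lead_space b Z k"
  using germ_space_holo[OF assms(2)]
proof (cases rule: fun_least_cases)
  case 1
  then show ?thesis using subspace_lead_space cpoly.subspace_0 by (metis zero_less_Suc)
next
  case (2 k)
  then have "\<not> ord_ge K f b" using assms by blast
  then have "k < K" using 2(1) ord_ge_mono by (metis not_less)
  then show ?thesis using 2 assms(2) by (auto simp: lead_space_def intro!: exI[of _ k])
qed

lemma lead_space_polys_le: "lead_space b Z k \<subseteq> polys_le k"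
  by (auto simp: lead_space_def polys_le_def in_keys_iff lookup_hom_part split: if_splits)

lemma least_span_polys_le: obtains K where "cpoly.span (fun_least b ` Z) \<subseteq> polys_le K"
proof -
  obtain K where K: "\<forall>f\<in>Z. ord_ge K f b \<longrightarrow> (\<forall>k. ord_ge k f b)"
    using Z by (auto simp: germ_space_def)
  have "fun_least b ` Z \<subseteq> polys_le K"
    using fun_least_in_lead_space[OF K] lead_space_polys_le
    by (fastforce simp: polys_le_def less_Suc_eq_le dest: subsetD)
  then show thesis using that cpoly.span_minimal subspace_polys_le by metis
qed

text \<open>Against its own least part f is seen only through that part, so the pairing is the
  squared norm of the least part.\<close>

lemma least_span_nondegenerate:
  assumes "f \<in> Z" "\<And>q. q \<in> cpoly.span (fun_least b ` Z) \<Longrightarrow> pair q (taylor_coeff f b) = 0"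
  shows "ord_ge k f b"
proof -
  have *: "pair (fun_least b f) (taylor_coeff f b) = 0"
    using assms by (auto intro: cpoly.span_base)
  show ?thesis using germ_space_holo[OF assms(1)]
  proof (cases rule: fun_least_cases)
    case (2 j)
    have "pair (fun_least b f) (taylor_coeff f b) = pair (fun_least b f) (Poly_Mapping.lookup (fun_least b f))"
      by (rule pair_cong) (auto simp: 2 in_keys_iff lookup_hom_part split: if_splits)
    then have l0: "fun_least b f = 0" using * pair_self_eq_0 by metis
    have "taylor_coeff f b \<nu> = 0" if "mdeg \<nu> < Suc j" for \<nu>
    proof (cases "mdeg \<nu> = j")
      case True
      then show ?thesis using l0 2 lookup_hom_part[of j "taylor_coeff f b" \<nu>] by simp
    next
      case False
      then show ?thesis using that 2(1) ord_ge_iff_taylor[OF germ_space_holo[OF assms(1)]] by auto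
    qed
    then have "ord_ge (Suc j) f b" using ord_ge_iff_taylor[OF germ_space_holo[OF assms(1)]] by blast
    then show ?thesis using 2 by blast
  qed blast
qed

text \<open>Existence of the Taylor interpolant. The degrees are treated in increasing order: an
  element of \<open>Z\<close> of order at least k can correct the pairing with the piece of degree
  k, and by homogeneity it is invisible to the pieces of lower degree.\<close>

lemma least_span_interpolation:
  "\<exists>z\<in>Z. \<forall>q\<in>cpoly.span (fun_least b ` Z). pair q (\<lambda>\<nu>. c \<nu> - taylor_coeff z b \<nu>) = 0"
proof -
  have step: "\<exists>z\<in>Z. \<forall>j<k. \<forall>q\<in>lead_space b Z j. pair q (\<lambda>\<nu>. c \<nu> - taylor_coeff z b \<nu>) = 0" for k
  proof (induction k)
    case 0
    then show ?case using germ_space_zero by auto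
  next
    case (Suc k)
    then obtain z where z: "z \<in> Z" "\<And>j q. j < k \<Longrightarrow> q \<in> lead_space b Z j \<Longrightarrow> pair q (\<lambda>\<nu>. c \<nu> - taylor_coeff z b \<nu>) = 0"
      by blast
    obtain B where B: "finite B" "lead_space b Z k = cpoly.span B"
      using subspace_polys_le_finite_span[OF subspace_lead_space lead_space_polys_le] by blast
    \<comment> \<open>The correction: the error left by \<open>z\<close> is projected onto the
      finite-dimensional piece of degree k, and the projection is the degree k part of some
      \<open>f\<close> in \<open>Z\<close> of order at least k.\<close>
    obtain w where w: "w \<in> lead_space b Z k"
      "\<And>q. q \<in> lead_space b Z k \<Longrightarrow> pair q (\<lambda>\<nu>. (c \<nu> - taylor_coeff z b \<nu>) - Poly_Mapping.lookup w \<nu>) = 0"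
      using pair_projection[OF B(1), of "\<lambda>\<nu>. c \<nu> - taylor_coeff z b \<nu>"] unfolding B(2)[symmetric] by blast
    obtain f where f: "f \<in> Z" "ord_ge k f b" "w = hom_part k (taylor_coeff f b)"
      using w(1) by (auto simp: lead_space_def)
    have tc: "taylor_coeff (\<lambda>t. z t + f t) b \<nu> = taylor_coeff z b \<nu> + taylor_coeff f b \<nu>" for \<nu>
      using z(1) f(1) by (intro taylor_coeff_add germ_space_holo)
    have keys: "mdeg \<nu> = j" if "q \<in> lead_space b Z j" "\<nu> \<in> Poly_Mapping.keys q" for q j \<nu>
      using that by (auto simp: lead_space_def in_keys_iff lookup_hom_part split: if_splits)
    have "pair q (\<lambda>\<nu>. c \<nu> - taylor_coeff (\<lambda>t. z t + f t) b \<nu>) = 0" if q: "j < Suc k" "q \<in> lead_space b Z j" for j q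
    proof (cases "j = k")
      case True
      have "pair q (\<lambda>\<nu>. c \<nu> - taylor_coeff (\<lambda>t. z t + f t) b \<nu>) = pair q (\<lambda>\<nu>. (c \<nu> - taylor_coeff z b \<nu>) - Poly_Mapping.lookup w \<nu>)"
        using keys[OF q(2)] True by (intro pair_cong) (simp add: tc f lookup_hom_part)
      then show ?thesis using w(2) q True by simp
    next
      case False
      then have "j < k" using q by simp
      have "pair q (\<lambda>\<nu>. c \<nu> - taylor_coeff (\<lambda>t. z t + f t) b \<nu>) = pair q (\<lambda>\<nu>. c \<nu> - taylor_coeff z b \<nu>)"
        using keys[OF q(2)] \<open>j < k\<close> f(2) ord_ge_iff_taylor[OF germ_space_holo[OF f(1)]]
        by (intro pair_cong) (simp add: tc)
      then show ?thesis using z(2) q \<open>j < k\<close> by simp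
    qed
    then show ?case using germ_space_add[OF z(1) f(1)] by blast
  qed
  obtain K where K: "\<forall>f\<in>Z. ord_ge K f b \<longrightarrow> (\<forall>k. ord_ge k f b)"
    using Z by (auto simp: germ_space_def)
  obtain z where z: "z \<in> Z" "\<And>j q. j < Suc K \<Longrightarrow> q \<in> lead_space b Z j \<Longrightarrow> pair q (\<lambda>\<nu>. c \<nu> - taylor_coeff z b \<nu>) = 0"
    using step[of "Suc K"] by blast
  have "pair q (\<lambda>\<nu>. c \<nu> - taylor_coeff z b \<nu>) = 0" if "q \<in> cpoly.span (fun_least b ` Z)" for q
    using that fun_least_in_lead_space[OF K] z(2) by (intro pair_span_zero[of "fun_least b ` Z" _ q]) auto
  then show ?thesis using z(1) by blast
qed

lemma poly_deriv_hom_part: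
  assumes "holo_at f b"
  shows "poly_deriv i (hom_part (Suc k) (taylor_coeff f b)) = hom_part k (taylor_coeff (pdiff i f) b)"
  by (rule poly_mapping_eqI) (simp add: lookup_poly_deriv lookup_hom_part taylor_coeff_pdiff[OF assms] del: of_nat_Suc)

text \<open>For f of order at least k + 1 a partial derivative has order at least k, so agreement
  with some g in \<open>Z\<close> to order k + 1 means that g has order at least k and the same part
  of degree k. That part is the derivative of the degree k + 1 part of f.\<close>

lemma D_invariant_least_span_iff:
  "D_invariant (cpoly.span (fun_least b ` Z)) \<longleftrightarrow> deriv_approx b Z"
proof
  assume D: "D_invariant (cpoly.span (fun_least b ` Z))"
  show "deriv_approx b Z"
    unfolding deriv_approx_def
  proof (intro allI ballI impI)
    fix k f i assume f: "f \<in> Z" "ord_ge (Suc k) f b"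
    have h: "holo_at f b" by (rule germ_space_holo[OF f(1)])
    have "hom_part (Suc k) (taylor_coeff f b) \<in> cpoly.span (fun_least b ` Z)"
      using f lead_space_subset[of "Suc k"] by (auto simp: lead_space_def simp del: ord_ge.simps)
    then have "hom_part k (taylor_coeff (pdiff i f) b) \<in> cpoly.span (fun_least b ` Z)"
      using D unfolding D_invariant_def poly_deriv_hom_part[OF h, symmetric] by blast
    then have "hom_part k (Poly_Mapping.lookup (hom_part k (taylor_coeff (pdiff i f) b))) \<in> lead_space b Z k"
      by (rule hom_part_least_span)
    then obtain g where g: "g \<in> Z" "ord_ge k g b"
      "hom_part k (Poly_Mapping.lookup (hom_part k (taylor_coeff (pdiff i f) b))) = hom_part k (taylor_coeff g b)"
      by (auto simp: lead_space_def)
    have hg: "holo_at g b" by (rule germ_space_holo[OF g(1)])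
    have "taylor_coeff (pdiff i f) b \<nu> = taylor_coeff g b \<nu>" if "mdeg \<nu> < Suc k" for \<nu>
    proof (cases "mdeg \<nu> = k")
      case True
      then show ?thesis using arg_cong[OF g(3), of "\<lambda>q. Poly_Mapping.lookup q \<nu>"] by (simp add: lookup_hom_part)
    next
      case False
      then have "mdeg \<nu> < k" using that by simp
      moreover have "ord_ge k (pdiff i f) b" using f(2) by simp
      ultimately show ?thesis using g(2) ord_ge_iff_taylor[OF hg] ord_ge_iff_taylor[OF holo_at_pdiff[OF h]] by auto
    qed
    then have "ord_ge (Suc k) (\<lambda>z. pdiff i f z - g z) b"
      using h hg by (subst ord_ge_iff_taylor) (auto simp: holo_at_sub holo_at_pdiff taylor_coeff_diff)
    then show "\<exists>g\<in>Z. ord_ge (Suc k) (\<lambda>z. pdiff i f z - g z) b" using g(1) by blast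
  qed
next
  assume D: "deriv_approx b Z"
  have 1: "poly_deriv i (fun_least b f) \<in> cpoly.span (fun_least b ` Z)" if f: "f \<in> Z" for f i
    using germ_space_holo[OF f]
  proof (cases rule: fun_least_cases)
    case 1
    then show ?thesis by (simp add: cpoly.span_zero)
  next
    case (2 j)
    show ?thesis
    proof (cases j)
      \<comment> \<open>The least part is a constant here, so its derivative is 0.\<close>
      case 0
      have "poly_deriv i (fun_least b f) = 0"
        by (rule poly_mapping_eqI) (simp add: lookup_poly_deriv 2 0 lookup_hom_part del: mdeg_eq_0)
      then show ?thesis by (simp add: cpoly.span_zero)
    next
      case (Suc k)
      have h: "holo_at f b" by (rule germ_space_holo[OF f])
      obtain g where g: "g \<in> Z" "ord_ge (Suc k) (\<lambda>z. pdiff i f z - g z) b"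
        using D f 2(1) unfolding Suc deriv_approx_def by blast
      have hg: "holo_at g b" by (rule germ_space_holo[OF g(1)])
      have eq: "taylor_coeff g b \<nu> = taylor_coeff (pdiff i f) b \<nu>" if "mdeg \<nu> < Suc k" for \<nu>
        using g(2) that h hg
        by (subst (asm) ord_ge_iff_taylor) (auto simp: holo_at_sub holo_at_pdiff taylor_coeff_diff)
      have "ord_ge k (pdiff i f) b" using 2(1) Suc by simp
      then have "ord_ge k g b"
        using eq ord_ge_iff_taylor[OF hg] ord_ge_iff_taylor[OF holo_at_pdiff[OF h]] by simp
      moreover have "hom_part k (taylor_coeff (pdiff i f) b) = hom_part k (taylor_coeff g b)"
        by (rule poly_mapping_eqI) (simp add: lookup_hom_part eq)
      ultimately have "hom_part k (taylor_coeff (pdiff i f) b) \<in> lead_space b Z k"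
        using g(1) by (auto simp: lead_space_def)
      then show ?thesis
        using lead_space_subset by (auto simp: 2 Suc poly_deriv_hom_part[OF h])
    qed
  qed
  have "poly_deriv i q \<in> cpoly.span (fun_least b ` Z)" if "q \<in> cpoly.span (fun_least b ` Z)" for i q
    using that
  proof (induction rule: cpoly.span_induct_alt)
    case base
    then show ?case by (simp add: cpoly.span_zero)
  next
    case (step c x y)
    then show ?case using 1
      by (auto simp: poly_deriv_add poly_deriv_scale intro!: cpoly.span_add cpoly.span_scale)
  qed
  then show "D_invariant (cpoly.span (fun_least b ` Z))" by (auto simp: D_invariant_def)
qed

end

text \<open>Composition with \<eta> shows that \<open>f\<close> has order k + 1 at b because
  \<open>f'\<close> has it at b'; composition with \<theta> brings the approximations of the
  derivatives of \<open>f\<close> back to b'. The rest is bookkeeping of the errors in the chain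
  rule.\<close>

lemma deriv_approx_transport:
  fixes b :: "complex ^ 'n::finite" and b' :: "complex ^ 'n'::finite"
  assumes Z: "germ_space b Z" and Z': "germ_space b' Z'"
    and \<theta>: "holo_map_at \<theta> b'" "\<theta> b' = b" and \<eta>: "holo_map_at \<eta> b" "\<eta> b = b'"
    and lift: "\<And>f. f \<in> Z \<Longrightarrow> \<exists>f'\<in>Z'. \<forall>\<^sub>F t in nhds b'. f' t = f (\<theta> t)"
    and lower: "\<And>f'. f' \<in> Z' \<Longrightarrow> \<exists>f\<in>Z. (\<forall>\<^sub>F t in nhds b'. f' t = f (\<theta> t)) \<and> (\<forall>\<^sub>F t in nhds b. f t = f' (\<eta> t))"
    and D: "deriv_approx b Z"
  shows "deriv_approx b' Z'"
  unfolding deriv_approx_def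
proof (intro allI ballI impI)
  fix k f' i assume f': "f' \<in> Z'" "ord_ge (Suc k) f' b'"
  obtain f where f: "f \<in> Z" "\<forall>\<^sub>F t in nhds b'. f' t = f (\<theta> t)" "\<forall>\<^sub>F t in nhds b. f t = f' (\<eta> t)"
    using lower[OF f'(1)] by blast
  have hf: "holo_at f b" by (rule germ_space_holo[OF Z f(1)])
  have hf': "holo_at f' b'" by (rule germ_space_holo[OF Z' f'(1)])
  have "ord_ge (Suc k) (\<lambda>t. f' (\<eta> t)) b"
    using ord_ge_compose[of f' \<eta> b "Suc k"] f' hf' \<eta> by (simp del: ord_ge.simps)
  then have ord_f: "ord_ge (Suc k) f b" using ord_ge_cong[OF f(3)] by blast
  obtain g where g: "\<And>j. g j \<in> Z" "\<And>j. ord_ge (Suc k) (\<lambda>z. pdiff j f z - g j z) b"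
    using D f(1) ord_f unfolding deriv_approx_def by metis
  have hg: "holo_at (g j) b" for j by (rule germ_space_holo[OF Z g(1)])
  \<comment> \<open>The Jacobian entries frozen at b': a linear combination in \<open>Z\<close>
    admits constants only.\<close>
  define c where "c j = pdiff i (\<lambda>t. \<theta> t $ j) b'" for j
  define G where "G z = (\<Sum>j\<in>UNIV. c j * g j z)" for z
  have "G \<in> Z" unfolding G_def by (intro germ_space_sum[OF Z] germ_space_cmult[OF Z] g)
  then obtain g' where g': "g' \<in> Z'" "\<forall>\<^sub>F t in nhds b'. g' t = G (\<theta> t)" using lift by blast
  have hfj: "holo_at (\<lambda>t. pdiff j f (\<theta> t)) b'" for j
    using holo_at_compose(1)[of "pdiff j f" \<theta> b'] hf \<theta> by (simp add: holo_at_pdiff)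
  have hgj: "holo_at (\<lambda>t. g j (\<theta> t)) b'" for j
    using holo_at_compose(1)[of "g j" \<theta> b'] hg \<theta> by simp
  have h\<theta>: "holo_at (\<lambda>t. pdiff i (\<lambda>t. \<theta> t $ j) t - c j) b'" for j
    using \<theta>(1) by (intro holo_at_sub holo_at_pdiff) (auto simp: holo_map_at_def)
  have h1: "holo_at (\<lambda>t. c j * (pdiff j f (\<theta> t) - g j (\<theta> t))) b'" for j
    by (intro holo_at_cmult holo_at_sub hfj hgj)
  have h2: "holo_at (\<lambda>t. pdiff j f (\<theta> t) * (pdiff i (\<lambda>t. \<theta> t $ j) t - c j)) b'" for j
    by (intro holo_at_mult hfj h\<theta>)
  have o1: "ord_ge (Suc k) (\<lambda>t. c j * (pdiff j f (\<theta> t) - g j (\<theta> t))) b'" for j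
  proof -
    have "ord_ge (Suc k) (\<lambda>t. pdiff j f (\<theta> t) - g j (\<theta> t)) b'"
      using ord_ge_compose[of "\<lambda>z. pdiff j f z - g j z" \<theta> b' "Suc k"] g(2) hf hg \<theta>
      by (simp add: holo_at_sub holo_at_pdiff del: ord_ge.simps)
    then show ?thesis by (rule ord_ge_cmult[OF holo_at_sub[OF hfj hgj]])
  qed
  \<comment> \<open>The error of freezing: order k from the derivative of \<open>f\<close>, and
    order 1 from an entry minus its value at b'.\<close>
  have o2: "ord_ge (Suc k) (\<lambda>t. pdiff j f (\<theta> t) * (pdiff i (\<lambda>t. \<theta> t $ j) t - c j)) b'" for j
  proof -
    have "ord_ge k (\<lambda>t. pdiff j f (\<theta> t)) b'"
      using ord_ge_compose[of "pdiff j f" \<theta> b' k] ord_f hf \<theta> by (simp add: holo_at_pdiff)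
    moreover have "ord_ge 1 (\<lambda>t. pdiff i (\<lambda>t. \<theta> t $ j) t - c j) b'"
      by (simp add: c_def)
    ultimately show ?thesis using ord_ge_mult[OF hfj h\<theta>] by fastforce
  qed
  have "\<forall>\<^sub>F t in nhds b'. pdiff i f' t = (\<Sum>j\<in>UNIV. pdiff j f (\<theta> t) * pdiff i (\<lambda>t. \<theta> t $ j) t)"
    using pdiff_cong_ev[OF f(2), of i] holo_at_compose(2)[of f \<theta> b' i] hf \<theta>
    by (auto elim: eventually_elim2)
  then have "\<forall>\<^sub>F t in nhds b'. (\<Sum>j\<in>UNIV. c j * (pdiff j f (\<theta> t) - g j (\<theta> t)) + pdiff j f (\<theta> t) * (pdiff i (\<lambda>t. \<theta> t $ j) t - c j))
      = pdiff i f' t - g' t"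
    using g'(2)
    by eventually_elim (simp add: G_def sum_subtractf[symmetric] algebra_simps)
  moreover have "ord_ge (Suc k) (\<lambda>t. \<Sum>j\<in>UNIV. c j * (pdiff j f (\<theta> t) - g j (\<theta> t)) + pdiff j f (\<theta> t) * (pdiff i (\<lambda>t. \<theta> t $ j) t - c j)) b'"
    by (intro ord_ge_sum holo_at_add ord_ge_add h1 h2 o1 o2)
  ultimately have "ord_ge (Suc k) (\<lambda>t. pdiff i f' t - g' t) b'"
    by (rule ord_ge_cong[THEN iffD1])
  then show "\<exists>g\<in>Z'. ord_ge (Suc k) (\<lambda>z. pdiff i f' z - g z) b'" using g'(1) by blast
qed

subsection \<open>Dimensions of spaces of polynomials\<close>

lemma card_independent_le_dim:
  fixes S :: "'n::finite cpoly set"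
  assumes "cpoly.independent S" "S \<subseteq> R" "R \<subseteq> polys_le N"
  shows "finite S" "card S \<le> cpoly.dim R"
proof -
  let ?M = "(\<lambda>\<nu>. Poly_Mapping.single \<nu> 1) ` {\<nu>::'n \<Rightarrow>\<^sub>0 nat. mdeg \<nu> \<le> N}"
  have R: "R \<subseteq> cpoly.span ?M" using assms(3) polys_le_span_finite by blast
  obtain C where C: "C \<subseteq> R" "cpoly.independent C" "R \<subseteq> cpoly.span C" "card C = cpoly.dim R"
    using cpoly.basis_exists[of R] by metis
  have "finite C" using cpoly.independent_span_bound[of ?M C] C(1,2) R by auto
  from cpoly.independent_span_bound[OF this assms(1)] assms(2) C(3,4)
  show "finite S" "card S \<le> cpoly.dim R" by auto
qed

text \<open>Beyond a term of least dimension, a proper inclusion would force a still smaller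
  dimension.\<close>

lemma decreasing_subspaces_stationary:
  fixes V :: "nat \<Rightarrow> 'n::finite cpoly set"
  assumes "\<And>k. cpoly.subspace (V k)" "\<And>k. V k \<subseteq> polys_le N" "\<And>j k. j \<le> k \<Longrightarrow> V k \<subseteq> V j"
  obtains K where "\<And>k. K \<le> k \<Longrightarrow> V k = V K"
proof -
  obtain K where K: "\<And>k. cpoly.dim (V K) \<le> cpoly.dim (V k)"
    using ex_has_least_nat[of "\<lambda>_. True" _ "\<lambda>k. cpoly.dim (V k)"] by blast
  have "V k = V K" if "K \<le> k" for k
  proof (rule ccontr)
    assume "V k \<noteq> V K"
    then obtain x where x: "x \<in> V K" "x \<notin> V k" using assms(3)[OF \<open>K \<le> k\<close>] by blast
    obtain C where C: "C \<subseteq> V k" "cpoly.independent C" "V k \<subseteq> cpoly.span C" "card C = cpoly.dim (V k)"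
      using cpoly.basis_exists[of "V k"] by metis
    have "cpoly.span C = V k"
      using C(1,3) cpoly.span_minimal[OF C(1) assms(1)] by blast
    then have "cpoly.independent (insert x C)" using x(2) C(2) by (simp add: cpoly.independent_insert)
    moreover have "insert x C \<subseteq> V K" using x(1) C(1) assms(3)[OF that] by blast
    ultimately have "card (insert x C) \<le> cpoly.dim (V K)"
      by (rule card_independent_le_dim(2)[OF _ _ assms(2)])
    moreover have "finite C" using card_independent_le_dim(1)[OF C(2,1) assms(2)] .
    moreover have "x \<notin> C" using x(2) C(1) by blast
    ultimately show False using K[of k] C(4) by simp
  qed
  then show thesis using that by blast
qed

text \<open>Test polynomials dual to \<open>B\<close> turn the perturbed family into a matrix close
  to the identity, and a matrix close enough to the identity has no kernel.\<close>

lemma independent_perturb: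
  fixes B :: "'n::finite cpoly set" and u :: "'n cpoly \<Rightarrow> 'a \<Rightarrow> 'n cpoly"
  assumes fin: "finite B" and ind: "cpoly.independent B" and K: "finite K"
    and keys: "\<And>x s. x \<in> B \<Longrightarrow> Poly_Mapping.keys (u x s) \<subseteq> K" "\<And>x. x \<in> B \<Longrightarrow> Poly_Mapping.keys x \<subseteq> K"
    and lim: "\<And>x \<nu>. x \<in> B \<Longrightarrow> \<nu> \<in> K \<Longrightarrow> ((\<lambda>s. Poly_Mapping.lookup (u x s) \<nu>) \<longlongrightarrow> Poly_Mapping.lookup x \<nu>) F"
  shows "\<forall>\<^sub>F s in F. cpoly.independent ((\<lambda>x. u x s) ` B) \<and> card ((\<lambda>x. u x s) ` B) = card B"
proof -
  have "\<exists>e. pair x (Poly_Mapping.lookup e) = 1 \<and> (\<forall>y\<in>B - {x}. pair y (Poly_Mapping.lookup e) = 0)" if "x \<in> B" for x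
  proof -
    have "x \<notin> cpoly.span (B - {x})" using ind that by (auto simp: cpoly.dependent_def)
    then obtain f where f: "\<And>p. p \<in> cpoly.span (B - {x}) \<Longrightarrow> pair p (Poly_Mapping.lookup f) = 0"
      "pair x (Poly_Mapping.lookup f) \<noteq> 0"
      using pair_separate[of "B - {x}" x] fin by auto
    \<comment> \<open>Normalisation in the second argument, which is conjugate-linear; hence the
      conjugate of the inverse.\<close>
    define e where "e = poly_scale (cnj (inverse (pair x (Poly_Mapping.lookup f)))) f"
    have "pair y (Poly_Mapping.lookup e) = inverse (pair x (Poly_Mapping.lookup f)) * pair y (Poly_Mapping.lookup f)" for y
      using pair_scale_right[of y "cnj (inverse (pair x (Poly_Mapping.lookup f)))" "Poly_Mapping.lookup f"]
      by (simp add: e_def lookup_poly_scale[abs_def])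
    then show ?thesis using f by (intro exI[of _ e]) (auto intro: cpoly.span_base)
  qed
  then obtain e where e: "\<And>x. x \<in> B \<Longrightarrow> pair x (Poly_Mapping.lookup (e x)) = 1"
    "\<And>x y. x \<in> B \<Longrightarrow> y \<in> B \<Longrightarrow> y \<noteq> x \<Longrightarrow> pair y (Poly_Mapping.lookup (e x)) = 0"
    by (metis DiffI singletonD)
  define M where "M x y s = pair (u y s) (Poly_Mapping.lookup (e x))" for x y s
  have M_lim: "(M x y \<longlongrightarrow> (if x = y then 1 else 0)) F" if "x \<in> B" "y \<in> B" for x y
  proof -
    have "((\<lambda>s. \<Sum>\<nu>\<in>K. mfact \<nu> * Poly_Mapping.lookup (u y s) \<nu> * cnj (Poly_Mapping.lookup (e x) \<nu>)) \<longlongrightarrow>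
       (\<Sum>\<nu>\<in>K. mfact \<nu> * Poly_Mapping.lookup y \<nu> * cnj (Poly_Mapping.lookup (e x) \<nu>))) F"
      by (intro tendsto_intros lim that)
    then have "(M x y \<longlongrightarrow> pair y (Poly_Mapping.lookup (e x))) F"
      unfolding M_def using pair_superset[OF K keys(1)[OF that(2)]] pair_superset[OF K keys(2)[OF that(2)]] by simp
    then show ?thesis using e that by (cases "x = y") auto
  qed
  \<comment> \<open>Small enough that the deviations along one row of the matrix sum to less than 1;
    the summand 1 in the denominator covers empty \<open>B\<close>.\<close>
  define \<delta> where "\<delta> = 1 / (2 * real (card B) + 1)"
  have \<delta>: "\<delta> > 0" "real (card B) * \<delta> < 1" by (auto simp: \<delta>_def field_simps)
  have "\<forall>\<^sub>F s in F. \<forall>x\<in>B. \<forall>y\<in>B. dist (M x y s) (if x = y then 1 else 0) < \<delta>"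
    using M_lim \<delta>(1) by (intro eventually_ball_finite fin ballI) (auto simp only: tendsto_iff)
  then show ?thesis
  proof eventually_elim
    case (elim s)
    have indep: "\<forall>x\<in>B. a x = 0" if sum0: "(\<Sum>y\<in>B. poly_scale (a y) (u y s)) = 0" for a
    proof (rule ccontr)
      assume "\<not> (\<forall>x\<in>B. a x = 0)"
      then obtain x0 where x0: "x0 \<in> B" "a x0 \<noteq> 0" by blast
      \<comment> \<open>The largest modulus among the coefficients of a supposed dependence. In the
        row where it is attained the deviations from the identity amount to less than
        \<open>m\<close>, a contradiction.\<close>
      define m where "m = Max ((\<lambda>x. norm (a x)) ` B)"
      have mx: "norm (a x) \<le> m" if "x \<in> B" for x
        unfolding m_def using that fin by (intro Max_ge) auto
      have "m \<in> (\<lambda>x. norm (a x)) ` B"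
        unfolding m_def using x0 fin by (intro Max_in) auto
      then obtain x where x: "x \<in> B" "norm (a x) = m" by auto
      have m0: "m > 0" using mx[OF x0(1)] x0(2) by (metis less_le_trans zero_less_norm_iff)
      have "0 = pair (\<Sum>y\<in>B. poly_scale (a y) (u y s)) (Poly_Mapping.lookup (e x))" using sum0 by simp
      also have "\<dots> = (\<Sum>y\<in>B. a y * M x y s)" by (simp add: pair_sum pair_scale M_def)
      finally have "a x = (\<Sum>y\<in>B. a y * (if x = y then 1 else 0)) - (\<Sum>y\<in>B. a y * M x y s)"
        using x(1) fin by (simp add: if_distrib[of "\<lambda>z. _ * z"] cong: if_cong)
      also have "\<dots> = (\<Sum>y\<in>B. a y * ((if x = y then 1 else 0) - M x y s))"
        by (simp add: sum_subtractf[symmetric] right_diff_distrib)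
      also have "norm \<dots> \<le> (\<Sum>y\<in>B. m * \<delta>)"
      proof (rule sum_norm_le)
        fix y assume y: "y \<in> B"
        have "norm ((if x = y then 1 else 0) - M x y s) \<le> \<delta>"
          using elim x(1) y by (metis dist_commute dist_norm less_imp_le)
        then show "norm (a y * ((if x = y then 1 else 0) - M x y s)) \<le> m * \<delta>"
          unfolding norm_mult using mx[OF y] m0 by (intro mult_mono) auto
      qed
      finally have "m \<le> m * (real (card B) * \<delta>)" by (simp add: x(2) algebra_simps)
      then show False using m0 \<delta>(2) by (metis mult_less_cancel_left2 not_less)
    qed
    have inj: "inj_on (\<lambda>x. u x s) B"
    proof (rule inj_onI, rule ccontr)
      fix x y assume xy: "x \<in> B" "y \<in> B" "u x s = u y s" "x \<noteq> y"
      define a where "a z = (if z = x then 1 else if z = y then -1 else 0 :: complex)" for z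
      have "(\<Sum>z\<in>B. poly_scale (a z) (u z s)) = (\<Sum>z\<in>{x,y}. poly_scale (a z) (u z s))"
        using fin xy by (intro sum.mono_neutral_right) (auto simp: a_def)
      also have "\<dots> = 0" using xy by (simp add: a_def)
      finally show False using indep[of a] xy by (auto simp: a_def)
    qed
    have "cpoly.independent ((\<lambda>x. u x s) ` B)"
    proof
      assume "cpoly.dependent ((\<lambda>x. u x s) ` B)"
      then obtain a where a: "\<exists>v\<in>(\<lambda>x. u x s) ` B. a v \<noteq> 0" "(\<Sum>v\<in>(\<lambda>x. u x s) ` B. poly_scale (a v) v) = 0"
        using cpoly.dependent_finite[of "(\<lambda>x. u x s) ` B"] fin by auto
      then have "(\<Sum>x\<in>B. poly_scale (a (u x s)) (u x s)) = 0"
        by (simp add: sum.reindex[OF inj])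
      then show False using indep[of "\<lambda>x. a (u x s)"] a(1) by auto
    qed
    then show ?case using card_image[OF inj] by blast
  qed
qed

subsection \<open>Bundle points\<close>

lemma bundle_imp_deriv_approx:
  fixes b :: "complex ^ 'n::finite"
  assumes Z: "germ_space b Z" and W: "open W" "b \<in> W" "\<And>f. f \<in> Z \<Longrightarrow> holo_fun_on f W"
    and dim: "\<And>k t. t \<in> W \<Longrightarrow> cpoly.dim (jet_space Z k t) \<le> cpoly.dim (jet_space Z k b)"
  shows "deriv_approx b Z"
  unfolding deriv_approx_def
proof (intro allI ballI impI)
  fix k f i assume f: "f \<in> Z" "ord_ge (Suc k) f b"
  define K where "K = {\<nu>::'n \<Rightarrow>\<^sub>0 nat. mdeg \<nu> \<le> k}"
  define jet where "jet g t = trunc_poly K (taylor_coeff g t)" for g t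
  have jet_space: "jet_space Z k t = (\<lambda>g. jet g t) ` Z" for t
    by (simp add: jet_space_def jet_def K_def trunc_poly_def)
  have finK: "finite K" by (simp add: K_def)
  have lookup_jet: "Poly_Mapping.lookup (jet g t) \<nu> = (if \<nu> \<in> K then taylor_coeff g t \<nu> else 0)" for g t \<nu>
    by (simp add: jet_def lookup_trunc_poly finK)
  have jet_le: "jet_space Z k t \<subseteq> polys_le k" for t
    by (auto simp: jet_space polys_le_def in_keys_iff lookup_jet K_def split: if_splits)
  have hZ: "holo_at g t" if "g \<in> Z" "t \<in> W" for g t using W that holo_atI by blast
  have sub: "cpoly.subspace (jet_space Z k t)" if t: "t \<in> W" for t
  proof (rule cpoly.subspaceI)
    have "jet (\<lambda>_. 0) t = 0"
      by (rule poly_mapping_eqI) (simp add: lookup_jet taylor_coeff_def mdiff_const_zero)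
    then show "0 \<in> jet_space Z k t"
      unfolding jet_space using germ_space_zero[OF Z] by (metis image_eqI)
  next
    fix x y assume "x \<in> jet_space Z k t" "y \<in> jet_space Z k t"
    then obtain g h where gh: "g \<in> Z" "h \<in> Z" "x = jet g t" "y = jet h t" by (auto simp: jet_space)
    then have "x + y = jet (\<lambda>z. g z + h z) t"
      using t by (intro poly_mapping_eqI) (simp add: lookup_jet lookup_add taylor_coeff_add hZ)
    then show "x + y \<in> jet_space Z k t"
      unfolding jet_space using gh germ_space_add[OF Z] by blast
  next
    fix x c assume "x \<in> jet_space Z k t"
    then obtain g where g: "g \<in> Z" "x = jet g t" by (auto simp: jet_space)
    then have "poly_scale c x = jet (\<lambda>z. c * g z) t"
      using t by (intro poly_mapping_eqI) (simp add: lookup_jet taylor_coeff_cmult hZ)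
    then show "poly_scale c x \<in> jet_space Z k t"
      unfolding jet_space using g germ_space_cmult[OF Z] by blast
  qed
  have hf: "holo_at f b" by (rule hZ[OF f(1) W(2)])
  define w where "w = jet (pdiff i f) b"
  have "w \<in> jet_space Z k b"
  proof (rule ccontr)
    assume w: "w \<notin> jet_space Z k b"
    obtain B where B: "B \<subseteq> jet_space Z k b" "cpoly.independent B" "jet_space Z k b \<subseteq> cpoly.span B"
      "card B = cpoly.dim (jet_space Z k b)"
      using cpoly.basis_exists[of "jet_space Z k b"] by metis
    have finB: "finite B" using card_independent_le_dim(1)[OF B(2,1) jet_le] .
    have spanB: "cpoly.span B = jet_space Z k b"
      using B(1,3) cpoly.span_minimal[OF B(1) sub[OF W(2)]] by blast
    have wB: "w \<notin> B" using w B(1) by blast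
    have ind: "cpoly.independent (insert w B)"
      using w B(2) wB spanB by (simp add: cpoly.independent_insert)
    have "\<forall>x\<in>B. \<exists>g. g \<in> Z \<and> jet g b = x"
      using B(1) unfolding jet_space by blast
    from bchoice[OF this] obtain z
      where z: "\<And>x. x \<in> B \<Longrightarrow> z x \<in> Z" "\<And>x. x \<in> B \<Longrightarrow> jet (z x) b = x" by blast
    \<comment> \<open>At s = 0 the scaled jet would be 0 by the convention for inverses; the limit
      is taken along \<open>at 0\<close>, which leaves this parameter out.\<close>
    define u where "u x s = (if x = w then poly_scale (inverse s) (jet f (b + axis i s)) else jet (z x) (b + axis i s))" for x s
    have ax: "((\<lambda>s. b + axis i s) \<longlongrightarrow> b) (at 0)"
      using tendsto_add[OF tendsto_const bounded_linear.tendsto[OF bounded_linear_axis[of i] tendsto_ident_at], of b 0 UNIV] by simp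
    have "\<forall>\<^sub>F s in at 0. cpoly.independent ((\<lambda>x. u x s) ` insert w B) \<and> card ((\<lambda>x. u x s) ` insert w B) = card (insert w B)"
    proof (rule independent_perturb[OF _ ind finK])
      show "finite (insert w B)" using finB by simp
      show "Poly_Mapping.keys (u x s) \<subseteq> K" for x s
        by (auto simp: u_def in_keys_iff lookup_jet split: if_splits)
      show "Poly_Mapping.keys x \<subseteq> K" if "x \<in> insert w B" for x
      proof -
        have "x \<in> range (\<lambda>g. jet g b)" using that z(2)[of x] by (cases "x = w") (auto simp: w_def intro: range_eqI[OF sym])
        then obtain g where "x = jet g b" by blast
        then show ?thesis by (auto simp: in_keys_iff lookup_jet split: if_splits)
      qed
    next
      fix x \<nu> assume x: "x \<in> insert w B" and \<nu>: "\<nu> \<in> K"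
      have hol: "holo_fun_on (mdiff \<nu> g) W" if "g \<in> Z" for g using W that by (intro mdiff_holo) auto
      show "((\<lambda>s. Poly_Mapping.lookup (u x s) \<nu>) \<longlongrightarrow> Poly_Mapping.lookup x \<nu>) (at 0)"
      proof (cases "x = w")
        case True
        have d: "complex_diff_at (mdiff \<nu> f) b" using hol[OF f(1)] W(2) by (simp add: holo_fun_on_def)
        have "((\<lambda>s. mdiff \<nu> f (b + axis i s)) has_field_derivative pdiff i (mdiff \<nu> f) b) (at 0)"
          using has_derivative_axis_line[of "mdiff \<nu> f" _ b i 0] d pdiff_eqI[of "mdiff \<nu> f" _ b i]
          unfolding complex_diff_at_def by fastforce
        then have "((\<lambda>s. (mdiff \<nu> f (b + axis i (0 + s)) - mdiff \<nu> f (b + axis i 0)) / s) \<longlongrightarrow> pdiff i (mdiff \<nu> f) b) (at 0)"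
          unfolding DERIV_def .
        \<comment> \<open>Order k + 1 of \<open>f\<close> removes the constant term of the
          difference quotient for every \<nu> of degree at most k, so division by s alone already
          converges.\<close>
        moreover have "mdiff \<nu> f b = 0"
          using f(2) \<nu> unfolding ord_ge_iff_mdiff[OF hf] by (simp add: K_def less_Suc_eq_le)
        ultimately have "((\<lambda>s. mdiff \<nu> f (b + axis i s) / s) \<longlongrightarrow> mdiff \<nu> (pdiff i f) b) (at 0)"
          by (simp add: pdiff_mdiff[OF hf])
        from tendsto_divide[OF this tendsto_const, of "mfact \<nu>"]
        show ?thesis using \<nu> True by (simp add: u_def w_def lookup_jet taylor_coeff_def field_simps)
      next
        case False
        then have xB: "x \<in> B" using x by simp
        have "isCont (mdiff \<nu> (z x)) b"
          using hol[OF z(1)[OF xB]] W(2) by (auto simp: holo_fun_on_def intro: complex_diff_at_continuous)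
        then have "((\<lambda>s. mdiff \<nu> (z x) (b + axis i s)) \<longlongrightarrow> mdiff \<nu> (z x) b) (at 0)"
          using isCont_tendsto_compose ax by blast
        from tendsto_divide[OF this tendsto_const, of "mfact \<nu>"]
        have "((\<lambda>s. Poly_Mapping.lookup (u x s) \<nu>) \<longlongrightarrow> Poly_Mapping.lookup (jet (z x) b) \<nu>) (at 0)"
          using \<nu> False by (simp add: u_def lookup_jet taylor_coeff_def)
        then show ?thesis using z(2)[OF xB] by simp
      qed
    qed
    moreover have "\<forall>\<^sub>F s in at 0. b + axis i s \<in> W"
      using topological_tendstoD[OF ax W(1,2)] .
    ultimately have "\<forall>\<^sub>F s in at (0::complex). False"
    proof eventually_elim
      case (elim s)
      have "(\<lambda>x. u x s) ` insert w B \<subseteq> jet_space Z k (b + axis i s)"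
        using f(1) z(1) cpoly.subspace_scale[OF sub[OF elim(2)]]
        by (auto simp: u_def jet_space)
      then have "card (insert w B) \<le> cpoly.dim (jet_space Z k (b + axis i s))"
        using card_independent_le_dim(2)[OF _ _ jet_le] elim(1) by metis
      also have "\<dots> \<le> card B" using dim[OF elim(2)] B(4) by simp
      finally show False using finB wB by simp
    qed
    \<comment> \<open>There are nonzero s arbitrarily close to 0.\<close>
    then show False by (simp add: eventually_False)
  qed
  then obtain g where g: "g \<in> Z" "w = jet g b" by (auto simp: jet_space)
  have hg: "holo_at g b" by (rule hZ[OF g(1) W(2)])
  have "taylor_coeff (pdiff i f) b \<nu> = taylor_coeff g b \<nu>" if "mdeg \<nu> < Suc k" for \<nu>
    using arg_cong[OF g(2), of "\<lambda>p. Poly_Mapping.lookup p \<nu>"] that by (simp add: w_def lookup_jet K_def less_Suc_eq_le)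
  then have "ord_ge (Suc k) (\<lambda>z. pdiff i f z - g z) b"
    using hf hg by (subst ord_ge_iff_taylor) (auto simp: holo_at_sub holo_at_pdiff taylor_coeff_diff)
  then show "\<exists>g\<in>Z. ord_ge (Suc k) (\<lambda>z. pdiff i f z - g z) b" using g(1) by blast
qed

subsection \<open>The adjoint of a substitution\<close>

text \<open>Every polynomial occurs as a Taylor expansion at a, so the difference of
  \<open>q\<close> and \<open>q'\<close> can be tested against itself.\<close>

lemma pair_unique:
  assumes "\<And>F. holo_at F a \<Longrightarrow> pair q (taylor_coeff F a) = pair q' (taylor_coeff F a)"
  shows "q = q'"
proof -
  have "pair q (Poly_Mapping.lookup f) = pair q' (Poly_Mapping.lookup f)" for f
    using assms[of "shift_poly a f"] by (simp add: taylor_coeff_shift_poly)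
  moreover have "pair q c = pair (q - q') c + pair q' c" for c
    using pair_add[of "q - q'" q'] by simp
  ultimately have "pair (q - q') (Poly_Mapping.lookup (q - q')) = 0" by simp
  then show ?thesis using pair_self_eq_0 by fastforce
qed

text \<open>Substitution of \<Phi> does not lower the order of vanishing, so the pairing of p with F
  o \<Phi> depends only on the N-jet of F at a and is represented by a polynomial of degree at most
  N.\<close>

lemma adjoint_exists:
  fixes b :: "complex ^ 'n::finite" and \<Phi> :: "complex ^ 'n \<Rightarrow> complex ^ 'm::finite"
  assumes \<Phi>: "holo_map_at \<Phi> b" "\<Phi> b = a" and p: "p \<in> polys_le N"
  shows "\<exists>q\<in>polys_le N. \<forall>F. holo_at F a \<longrightarrow> pair q (taylor_coeff F a) = pair p (taylor_coeff (\<lambda>t. F (\<Phi> t)) b)"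
proof (intro bexI allI impI)
  \<comment> \<open>The coefficients are found by testing on the monomials (x - a)^\<mu>; dividing
    by \<mu>! undoes the weight in the pairing.\<close>
  define q where "q = trunc_poly {\<mu>. mdeg \<mu> \<le> N} (\<lambda>\<mu>. pair p (taylor_coeff (\<lambda>t. shift_monom a \<mu> (\<Phi> t)) b) / mfact \<mu>)"
  show "q \<in> polys_le N"
    using keys_trunc_poly[of "{\<mu>. mdeg \<mu> \<le> N}"] by (auto simp: q_def polys_le_def)
  fix F assume F: "holo_at F a"
  define R where "R z = F z - taylor_trunc N F a z" for z
  have R: "holo_at R a" "ord_ge (Suc N) R a"
    unfolding R_def using F ord_ge_taylor_remainder by (auto intro: holo_at_sub simp del: ord_ge.simps)
  have hR: "holo_at (\<lambda>t. R (\<Phi> t)) b" using holo_at_compose(1)[of R \<Phi> b] R(1) \<Phi> by simp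
  have oR: "ord_ge (Suc N) (\<lambda>t. R (\<Phi> t)) b" using ord_ge_compose[of R \<Phi> b "Suc N"] R \<Phi> by (simp del: ord_ge.simps)
  have hm: "holo_at (\<lambda>t. shift_monom a \<mu> (\<Phi> t)) b" for \<mu>
    using holo_at_compose(1)[of "shift_monom a \<mu>" \<Phi> b] \<Phi> by simp
  have hs: "holo_at (\<lambda>t. \<Sum>\<mu> | mdeg \<mu> \<le> N. taylor_coeff F a \<mu> * shift_monom a \<mu> (\<Phi> t)) b"
    by (intro holo_at_sum holo_at_cmult hm)
  have "F (\<Phi> t) = R (\<Phi> t) + (\<Sum>\<mu> | mdeg \<mu> \<le> N. taylor_coeff F a \<mu> * shift_monom a \<mu> (\<Phi> t))" for t
    by (simp add: R_def taylor_trunc_def)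
  then have "pair p (taylor_coeff (\<lambda>t. F (\<Phi> t)) b) =
     pair p (\<lambda>\<nu>. taylor_coeff (\<lambda>t. R (\<Phi> t)) b \<nu> + (\<Sum>\<mu> | mdeg \<mu> \<le> N. taylor_coeff F a \<mu> * taylor_coeff (\<lambda>t. shift_monom a \<mu> (\<Phi> t)) b \<nu>))"
    by (intro pair_cong) (simp add: taylor_coeff_add[OF hR hs] taylor_coeff_sum holo_at_cmult hm taylor_coeff_cmult)
  also have "\<dots> = pair p (taylor_coeff (\<lambda>t. R (\<Phi> t)) b) +
      (\<Sum>\<mu> | mdeg \<mu> \<le> N. cnj (taylor_coeff F a \<mu>) * pair p (taylor_coeff (\<lambda>t. shift_monom a \<mu> (\<Phi> t)) b))"
    by (simp add: pair_add_right pair_sum_right pair_scale_right)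
  also have "pair p (taylor_coeff (\<lambda>t. R (\<Phi> t)) b) = 0"
    using oR p by (intro pair_eq_zero) (simp add: ord_ge_iff_taylor[OF hR] less_Suc_eq_le polys_le_def del: ord_ge.simps)
  also have "0 + (\<Sum>\<mu> | mdeg \<mu> \<le> N. cnj (taylor_coeff F a \<mu>) * pair p (taylor_coeff (\<lambda>t. shift_monom a \<mu> (\<Phi> t)) b))
      = pair q (taylor_coeff F a)"
    by (simp add: q_def pair_trunc_poly field_simps)
  finally show "pair q (taylor_coeff F a) = pair p (taylor_coeff (\<lambda>t. F (\<Phi> t)) b)" by simp
qed

subsection \<open>Quotient rings and germs\<close>

lemma cring_idealI:
  assumes "cring R" "I \<subseteq> carrier R" "\<zero>\<^bsub>R\<^esub> \<in> I"
    "\<And>x y. x \<in> I \<Longrightarrow> y \<in> I \<Longrightarrow> x \<oplus>\<^bsub>R\<^esub> y \<in> I" "\<And>x r. x \<in> I \<Longrightarrow> r \<in> carrier R \<Longrightarrow> r \<otimes>\<^bsub>R\<^esub> x \<in> I"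
  shows "ideal I R"
proof -
  interpret cring R by fact
  have inv: "\<ominus>\<^bsub>R\<^esub> x \<in> I" if "x \<in> I" for x
  proof -
    have "\<ominus>\<^bsub>R\<^esub> x = (\<ominus>\<^bsub>R\<^esub> \<one>\<^bsub>R\<^esub>) \<otimes>\<^bsub>R\<^esub> x" using that assms(2) by (auto simp: l_minus)
    then show ?thesis using assms(5)[OF that, of "\<ominus>\<^bsub>R\<^esub> \<one>\<^bsub>R\<^esub>"] by simp
  qed
  show ?thesis
  proof (rule idealI)
    show "ring R" by (rule ring_axioms)
    show "subgroup I (add_monoid R)"
      by (rule add.group_axioms[THEN group.subgroupI]) (use assms(2-4) inv in \<open>auto simp: a_inv_def\<close>)
    show "x \<otimes>\<^bsub>R\<^esub> a \<in> I" if "a \<in> I" "x \<in> carrier R" for a x using assms(5) that by blast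
    show "a \<otimes>\<^bsub>R\<^esub> x \<in> I" if "a \<in> I" "x \<in> carrier R" for a x
      using assms(5)[OF that] m_comm[of a x] that assms(2) by auto
  qed
qed

text \<open>Allows ideals of a quotient ring to be tested on representatives: \<open>M\<close>
  contains with an element everything that has the same image, and it is closed under addition, so
  only absorption is left to check.\<close>

lemma surj_hom_ideal_iff:
  assumes "cring R" "cring S" "h \<in> ring_hom R S" "h ` carrier R = carrier S"
    and M: "M \<subseteq> carrier R" "\<zero>\<^bsub>R\<^esub> \<in> M" "\<And>x y. x \<in> M \<Longrightarrow> y \<in> M \<Longrightarrow> x \<oplus>\<^bsub>R\<^esub> y \<in> M"
    and sat: "\<And>x y. x \<in> M \<Longrightarrow> y \<in> carrier R \<Longrightarrow> h x = h y \<Longrightarrow> y \<in> M"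
  shows "ideal (h ` M) S \<longleftrightarrow> (\<forall>x\<in>M. \<forall>r\<in>carrier R. r \<otimes>\<^bsub>R\<^esub> x \<in> M)"
proof
  assume I: "ideal (h ` M) S"
  show "\<forall>x\<in>M. \<forall>r\<in>carrier R. r \<otimes>\<^bsub>R\<^esub> x \<in> M"
  proof (intro ballI)
    fix x r assume x: "x \<in> M" and r: "r \<in> carrier R"
    have xr: "x \<in> carrier R" using x M(1) by blast
    have rx: "r \<otimes>\<^bsub>R\<^esub> x \<in> carrier R"
      using assms(1) r xr by (simp add: cring.axioms(1) monoid.m_closed ring.is_monoid)
    have "h (r \<otimes>\<^bsub>R\<^esub> x) = h r \<otimes>\<^bsub>S\<^esub> h x" using ring_hom_mult[OF assms(3) r xr] .
    also have "\<dots> \<in> h ` M" using ideal.I_l_closed[OF I] x r assms(4) by blast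
    finally obtain y where "y \<in> M" "h y = h (r \<otimes>\<^bsub>R\<^esub> x)" by auto
    then show "r \<otimes>\<^bsub>R\<^esub> x \<in> M" using sat rx by blast
  qed
next
  assume *: "\<forall>x\<in>M. \<forall>r\<in>carrier R. r \<otimes>\<^bsub>R\<^esub> x \<in> M"
  show "ideal (h ` M) S"
  proof (rule cring_idealI[OF assms(2)])
    show "h ` M \<subseteq> carrier S" using M(1) assms(4) by blast
    have "h \<zero>\<^bsub>R\<^esub> = \<zero>\<^bsub>S\<^esub>"
      using ring_hom_zero[OF assms(3)] assms(1,2) by (simp add: cring.axioms(1))
    then show "\<zero>\<^bsub>S\<^esub> \<in> h ` M" using M(2) by (metis image_eqI)
    show "x \<oplus>\<^bsub>S\<^esub> y \<in> h ` M" if xy: "x \<in> h ` M" "y \<in> h ` M" for x y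
    proof -
      obtain x' y' where "x' \<in> M" "y' \<in> M" "x = h x'" "y = h y'" using xy by blast
      then show ?thesis using ring_hom_add[OF assms(3), of x' y'] M by (metis image_eqI subsetD)
    qed
    show "r \<otimes>\<^bsub>S\<^esub> x \<in> h ` M" if xr: "x \<in> h ` M" "r \<in> carrier S" for x r
    proof -
      obtain x' r' where "x' \<in> M" "r' \<in> carrier R" "x = h x'" "r = h r'" using xr assms(4) by blast
      then show ?thesis using ring_hom_mult[OF assms(3), of r' x'] M(1) * by (metis image_eqI subsetD)
    qed
  qed
qed

lemma (in abelian_group) add_minus_cancel_right:
  "z \<in> carrier G \<Longrightarrow> y \<in> carrier G \<Longrightarrow> (z \<oplus> y) \<ominus> y = z"
  by (simp add: minus_eq a_assoc r_neg)

section \<open>The ring of germs at a point\<close>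

lemma holo_ring_simps [simp]:
  "carrier (holo_ring b) = {f. holo_at f b}"
  "x \<otimes>\<^bsub>holo_ring b\<^esub> y = (\<lambda>z. x z * y z)" "x \<oplus>\<^bsub>holo_ring b\<^esub> y = (\<lambda>z. x z + y z)"
  "\<zero>\<^bsub>holo_ring b\<^esub> = (\<lambda>_. 0)" "\<one>\<^bsub>holo_ring b\<^esub> = (\<lambda>_. 1)"
  by (simp_all add: holo_ring_def)

lemma cring_holo_ring: "cring (holo_ring (b :: complex ^ 'n::finite))"
proof (rule cringI)
  show "abelian_group (holo_ring b)"
  proof (rule abelian_groupI)
    fix f assume "f \<in> carrier (holo_ring b)"
    then show "\<exists>g\<in>carrier (holo_ring b). g \<oplus>\<^bsub>holo_ring b\<^esub> f = \<zero>\<^bsub>holo_ring b\<^esub>"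
      by (intro bexI[of _ "\<lambda>z. (-1) * f z"]) (use holo_at_cmult[of f b "-1"] in auto)
  qed (auto simp: holo_at_add algebra_simps)
  show "Group.comm_monoid (holo_ring b)"
    by (rule comm_monoidI) (auto simp: holo_at_mult algebra_simps)
qed (auto simp: algebra_simps)

lemma ideal_null_funs: "ideal (null_funs b) (holo_ring (b :: complex ^ 'n::finite))"
proof (rule cring_idealI[OF cring_holo_ring])
  show "x \<oplus>\<^bsub>holo_ring b\<^esub> y \<in> null_funs b" if "x \<in> null_funs b" "y \<in> null_funs b" for x y
    using that by (auto simp: null_funs_def holo_at_add elim: eventually_elim2)
  show "r \<otimes>\<^bsub>holo_ring b\<^esub> x \<in> null_funs b" if "x \<in> null_funs b" "r \<in> carrier (holo_ring b)" for x r
    using that by (auto simp: null_funs_def holo_at_mult elim: eventually_mono)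
qed (auto simp: null_funs_def)

lemma cring_germ_ring: "cring (germ_ring (b :: complex ^ 'n::finite))"
  unfolding germ_ring_def by (rule ideal.quotient_is_cring[OF ideal_null_funs cring_holo_ring])

lemma mem_germ_iff:
  assumes "holo_at f (b :: complex ^ 'n::finite)"
  shows "g \<in> germ b f \<longleftrightarrow> holo_at g b \<and> (\<forall>\<^sub>F z in nhds b. g z = f z)"
proof
  assume "g \<in> germ b f"
  then obtain h where "h \<in> null_funs b" "g = (\<lambda>z. h z + f z)"
    by (auto simp: germ_def a_r_coset_def')
  then show "holo_at g b \<and> (\<forall>\<^sub>F z in nhds b. g z = f z)"
    using assms by (auto simp: null_funs_def holo_at_add elim: eventually_mono)
next
  assume g: "holo_at g b \<and> (\<forall>\<^sub>F z in nhds b. g z = f z)"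
  then have "(\<lambda>z. g z - f z) \<in> null_funs b"
    using assms by (auto simp: null_funs_def holo_at_sub elim: eventually_mono)
  moreover have "g = (\<lambda>z. (g z - f z) + f z)" by simp
  ultimately show "g \<in> germ b f" by (auto simp: germ_def a_r_coset_def' intro!: bexI[of _ "\<lambda>z. g z - f z"])
qed

lemma germ_self: "holo_at f (b :: complex ^ 'n::finite) \<Longrightarrow> f \<in> germ b f"
  by (simp add: mem_germ_iff)

lemma germ_eq_iff:
  assumes "holo_at f (b :: complex ^ 'n::finite)" "holo_at g b"
  shows "germ b f = germ b g \<longleftrightarrow> (\<forall>\<^sub>F z in nhds b. f z = g z)"
proof
  assume "germ b f = germ b g"
  then show "\<forall>\<^sub>F z in nhds b. f z = g z" using germ_self[OF assms(1)] mem_germ_iff[OF assms(2)] by blast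
next
  assume *: "\<forall>\<^sub>F z in nhds b. f z = g z"
  have "h \<in> germ b f \<longleftrightarrow> h \<in> germ b g" for h
    unfolding mem_germ_iff[OF assms(1)] mem_germ_iff[OF assms(2)]
    using * by (auto elim: eventually_elim2)
  then show "germ b f = germ b g" by blast
qed

lemma germ_hom: "germ b \<in> ring_hom (holo_ring b) (germ_ring (b :: complex ^ 'n::finite))"
  using ideal.rcos_ring_hom[OF ideal_null_funs] unfolding germ_ring_def germ_def[abs_def] .

lemma carrier_germ_ring: "carrier (germ_ring (b :: complex ^ 'n::finite)) = germ b ` {f. holo_at f b}"
  by (auto simp: germ_ring_def FactRing_def A_RCOSETS_def' germ_def)

lemma zero_germ_ring: "\<zero>\<^bsub>germ_ring (b :: complex ^ 'n::finite)\<^esub> = germ b (\<lambda>_. 0)"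
  by (rule ring_hom_zero[OF germ_hom cring.axioms(1)[OF cring_holo_ring] cring.axioms(1)[OF cring_germ_ring], symmetric, unfolded holo_ring_simps])

lemma some_germ:
  assumes "holo_at f (b :: complex ^ 'n::finite)"
  shows "holo_at (SOME g. g \<in> germ b f) b" "\<forall>\<^sub>F z in nhds b. (SOME g. g \<in> germ b f) z = f z"
  using someI[of "\<lambda>g. g \<in> germ b f", OF germ_self[OF assms]] mem_germ_iff[OF assms] by auto

lemma germ_coeff_germ: "holo_at f (b :: complex ^ 'n::finite) \<Longrightarrow> germ_coeff b (germ b f) = taylor_coeff f b"
  unfolding germ_coeff_def by (rule ext) (rule taylor_coeff_cong[OF some_germ(2)])

lemma sform_germ: "holo_at f (b :: complex ^ 'n::finite) \<Longrightarrow> sform b p (germ b f) = pair p (taylor_coeff f b)"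
  by (simp add: sform_def pair_def germ_coeff_germ)

text \<open>The exceptional case is the zero germ on one side and the flat functions on the other;
  the identity theorem identifies them.\<close>

lemma least_part_germ:
  assumes "holo_at f (b :: complex ^ 'n::finite)"
  shows "least_part b (germ b f) = fun_least b f"
proof -
  have "germ b f = \<zero>\<^bsub>germ_ring b\<^esub> \<longleftrightarrow> (\<forall>k. ord_ge k f b)"
    using identity_theorem[OF assms] ord_ge_cong[of f "\<lambda>_. 0" b]
    by (auto simp: zero_germ_ring germ_eq_iff assms)
  then show ?thesis
    by (simp add: least_part_def fun_least_def germ_coeff_germ assms hom_part_def trunc_poly_def Let_def)
qed

lemma pullback_germ:
  fixes b :: "complex ^ 'n::finite" and \<Phi> :: "complex ^ 'n \<Rightarrow> complex ^ 'm::finite"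
  assumes "holo_map_at \<Phi> b" "\<Phi> b = a" "holo_at F a"
  shows "pullback b \<Phi> (germ a F) = germ b (\<lambda>t. F (\<Phi> t))"
proof -
  let ?G = "SOME G. G \<in> germ a F"
  have "\<forall>\<^sub>F t in nhds b. ?G (\<Phi> t) = F (\<Phi> t)"
    using holo_map_at_eventually[OF assms(1), of "\<lambda>x. ?G x = F x"] some_germ(2)[OF assms(3)] assms(2) by simp
  moreover have "holo_at (\<lambda>t. ?G (\<Phi> t)) b" "holo_at (\<lambda>t. F (\<Phi> t)) b"
    using holo_at_compose(1)[of _ \<Phi> b] some_germ(1)[OF assms(3)] assms by auto
  ultimately show ?thesis unfolding pullback_def comp_def by (subst germ_eq_iff) auto
qed

lemma fun_perp_holo: "f \<in> fun_perp b L \<Longrightarrow> holo_at f b"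
  by (simp add: fun_perp_def)

lemma fun_perp_zero: "(\<lambda>_. 0) \<in> fun_perp b L"
proof -
  have "taylor_coeff (\<lambda>_. 0) b = (\<lambda>_. 0)" by (rule ext) (simp add: taylor_coeff_def mdiff_const_zero)
  then show ?thesis by (simp add: fun_perp_def pair_def)
qed

lemma fun_perp_add:
  assumes "f \<in> fun_perp b L" "g \<in> fun_perp b L"
  shows "(\<lambda>z. f z + g z) \<in> fun_perp b L"
proof -
  have "pair p (taylor_coeff (\<lambda>z. f z + g z) b) = pair p (taylor_coeff f b) + pair p (taylor_coeff g b)" for p
    unfolding pair_add_right[symmetric]
    by (rule pair_cong) (use assms in \<open>simp add: taylor_coeff_add fun_perp_def\<close>)
  then show ?thesis using assms by (simp add: fun_perp_def holo_at_add)
qed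

lemma fun_perp_cong:
  assumes "f \<in> fun_perp b L" "\<forall>\<^sub>F z in nhds b. f z = g z"
  shows "g \<in> fun_perp b L"
proof -
  have "taylor_coeff f b = taylor_coeff g b" by (rule ext) (rule taylor_coeff_cong[OF assms(2)])
  then show ?thesis using assms holo_at_cong by (auto simp: fun_perp_def)
qed

lemma perp_eq: "perp b L = germ b ` fun_perp b L"
  unfolding perp_def carrier_germ_ring fun_perp_def by (auto simp: sform_germ)

lemma ideal_perp_iff: "ideal (perp b L) (germ_ring (b :: complex ^ 'n::finite)) \<longleftrightarrow> mult_closed b (fun_perp b L)"
proof -
  have "ideal (germ b ` fun_perp b L) (germ_ring b) \<longleftrightarrow>
     (\<forall>x\<in>fun_perp b L. \<forall>r\<in>carrier (holo_ring b). r \<otimes>\<^bsub>holo_ring b\<^esub> x \<in> fun_perp b L)"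
  proof (rule surj_hom_ideal_iff[OF cring_holo_ring cring_germ_ring germ_hom])
    fix x y assume "x \<in> fun_perp b L" "y \<in> carrier (holo_ring b)" "germ b x = germ b y"
    then show "y \<in> fun_perp b L" using fun_perp_cong fun_perp_holo germ_eq_iff by (metis holo_ring_simps(1) mem_Collect_eq)
  qed (auto simp: carrier_germ_ring fun_perp_holo fun_perp_zero fun_perp_add)
  then show ?thesis by (simp add: perp_eq mult_closed_def)
qed

subsection \<open>Germs on the submanifold\<close>

lemma vanishing_ideal_eq:
  "vanishing_ideal X a = germ a ` {F. holo_at F a \<and> (\<forall>\<^sub>F x in nhds (a :: complex ^ 'm::finite). x \<in> X \<longrightarrow> F x = 0)}"
proof -
  have "(\<forall>G\<in>germ a F. \<forall>\<^sub>F x in nhds a. x \<in> X \<longrightarrow> G x = 0) \<longleftrightarrow> (\<forall>\<^sub>F x in nhds a. x \<in> X \<longrightarrow> F x = 0)"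
    if "holo_at F a" for F
    using germ_self[OF that] by (auto simp: mem_germ_iff[OF that] elim: eventually_elim2)
  then show ?thesis unfolding vanishing_ideal_def carrier_germ_ring by auto
qed

lemma ideal_vanishing_ideal: "ideal (vanishing_ideal X a) (germ_ring (a :: complex ^ 'm::finite))"
proof -
  let ?M = "{F. holo_at F a \<and> (\<forall>\<^sub>F x in nhds a. x \<in> X \<longrightarrow> F x = 0)}"
  have "ideal (germ a ` ?M) (germ_ring a) \<longleftrightarrow> (\<forall>x\<in>?M. \<forall>r\<in>carrier (holo_ring a). r \<otimes>\<^bsub>holo_ring a\<^esub> x \<in> ?M)"
  proof (rule surj_hom_ideal_iff[OF cring_holo_ring cring_germ_ring germ_hom])
    show "x \<oplus>\<^bsub>holo_ring a\<^esub> y \<in> ?M" if "x \<in> ?M" "y \<in> ?M" for x y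
      using that by (auto simp: holo_at_add elim: eventually_elim2)
    show "y \<in> ?M" if "x \<in> ?M" "y \<in> carrier (holo_ring a)" "germ a x = germ a y" for x y
      using that by (auto simp: germ_eq_iff elim: eventually_elim2)
  qed (auto simp: carrier_germ_ring)
  moreover have "r \<otimes>\<^bsub>holo_ring a\<^esub> x \<in> ?M" if "x \<in> ?M" "r \<in> carrier (holo_ring a)" for x r
    using that by (auto simp: holo_at_mult elim: eventually_mono)
  ultimately show ?thesis unfolding vanishing_ideal_eq by blast
qed

text \<open>Germs on \<open>X\<close> are cosets of cosets. This direct map from functions allows
  both quotients to be handled through representatives.\<close>

definition X_germ :: "(complex ^ 'm::finite) set \<Rightarrow> complex ^ 'm \<Rightarrow> (complex ^ 'm \<Rightarrow> complex) \<Rightarrow> (complex ^ 'm \<Rightarrow> complex) set set"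
  where "X_germ X a F = vanishing_ideal X a +>\<^bsub>germ_ring a\<^esub> germ a F"

lemma cring_X_germ_ring: "cring (X_germ_ring X (a :: complex ^ 'm::finite))"
  unfolding X_germ_ring_def by (rule ideal.quotient_is_cring[OF ideal_vanishing_ideal cring_germ_ring])

lemma X_germ_hom: "X_germ X a \<in> ring_hom (holo_ring a) (X_germ_ring X (a :: complex ^ 'm::finite))"
  using ring_hom_trans[OF germ_hom ideal.rcos_ring_hom[OF ideal_vanishing_ideal]]
  unfolding X_germ_ring_def X_germ_def[abs_def] comp_def .

lemma carrier_X_germ_ring: "carrier (X_germ_ring X (a :: complex ^ 'm::finite)) = X_germ X a ` {F. holo_at F a}"
  by (auto simp: X_germ_ring_def FactRing_def A_RCOSETS_def' X_germ_def[abs_def] carrier_germ_ring)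

lemma zero_X_germ_ring: "\<zero>\<^bsub>X_germ_ring X (a :: complex ^ 'm::finite)\<^esub> = X_germ X a (\<lambda>_. 0)"
  by (rule ring_hom_zero[OF X_germ_hom cring.axioms(1)[OF cring_holo_ring] cring.axioms(1)[OF cring_X_germ_ring], symmetric, unfolded holo_ring_simps])

lemma mem_X_germ_iff:
  assumes "holo_at F (a :: complex ^ 'm::finite)"
  shows "A \<in> X_germ X a F \<longleftrightarrow> (\<exists>G. holo_at G a \<and> A = germ a G \<and> (\<forall>\<^sub>F x in nhds a. x \<in> X \<longrightarrow> G x = F x))"
proof -
  have add: "germ a H \<oplus>\<^bsub>germ_ring a\<^esub> germ a F = germ a (\<lambda>x. H x + F x)" if "holo_at H a" for H
    using ring_hom_add[OF germ_hom, of H a F] that assms by simp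
  have "A \<in> X_germ X a F \<longleftrightarrow> (\<exists>H. holo_at H a \<and> (\<forall>\<^sub>F x in nhds a. x \<in> X \<longrightarrow> H x = 0) \<and> A = germ a (\<lambda>x. H x + F x))"
    by (auto simp: X_germ_def a_r_coset_def' vanishing_ideal_eq add)
  also have "\<dots> \<longleftrightarrow> (\<exists>G. holo_at G a \<and> A = germ a G \<and> (\<forall>\<^sub>F x in nhds a. x \<in> X \<longrightarrow> G x = F x))"
  proof
    assume "\<exists>H. holo_at H a \<and> (\<forall>\<^sub>F x in nhds a. x \<in> X \<longrightarrow> H x = 0) \<and> A = germ a (\<lambda>x. H x + F x)"
    then obtain H where "holo_at H a" "\<forall>\<^sub>F x in nhds a. x \<in> X \<longrightarrow> H x = 0" "A = germ a (\<lambda>x. H x + F x)" by blast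
    then show "\<exists>G. holo_at G a \<and> A = germ a G \<and> (\<forall>\<^sub>F x in nhds a. x \<in> X \<longrightarrow> G x = F x)"
      using assms by (intro exI[of _ "\<lambda>x. H x + F x"]) (auto simp: holo_at_add elim: eventually_mono)
  next
    assume "\<exists>G. holo_at G a \<and> A = germ a G \<and> (\<forall>\<^sub>F x in nhds a. x \<in> X \<longrightarrow> G x = F x)"
    then obtain G where "holo_at G a" "A = germ a G" "\<forall>\<^sub>F x in nhds a. x \<in> X \<longrightarrow> G x = F x" by blast
    then show "\<exists>H. holo_at H a \<and> (\<forall>\<^sub>F x in nhds a. x \<in> X \<longrightarrow> H x = 0) \<and> A = germ a (\<lambda>x. H x + F x)"
      using assms by (intro exI[of _ "\<lambda>x. G x - F x"]) (auto simp: holo_at_sub elim: eventually_mono)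
  qed
  finally show ?thesis .
qed

lemma X_germ_eq_iff:
  assumes "holo_at F (a :: complex ^ 'm::finite)" "holo_at G a"
  shows "X_germ X a F = X_germ X a G \<longleftrightarrow> (\<forall>\<^sub>F x in nhds a. x \<in> X \<longrightarrow> F x = G x)"
proof
  assume "X_germ X a F = X_germ X a G"
  moreover have "germ a F \<in> X_germ X a F" unfolding mem_X_germ_iff[OF assms(1)] using assms by auto
  ultimately have "germ a F \<in> X_germ X a G" by simp
  then obtain H where "holo_at H a" "germ a F = germ a H" "\<forall>\<^sub>F x in nhds a. x \<in> X \<longrightarrow> H x = G x"
    unfolding mem_X_germ_iff[OF assms(2)] by blast
  then show "\<forall>\<^sub>F x in nhds a. x \<in> X \<longrightarrow> F x = G x"
    using assms by (auto simp: germ_eq_iff elim: eventually_elim2)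
next
  assume *: "\<forall>\<^sub>F x in nhds a. x \<in> X \<longrightarrow> F x = G x"
  have "(\<forall>\<^sub>F x in nhds a. x \<in> X \<longrightarrow> H x = F x) \<longleftrightarrow> (\<forall>\<^sub>F x in nhds a. x \<in> X \<longrightarrow> H x = G x)" for H
    using * by (auto elim: eventually_elim2)
  then have "A \<in> X_germ X a F \<longleftrightarrow> A \<in> X_germ X a G" for A
    unfolding mem_X_germ_iff[OF assms(1)] mem_X_germ_iff[OF assms(2)] by simp
  then show "X_germ X a F = X_germ X a G" by blast
qed

lemma X_germ_minus:
  assumes "holo_at F (a :: complex ^ 'm::finite)" "holo_at G a"
  shows "X_germ X a F \<ominus>\<^bsub>X_germ_ring X a\<^esub> X_germ X a G = X_germ X a (\<lambda>x. F x - G x)"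
proof -
  have h: "holo_at (\<lambda>x. F x - G x) a" using assms by (rule holo_at_sub)
  have "X_germ X a F = X_germ X a (\<lambda>x. F x - G x) \<oplus>\<^bsub>X_germ_ring X a\<^esub> X_germ X a G"
    using ring_hom_add[OF X_germ_hom, of "\<lambda>x. F x - G x" a G X] assms h by simp
  moreover have ag: "abelian_group (X_germ_ring X a)"
    by (rule ring.is_abelian_group[OF cring.axioms(1)[OF cring_X_germ_ring]])
  moreover have "X_germ X a H \<in> carrier (X_germ_ring X a)" if "holo_at H a" for H
    using that by (simp add: carrier_X_germ_ring)
  ultimately show ?thesis
    using abelian_group.add_minus_cancel_right[OF ag] h assms(2) by presburger
qed

subsection \<open>Local parametrisations\<close>

lemma holo_map_at_holo_map_on: "open W \<Longrightarrow> b \<in> W \<Longrightarrow> holo_map_on \<Phi> W \<Longrightarrow> holo_map_at \<Phi> b"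
  by (auto simp: holo_map_at_def holo_map_on_def holo_fun_on_def intro: holo_atI)

text \<open>The germ content of a local parametrisation: neighbourhoods give way to
  \<open>eventually\<close>, and \<Psi> is a holomorphic map of the ambient space that inverts
  \<Phi> on \<open>X\<close>.\<close>

definition param_pair :: "(complex ^ 'm::finite) set \<Rightarrow> complex ^ 'm \<Rightarrow> complex ^ 'n::finite
    \<Rightarrow> (complex ^ 'n \<Rightarrow> complex ^ 'm) \<Rightarrow> (complex ^ 'm \<Rightarrow> complex ^ 'n) \<Rightarrow> bool"
  where "param_pair X a b \<Phi> \<Psi> \<longleftrightarrow> holo_map_at \<Phi> b \<and> \<Phi> b = a \<and> holo_map_at \<Psi> a \<and> \<Psi> a = b \<and>
    (\<forall>\<^sub>F t in nhds b. \<Phi> t \<in> X \<and> \<Psi> (\<Phi> t) = t) \<and> (\<forall>\<^sub>F x in nhds a. x \<in> X \<longrightarrow> \<Phi> (\<Psi> x) = x)"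

lemma local_parametrisation_param_pair:
  assumes "local_parametrisation X a b \<Phi>"
  obtains \<Psi> where "param_pair X a b \<Phi> \<Psi>"
proof -
  obtain W U \<Psi> where *: "\<Phi> b = a" "open W" "b \<in> W" "open U" "a \<in> U" "holo_map_on \<Phi> W" "holo_map_on \<Psi> U"
    "homeomorphism W (X \<inter> U) \<Phi> \<Psi>"
    using assms by (auto simp: local_parametrisation_def)
  have "\<forall>\<^sub>F t in nhds b. \<Phi> t \<in> X \<and> \<Psi> (\<Phi> t) = t"
    unfolding eventually_nhds using *(2,3,8) by (intro exI[of _ W]) (auto simp: homeomorphism_def)
  moreover have "\<forall>\<^sub>F x in nhds a. x \<in> X \<longrightarrow> \<Phi> (\<Psi> x) = x"
    unfolding eventually_nhds using *(4,5,8) by (intro exI[of _ U]) (auto simp: homeomorphism_def)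
  moreover have "\<Psi> a = b" using * by (auto simp: homeomorphism_def)
  ultimately show thesis
    using *(1) holo_map_at_holo_map_on[OF *(2,3,6)] holo_map_at_holo_map_on[OF *(4,5,7)] that[of \<Psi>]
    by (simp add: param_pair_def)
qed

lemma poly_eval_shift: "poly_eval p = shift_poly 0 p"
  by (rule ext) (simp add: poly_eval_def shift_poly_def shift_monom_def)

lemma holo_at_poly_eval [simp]: "holo_at (poly_eval p) c"
  by (simp add: poly_eval_shift)

lemma poly_eval_superset:
  assumes "finite K" "Poly_Mapping.keys p \<subseteq> K"
  shows "poly_eval p z = (\<Sum>\<nu>\<in>K. Poly_Mapping.lookup p \<nu> * (\<Prod>i\<in>UNIV. (z $ i) ^ Poly_Mapping.lookup \<nu> i))"
  unfolding poly_eval_def by (rule sum.mono_neutral_left) (use assms in \<open>auto simp: in_keys_iff\<close>)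

lemma poly_eval_add: "poly_eval (p + q) z = poly_eval p z + poly_eval q z"
proof -
  have "Poly_Mapping.keys (p + q) \<subseteq> Poly_Mapping.keys p \<union> Poly_Mapping.keys q"
    by (rule keys_add)
  then show ?thesis
    by (simp add: poly_eval_superset[of "Poly_Mapping.keys p \<union> Poly_Mapping.keys q"] lookup_add
        sum.distrib[symmetric] algebra_simps)
qed

lemma poly_eval_scale: "poly_eval (poly_scale c p) z = c * poly_eval p z"
proof -
  have "Poly_Mapping.keys (poly_scale c p) \<subseteq> Poly_Mapping.keys p"
    by (auto simp: in_keys_iff)
  then show ?thesis
    by (simp add: poly_eval_superset[of "Poly_Mapping.keys p"] sum_distrib_left algebra_simps)
qed

lemma poly_eval_zero [simp]: "poly_eval 0 z = 0"
  by (simp add: poly_eval_def)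

section \<open>Polynomials in a parametrisation, and change of parametrisation\<close>

definition Phi_funs :: "(complex ^ 'n::finite \<Rightarrow> complex ^ 'm::finite) \<Rightarrow> nat \<Rightarrow> (complex ^ 'n \<Rightarrow> complex) set"
  where "Phi_funs \<Phi> d = (\<lambda>p t. poly_eval p (\<Phi> t)) ` polys_le d"

text \<open>Stationarity is a dimension count on the side of polynomials: those of degree at most d
  whose composition with \<Phi> has order at least k form a decreasing sequence of
  subspaces.\<close>

lemma germ_space_Phi_funs:
  assumes "holo_map_at \<Phi> b"
  shows "germ_space b (Phi_funs \<Phi> d)"
proof -
  have hol: "holo_at (\<lambda>t. poly_eval p (\<Phi> t)) b" for p
    using holo_at_compose(1)[of "poly_eval p" \<Phi> b] assms by simp
  define V where "V k = {p \<in> polys_le d. ord_ge k (\<lambda>t. poly_eval p (\<Phi> t)) b}" for k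
  have "cpoly.subspace (V k)" for k
  proof (rule cpoly.subspaceI)
    show "0 \<in> V k" by (auto simp: V_def polys_le_def)
    fix x y assume "x \<in> V k" "y \<in> V k"
    then show "x + y \<in> V k"
      by (auto simp: V_def poly_eval_add ord_ge_add hol cpoly.subspace_add[OF subspace_polys_le])
  next
    fix c x assume "x \<in> V k"
    then show "poly_scale c x \<in> V k"
      by (auto simp: V_def poly_eval_scale ord_ge_cmult hol cpoly.subspace_scale[OF subspace_polys_le])
  qed
  then obtain K where K: "\<And>k. K \<le> k \<Longrightarrow> V k = V K"
    using decreasing_subspaces_stationary[of V d] ord_ge_mono unfolding V_def by blast
  have "ord_ge k (\<lambda>t. poly_eval p (\<Phi> t)) b"
    if p: "p \<in> polys_le d" "ord_ge K (\<lambda>t. poly_eval p (\<Phi> t)) b" for p k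
  proof -
    have "p \<in> V (max k K)" using K[of "max k K"] p by (simp add: V_def)
    then show ?thesis using ord_ge_mono[of "max k K" _ b k] by (simp add: V_def)
  qed
  then have "\<exists>K. \<forall>f\<in>Phi_funs \<Phi> d. ord_ge K f b \<longrightarrow> (\<forall>k. ord_ge k f b)"
    by (intro exI[of _ K]) (auto simp: Phi_funs_def)
  moreover have "(\<lambda>_. 0) \<in> Phi_funs \<Phi> d"
    unfolding Phi_funs_def by (rule image_eqI[of _ _ 0]) (auto simp: polys_le_def)
  moreover have "(\<lambda>z. f z + g z) \<in> Phi_funs \<Phi> d" if "f \<in> Phi_funs \<Phi> d" "g \<in> Phi_funs \<Phi> d" for f g
  proof -
    obtain p q where "p \<in> polys_le d" "q \<in> polys_le d" "f = (\<lambda>t. poly_eval p (\<Phi> t))" "g = (\<lambda>t. poly_eval q (\<Phi> t))"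
      using \<open>f \<in> _\<close> \<open>g \<in> _\<close> unfolding Phi_funs_def by blast
    then show ?thesis unfolding Phi_funs_def
      by (intro image_eqI[of _ _ "p + q"]) (auto simp: poly_eval_add cpoly.subspace_add[OF subspace_polys_le])
  qed
  moreover have "(\<lambda>z. c * f z) \<in> Phi_funs \<Phi> d" if "f \<in> Phi_funs \<Phi> d" for f c
  proof -
    obtain p where "p \<in> polys_le d" "f = (\<lambda>t. poly_eval p (\<Phi> t))"
      using \<open>f \<in> _\<close> unfolding Phi_funs_def by auto
    then show ?thesis unfolding Phi_funs_def
      by (intro image_eqI[of _ _ "poly_scale c p"]) (auto simp: poly_eval_scale cpoly.subspace_scale[OF subspace_polys_le])
  qed
  moreover have "\<forall>f\<in>Phi_funs \<Phi> d. holo_at f b" using hol by (auto simp: Phi_funs_def)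
  ultimately show ?thesis unfolding germ_space_def by blast
qed

lemma holo_map_at_compose:
  assumes "holo_map_at \<Psi> (\<Phi> b)" "holo_map_at \<Phi> b"
  shows "holo_map_at (\<lambda>t. \<Psi> (\<Phi> t)) b"
  unfolding holo_map_at_def
proof
  fix j
  have "holo_at (\<lambda>x. \<Psi> x $ j) (\<Phi> b)" using assms(1) by (simp add: holo_map_at_def)
  from holo_at_compose(1)[OF this assms(2)] show "holo_at (\<lambda>t. \<Psi> (\<Phi> t) $ j) b" .
qed

lemma param_pair_transition:
  assumes "param_pair X a b \<Phi> \<Psi>" "param_pair X a b' \<Phi>' \<Psi>'"
  shows "holo_map_at (\<lambda>t. \<Psi> (\<Phi>' t)) b'" "\<Psi> (\<Phi>' b') = b" "\<forall>\<^sub>F t in nhds b'. \<Phi>' t = \<Phi> (\<Psi> (\<Phi>' t))"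
proof -
  show "holo_map_at (\<lambda>t. \<Psi> (\<Phi>' t)) b'" "\<Psi> (\<Phi>' b') = b"
    using assms by (auto simp: param_pair_def intro: holo_map_at_compose)
  have "\<forall>\<^sub>F t in nhds b'. \<Phi>' t \<in> X \<longrightarrow> \<Phi> (\<Psi> (\<Phi>' t)) = \<Phi>' t"
    using holo_map_at_eventually[of \<Phi>' b' "\<lambda>x. x \<in> X \<longrightarrow> \<Phi> (\<Psi> x) = x"] assms by (auto simp: param_pair_def)
  moreover have "\<forall>\<^sub>F t in nhds b'. \<Phi>' t \<in> X" using assms(2) by (auto simp: param_pair_def elim: eventually_mono)
  ultimately show "\<forall>\<^sub>F t in nhds b'. \<Phi>' t = \<Phi> (\<Psi> (\<Phi>' t))" by eventually_elim simp
qed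

text \<open>The transition maps \<Psi> o \<Phi>' and \<Psi>' o \<Phi> match the two function spaces:
  the same polynomial p, composed with \<Phi> and with \<Phi>', gives corresponding
  functions.\<close>

lemma deriv_approx_parametrisation:
  assumes \<Phi>: "param_pair X a b \<Phi> \<Psi>" and \<Phi>': "param_pair X a b' \<Phi>' \<Psi>'"
    and "deriv_approx b (Phi_funs \<Phi> d)"
  shows "deriv_approx b' (Phi_funs \<Phi>' d)"
proof (rule deriv_approx_transport[where \<theta> = "\<lambda>t. \<Psi> (\<Phi>' t)" and \<eta> = "\<lambda>t. \<Psi>' (\<Phi> t)"])
  show "germ_space b (Phi_funs \<Phi> d)" "germ_space b' (Phi_funs \<Phi>' d)"
    using \<Phi> \<Phi>' by (auto simp: param_pair_def intro: germ_space_Phi_funs)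
  note t1 = param_pair_transition[OF \<Phi> \<Phi>'] and t2 = param_pair_transition[OF \<Phi>' \<Phi>]
  have e1: "\<forall>\<^sub>F t in nhds b'. poly_eval p (\<Phi>' t) = poly_eval p (\<Phi> (\<Psi> (\<Phi>' t)))" for p
    using t1(3) by eventually_elim simp
  have e2: "\<forall>\<^sub>F t in nhds b. poly_eval p (\<Phi> t) = poly_eval p (\<Phi>' (\<Psi>' (\<Phi> t)))" for p
    using t2(3) by eventually_elim simp
  show "\<exists>f'\<in>Phi_funs \<Phi>' d. \<forall>\<^sub>F t in nhds b'. f' t = f (\<Psi> (\<Phi>' t))" if "f \<in> Phi_funs \<Phi> d" for f
    using that e1 unfolding Phi_funs_def by auto
  show "\<exists>f\<in>Phi_funs \<Phi> d. (\<forall>\<^sub>F t in nhds b'. f' t = f (\<Psi> (\<Phi>' t))) \<and> (\<forall>\<^sub>F t in nhds b. f t = f' (\<Psi>' (\<Phi> t)))"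
    if "f' \<in> Phi_funs \<Phi>' d" for f'
    using that e1 e2 unfolding Phi_funs_def by auto
qed (use assms(3) param_pair_transition[OF \<Phi> \<Phi>'] param_pair_transition[OF \<Phi>' \<Phi>] in auto)

lemma bundle_point_param_deriv_approx:
  fixes b :: "complex ^ 'n::finite"
  assumes "bundle_point_param b \<Phi> d"
  shows "deriv_approx b (Phi_funs \<Phi> d)"
proof -
  have Z: "(\<lambda>p. poly_eval p \<circ> \<Phi>) ` polys_le d = Phi_funs \<Phi> d"
    by (simp add: Phi_funs_def comp_def)
  obtain W where W: "open W" "b \<in> W" "holo_map_on \<Phi> W" "bundle_point_on W (Phi_funs \<Phi> d) b"
    using assms unfolding bundle_point_param_def Z by blast
  show ?thesis
  proof (rule bundle_imp_deriv_approx[OF germ_space_Phi_funs[OF holo_map_at_holo_map_on[OF W(1-3)]] W(1,2)])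
    fix f assume "f \<in> Phi_funs \<Phi> d"
    then obtain p where f: "f = (\<lambda>t. poly_eval p (\<Phi> t))" by (auto simp: Phi_funs_def)
    show "holo_fun_on f W"
      unfolding holo_fun_on_def f
    proof
      fix t assume "t \<in> W"
      then show "complex_diff_at (\<lambda>t. poly_eval p (\<Phi> t)) t"
        using complex_diff_at_compose(1)[of "poly_eval p" \<Phi> t] W(3)
        by (simp add: holo_at_diff holo_map_on_def)
    qed
  next
    fix k t assume t: "t \<in> W"
    \<comment> \<open>Jets of order k lie in the span of finitely many monomials; the dimensions are
      therefore bounded on \<open>W\<close>, and \<open>Max\<close> is taken over a finite
      set.\<close>
    let ?M = "(\<lambda>\<nu>. Poly_Mapping.single \<nu> 1) ` {\<nu>::'n \<Rightarrow>\<^sub>0 nat. mdeg \<nu> \<le> k} :: 'n cpoly set"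
    have "cpoly.dim (jet_space (Phi_funs \<Phi> d) k s) \<le> card ?M" for s
    proof (rule cpoly.dim_le_card)
      have "jet_space (Phi_funs \<Phi> d) k s \<subseteq> polys_le k"
        using keys_trunc_poly[of "{\<nu>::'n \<Rightarrow>\<^sub>0 nat. mdeg \<nu> \<le> k}"]
        by (auto simp: jet_space_def polys_le_def trunc_poly_def[symmetric])
      then show "jet_space (Phi_funs \<Phi> d) k s \<subseteq> cpoly.span ?M" using polys_le_span_finite by blast
    qed simp
    then have "finite ((\<lambda>s. cpoly.dim (jet_space (Phi_funs \<Phi> d) k s)) ` W)"
      by (intro finite_subset[OF _ finite_atMost[of "card ?M"]]) auto
    then show "cpoly.dim (jet_space (Phi_funs \<Phi> d) k t) \<le> cpoly.dim (jet_space (Phi_funs \<Phi> d) k b)"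
      using W(4) t unfolding bundle_point_on_def by (metis Max_ge image_eqI)
  qed
qed

section \<open>Adjoint, annihilators and Taylor projector for a fixed parametrisation\<close>

context
  fixes X :: "(complex ^ 'm::finite) set" and a :: "complex ^ 'm"
    and b :: "complex ^ 'n::finite" and \<Phi> \<Psi>
  assumes P: "param_pair X a b \<Phi> \<Psi>"
begin

lemma param_holo: "holo_map_at \<Phi> b" "\<Phi> b = a" "holo_map_at \<Psi> a" "\<Psi> a = b"
  using P by (auto simp: param_pair_def)

lemma holo_at_subst: "holo_at F a \<Longrightarrow> holo_at (\<lambda>t. F (\<Phi> t)) b"
  using holo_at_compose(1)[of F \<Phi> b] param_holo by simp

text \<open>Surjectivity of \<phi>. The preimage is g o \<Psi>, which makes sense because \<Psi> is
  holomorphic on a neighbourhood of a and not just on \<open>X\<close>.\<close>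

lemma subst_surj:
  assumes "holo_at g b"
  obtains G where "holo_at G a" "\<forall>\<^sub>F t in nhds b. G (\<Phi> t) = g t"
proof
  show "holo_at (\<lambda>x. g (\<Psi> x)) a" using holo_at_compose(1)[of g \<Psi> a] param_holo assms by simp
  show "\<forall>\<^sub>F t in nhds b. g (\<Psi> (\<Phi> t)) = g t"
    using P by (auto simp: param_pair_def elim: eventually_mono)
qed

text \<open>Near a the points of \<open>X\<close> are values of \<Phi> near b, and continuity of
  \<Phi> and \<Psi> transports the neighbourhoods.\<close>

lemma eventually_on_X_iff:
  "(\<forall>\<^sub>F x in nhds a. x \<in> X \<longrightarrow> F x = G x) \<longleftrightarrow> (\<forall>\<^sub>F t in nhds b. F (\<Phi> t) = G (\<Phi> t))"
proof
  assume "\<forall>\<^sub>F x in nhds a. x \<in> X \<longrightarrow> F x = G x"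
  then have "\<forall>\<^sub>F t in nhds b. \<Phi> t \<in> X \<longrightarrow> F (\<Phi> t) = G (\<Phi> t)"
    using holo_map_at_eventually[OF param_holo(1), of "\<lambda>x. x \<in> X \<longrightarrow> F x = G x"] param_holo(2) by simp
  moreover have "\<forall>\<^sub>F t in nhds b. \<Phi> t \<in> X" using P by (auto simp: param_pair_def elim: eventually_mono)
  ultimately show "\<forall>\<^sub>F t in nhds b. F (\<Phi> t) = G (\<Phi> t)" by eventually_elim simp
next
  assume "\<forall>\<^sub>F t in nhds b. F (\<Phi> t) = G (\<Phi> t)"
  then have "\<forall>\<^sub>F x in nhds a. F (\<Phi> (\<Psi> x)) = G (\<Phi> (\<Psi> x))"
    using holo_map_at_eventually[OF param_holo(3), of "\<lambda>t. F (\<Phi> t) = G (\<Phi> t)"] param_holo(4) by simp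
  moreover have "\<forall>\<^sub>F x in nhds a. x \<in> X \<longrightarrow> \<Phi> (\<Psi> x) = x" using P by (simp add: param_pair_def)
  ultimately show "\<forall>\<^sub>F x in nhds a. x \<in> X \<longrightarrow> F x = G x" by eventually_elim auto
qed

lemma Phi_polys_eq: "Phi_polys a b \<Phi> d = germ b ` Phi_funs \<Phi> d"
  by (simp add: Phi_polys_def Phi_funs_def pullback_germ[OF param_holo(1,2)] image_image)

lemma germ_space_param: "germ_space b (Phi_funs \<Phi> d)"
  by (rule germ_space_Phi_funs[OF param_holo(1)])

lemma least_space_eq: "least_space b (Phi_polys a b \<Phi> d) = cpoly.span (fun_least b ` Phi_funs \<Phi> d)"
proof -
  have "least_part b ` germ b ` Phi_funs \<Phi> d = fun_least b ` Phi_funs \<Phi> d"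
    using germ_space_holo[OF germ_space_param] by (simp add: image_image least_part_germ)
  then show ?thesis by (simp add: least_space_def Phi_polys_eq)
qed

lemma adjoint_map_eqI:
  assumes "\<And>F. holo_at F a \<Longrightarrow> pair q (taylor_coeff F a) = pair p (taylor_coeff (\<lambda>t. F (\<Phi> t)) b)"
  shows "adjoint_map a b \<Phi> p = q"
proof -
  have "(\<forall>F\<in>carrier (germ_ring a). sform a q' F = sform b p (pullback b \<Phi> F)) \<longleftrightarrow>
      (\<forall>F. holo_at F a \<longrightarrow> pair q' (taylor_coeff F a) = pair p (taylor_coeff (\<lambda>t. F (\<Phi> t)) b))" for q'
    by (simp add: carrier_germ_ring sform_germ pullback_germ[OF param_holo(1,2)] holo_at_subst)
  moreover have "(THE q'. \<forall>F. holo_at F a \<longrightarrow> pair q' (taylor_coeff F a) = pair p (taylor_coeff (\<lambda>t. F (\<Phi> t)) b)) = q"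
  proof (rule the_equality)
    fix q' assume "\<forall>F. holo_at F a \<longrightarrow> pair q' (taylor_coeff F a) = pair p (taylor_coeff (\<lambda>t. F (\<Phi> t)) b)"
    then have "pair q' (taylor_coeff F a) = pair q (taylor_coeff F a)" if "holo_at F a" for F
      using assms that by simp
    then show "q' = q" by (rule pair_unique)
  qed (use assms in blast)
  ultimately show ?thesis by (simp add: adjoint_map_def)
qed

lemma pair_adjoint_map:
  assumes "holo_at F a"
  shows "pair (adjoint_map a b \<Phi> p) (taylor_coeff F a) = pair p (taylor_coeff (\<lambda>t. F (\<Phi> t)) b)"
proof -
  \<comment> \<open>Existence of the adjoint is known under a degree bound, and each polynomial has
    one; the inserted 0 covers p = 0.\<close>
  have "p \<in> polys_le (Max (insert 0 (mdeg ` Poly_Mapping.keys p)))"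
    by (auto simp: polys_le_def)
  then obtain q where q: "\<And>F. holo_at F a \<Longrightarrow> pair q (taylor_coeff F a) = pair p (taylor_coeff (\<lambda>t. F (\<Phi> t)) b)"
    using adjoint_exists[OF param_holo(1,2)] by blast
  then show ?thesis using adjoint_map_eqI[OF q] assms by simp
qed

lemma adjoint_map_polys_le: "p \<in> polys_le N \<Longrightarrow> adjoint_map a b \<Phi> p \<in> polys_le N"
  using adjoint_exists[OF param_holo(1,2)] adjoint_map_eqI by metis

lemma subspace_adjoint_image:
  assumes "cpoly.subspace L"
  shows "cpoly.subspace (adjoint_map a b \<Phi> ` L)"
proof (rule cpoly.subspaceI)
  have "adjoint_map a b \<Phi> 0 = 0" by (rule adjoint_map_eqI) simp
  then show "0 \<in> adjoint_map a b \<Phi> ` L" using cpoly.subspace_0[OF assms] by (metis image_eqI)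
next
  fix x y assume "x \<in> adjoint_map a b \<Phi> ` L" "y \<in> adjoint_map a b \<Phi> ` L"
  then obtain p q where pq: "p \<in> L" "q \<in> L" "x = adjoint_map a b \<Phi> p" "y = adjoint_map a b \<Phi> q" by blast
  have "adjoint_map a b \<Phi> (p + q) = x + y"
    by (rule adjoint_map_eqI) (simp add: pair_add pair_adjoint_map pq)
  then show "x + y \<in> adjoint_map a b \<Phi> ` L" using cpoly.subspace_add[OF assms pq(1,2)] by (metis image_eqI)
next
  fix c x assume "x \<in> adjoint_map a b \<Phi> ` L"
  then obtain p where p: "p \<in> L" "x = adjoint_map a b \<Phi> p" by blast
  have "adjoint_map a b \<Phi> (poly_scale c p) = poly_scale c x"
    by (rule adjoint_map_eqI) (simp add: pair_scale pair_adjoint_map p)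
  then show "poly_scale c x \<in> adjoint_map a b \<Phi> ` L"
    using cpoly.subspace_scale[OF assms p(1)] by (metis image_eqI)
qed

text \<open>As \<phi> is surjective, the adjoint image tests p against every germ at b.\<close>

lemma adjoint_map_inj:
  assumes "adjoint_map a b \<Phi> p = adjoint_map a b \<Phi> q"
  shows "p = q"
proof (rule pair_unique)
  fix g assume "holo_at g b"
  then obtain G where G: "holo_at G a" "\<forall>\<^sub>F t in nhds b. G (\<Phi> t) = g t" by (rule subst_surj)
  have "taylor_coeff (\<lambda>t. G (\<Phi> t)) b = taylor_coeff g b"
    by (rule ext) (rule taylor_coeff_cong[OF G(2)])
  then show "pair p (taylor_coeff g b) = pair q (taylor_coeff g b)"
    using pair_adjoint_map[OF G(1)] assms by metis
qed

text \<open>The preimage under \<phi> of the annihilator of \<open>L\<close>. It serves twice: as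
  the annihilator of the adjoint image of \<open>L\<close> among functions near a, and as a set of
  representatives for the annihilator in the germs on \<open>X\<close>.\<close>

definition subst_perp :: "'n cpoly set \<Rightarrow> (complex ^ 'm \<Rightarrow> complex) set"
  where "subst_perp L = {F. holo_at F a \<and> (\<lambda>t. F (\<Phi> t)) \<in> fun_perp b L}"

lemma fun_perp_adjoint_image: "fun_perp a (adjoint_map a b \<Phi> ` L) = subst_perp L"
  by (auto simp: fun_perp_def subst_perp_def pair_adjoint_map holo_at_subst)

text \<open>By surjectivity of \<phi> both factors of a product at b lift to a, up to equality near
  b, which annihilators do not notice.\<close>

lemma mult_closed_subst_perp: "mult_closed a (subst_perp L) \<longleftrightarrow> mult_closed b (fun_perp b L)"
proof
  assume M: "mult_closed a (subst_perp L)"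
  show "mult_closed b (fun_perp b L)"
    unfolding mult_closed_def
  proof (intro ballI allI impI)
    fix f g assume f: "f \<in> fun_perp b L" and g: "holo_at g b"
    obtain F where F: "holo_at F a" "\<forall>\<^sub>F t in nhds b. F (\<Phi> t) = f t" using subst_surj fun_perp_holo[OF f] by blast
    obtain G where G: "holo_at G a" "\<forall>\<^sub>F t in nhds b. G (\<Phi> t) = g t" using subst_surj g by blast
    have "\<forall>\<^sub>F t in nhds b. f t = F (\<Phi> t)" using F(2) by eventually_elim simp
    then have "F \<in> subst_perp L" using F(1) fun_perp_cong[OF f] by (simp add: subst_perp_def)
    then have "(\<lambda>t. G (\<Phi> t) * F (\<Phi> t)) \<in> fun_perp b L"
      using M G(1) unfolding mult_closed_def subst_perp_def by blast
    then show "(\<lambda>t. g t * f t) \<in> fun_perp b L"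
      by (rule fun_perp_cong) (use F(2) G(2) in \<open>eventually_elim, simp\<close>)
  qed
next
  assume "mult_closed b (fun_perp b L)"
  then show "mult_closed a (subst_perp L)"
    unfolding mult_closed_def subst_perp_def using holo_at_subst by (auto intro: holo_at_mult)
qed

lemma X_pullback_X_germ:
  assumes "holo_at F a"
  shows "X_pullback b \<Phi> (X_germ X a F) = germ b (\<lambda>t. F (\<Phi> t))"
proof -
  have "germ a F \<in> X_germ X a F" unfolding mem_X_germ_iff[OF assms] using assms by auto
  then have "(SOME A. A \<in> X_germ X a F) \<in> X_germ X a F" by (rule someI)
  then obtain G where G: "holo_at G a" "(SOME A. A \<in> X_germ X a F) = germ a G" "\<forall>\<^sub>F x in nhds a. x \<in> X \<longrightarrow> G x = F x"
    unfolding mem_X_germ_iff[OF assms] by blast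
  then show ?thesis
    using assms by (simp add: X_pullback_def pullback_germ[OF param_holo(1,2)] germ_eq_iff holo_at_subst eventually_on_X_iff)
qed

text \<open>Injectivity of the adjoint makes the description in \<open>X_sform\<close>
  unambiguous.\<close>

lemma X_sform_X_germ:
  assumes "holo_at F a"
  shows "X_sform a b \<Phi> (adjoint_map a b \<Phi> p) (X_germ X a F) = pair p (taylor_coeff (\<lambda>t. F (\<Phi> t)) b)"
  unfolding X_sform_def X_pullback_X_germ[OF assms] sform_germ[OF holo_at_subst[OF assms]]
  by (rule the_equality) (auto dest: adjoint_map_inj)

lemma X_perp_eq: "X_perp X a b \<Phi> (adjoint_map a b \<Phi> ` L) = X_germ X a ` subst_perp L"
  by (auto simp: X_perp_def carrier_X_germ_ring subst_perp_def fun_perp_def X_sform_X_germ holo_at_subst)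

lemma ideal_X_perp_iff:
  "ideal (X_perp X a b \<Phi> (adjoint_map a b \<Phi> ` L)) (X_germ_ring X a) \<longleftrightarrow> mult_closed b (fun_perp b L)"
proof -
  have "ideal (X_germ X a ` subst_perp L) (X_germ_ring X a) \<longleftrightarrow>
     (\<forall>x\<in>subst_perp L. \<forall>r\<in>carrier (holo_ring a). r \<otimes>\<^bsub>holo_ring a\<^esub> x \<in> subst_perp L)"
  proof (rule surj_hom_ideal_iff[OF cring_holo_ring cring_X_germ_ring X_germ_hom])
    fix F G assume F: "F \<in> subst_perp L" and G: "G \<in> carrier (holo_ring a)" and "X_germ X a F = X_germ X a G"
    then have "\<forall>\<^sub>F t in nhds b. F (\<Phi> t) = G (\<Phi> t)"
      by (auto simp: X_germ_eq_iff subst_perp_def eventually_on_X_iff)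
    then show "G \<in> subst_perp L" using F G fun_perp_cong by (auto simp: subst_perp_def)
  next
    fix F G assume "F \<in> subst_perp L" "G \<in> subst_perp L"
    then show "F \<oplus>\<^bsub>holo_ring a\<^esub> G \<in> subst_perp L"
      using fun_perp_add[of "\<lambda>t. F (\<Phi> t)" b L "\<lambda>t. G (\<Phi> t)"] by (simp add: subst_perp_def holo_at_add)
  qed (auto simp: carrier_X_germ_ring subst_perp_def fun_perp_zero)
  then show ?thesis
    unfolding X_perp_eq mult_closed_subst_perp[symmetric] by (simp add: mult_closed_def)
qed

lemma bos_calvi_eq: "bos_calvi a b \<Phi> d = adjoint_map a b \<Phi> ` cpoly.span (fun_least b ` Phi_funs \<Phi> d)"
  by (simp add: bos_calvi_def least_space_eq)

lemma X_polys_eq: "X_polys X a d = (\<lambda>p. X_germ X a (poly_eval p)) ` polys_le d"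
  by (simp add: X_polys_def X_germ_def)

text \<open>The projector is a definite description, so existence and uniqueness come first.
  Existence is interpolation from the least space. Two solutions differ by an element of the
  function space that is annihilated by its own least space, hence flat, hence zero near b.\<close>

lemma taylor_kernel_eq:
  "taylor_kernel X a b \<Phi> d = X_perp X a b \<Phi> (bos_calvi a b \<Phi> d)"
proof -
  let ?L = "cpoly.span (fun_least b ` Phi_funs \<Phi> d)"
  define good where "good F p \<longleftrightarrow> p \<in> X_polys X a d \<and>
    (\<forall>q\<in>bos_calvi a b \<Phi> d. X_sform a b \<Phi> q (F \<ominus>\<^bsub>X_germ_ring X a\<^esub> p) = 0)" for F p
  have tc: "taylor_coeff (\<lambda>t. F (\<Phi> t) - G (\<Phi> t)) b = (\<lambda>\<nu>. taylor_coeff (\<lambda>t. F (\<Phi> t)) b \<nu> - taylor_coeff (\<lambda>t. G (\<Phi> t)) b \<nu>)"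
    if "holo_at F a" "holo_at G a" for F G
    by (rule ext) (rule taylor_coeff_diff[OF holo_at_subst[OF that(1)] holo_at_subst[OF that(2)]])
  have good_iff: "good (X_germ X a F) (X_germ X a (poly_eval p)) \<longleftrightarrow>
     (\<forall>q\<in>?L. pair q (\<lambda>\<nu>. taylor_coeff (\<lambda>t. F (\<Phi> t)) b \<nu> - taylor_coeff (\<lambda>t. poly_eval p (\<Phi> t)) b \<nu>) = 0)"
    if "p \<in> polys_le d" "holo_at F a" for F p
    using that by (auto simp: good_def X_polys_eq bos_calvi_eq X_germ_minus X_sform_X_germ holo_at_sub tc)
  have ex: "\<exists>p\<in>polys_le d. good (X_germ X a F) (X_germ X a (poly_eval p))" if "holo_at F a" for F
    using least_span_interpolation[OF germ_space_param[of d], of "taylor_coeff (\<lambda>t. F (\<Phi> t)) b"] that good_iff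
    unfolding Phi_funs_def by auto
  have uniq: "X_germ X a (poly_eval p) = X_germ X a (poly_eval p')"
    if p: "p \<in> polys_le d" "p' \<in> polys_le d" and F: "holo_at F a"
      and g: "good (X_germ X a F) (X_germ X a (poly_eval p))" "good (X_germ X a F) (X_germ X a (poly_eval p'))" for p p' F
  proof -
    \<comment> \<open>Written with the factor -1 so that closure under sums and multiples places the
      difference in the function space.\<close>
    define h where "h t = poly_eval p (\<Phi> t) + (-1) * poly_eval p' (\<Phi> t)" for t
    have hZ: "h \<in> Phi_funs \<Phi> d"
      unfolding h_def using p
      by (intro germ_space_add[OF germ_space_param] germ_space_cmult[OF germ_space_param]) (auto simp: Phi_funs_def)
    have h_eq: "h = (\<lambda>t. poly_eval p (\<Phi> t) - poly_eval p' (\<Phi> t))" by (auto simp: h_def)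
    have "pair q (taylor_coeff h b) = 0" if "q \<in> ?L" for q
      using good_iff[OF p(1) F] good_iff[OF p(2) F] g that
      by (simp add: h_eq tc pair_diff_right)
    then have "\<And>k. ord_ge k h b" using least_span_nondegenerate[OF germ_space_param hZ] by blast
    then have "\<forall>\<^sub>F t in nhds b. h t = 0"
      using identity_theorem germ_space_holo[OF germ_space_param hZ] by blast
    then have "\<forall>\<^sub>F t in nhds b. poly_eval p (\<Phi> t) = poly_eval p' (\<Phi> t)"
      by (simp add: h_eq)
    then show ?thesis by (simp add: X_germ_eq_iff eventually_on_X_iff)
  qed
  have zero: "\<zero>\<^bsub>X_germ_ring X a\<^esub> = X_germ X a (poly_eval 0)" "0 \<in> polys_le d"
    by (auto simp: zero_X_germ_ring polys_le_def intro!: arg_cong[of _ _ "X_germ X a"])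
  have "taylor_projector X a b \<Phi> d (X_germ X a F) = \<zero>\<^bsub>X_germ_ring X a\<^esub> \<longleftrightarrow> F \<in> subst_perp ?L"
    if F: "holo_at F a" for F
  proof -
    obtain p where p: "p \<in> polys_le d" "good (X_germ X a F) (X_germ X a (poly_eval p))"
      using ex[OF F] by blast
    have proj: "taylor_projector X a b \<Phi> d (X_germ X a F) = X_germ X a (poly_eval p)"
      unfolding taylor_projector_def good_def[symmetric]
    proof (rule the_equality)
      fix y assume y: "good (X_germ X a F) y"
      then obtain p' where "p' \<in> polys_le d" "y = X_germ X a (poly_eval p')"
        by (auto simp: good_def X_polys_eq)
      then show "y = X_germ X a (poly_eval p)" using uniq[OF _ p(1) F _ p(2)] y by blast
    qed (rule p(2))
    \<comment> \<open>By uniqueness the projection vanishes exactly when 0 is itself a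
      solution.\<close>
    have "X_germ X a (poly_eval p) = X_germ X a (poly_eval 0) \<longleftrightarrow> good (X_germ X a F) (X_germ X a (poly_eval 0))"
      using uniq[OF p(1) zero(2) F p(2)] p(2) by metis
    also have "\<dots> \<longleftrightarrow> F \<in> subst_perp ?L"
    proof -
      have "taylor_coeff (\<lambda>t. poly_eval 0 (\<Phi> t)) b = (\<lambda>_. 0)"
        by (rule ext) (simp add: taylor_coeff_def mdiff_const_zero)
      then show ?thesis using good_iff[OF zero(2) F] F by (simp add: subst_perp_def fun_perp_def holo_at_subst)
    qed
    finally show ?thesis by (simp add: proj zero(1))
  qed
  then show ?thesis
    unfolding bos_calvi_eq X_perp_eq by (auto simp: taylor_kernel_def carrier_X_germ_ring subst_perp_def)
qed

lemma least_span_param_polys_le: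
  obtains K where "cpoly.span (fun_least b ` Phi_funs \<Phi> d) \<subseteq> polys_le K"
  using least_span_polys_le[OF germ_space_param] .

text \<open>Conditions (2) to (4) become absorption for the annihilator of the least space, and (1)
  ties this to \<open>deriv_approx\<close>, the form that is compared between
  parametrisations.\<close>

lemma least_space_conditions:
  "D_invariant (least_space b (Phi_polys a b \<Phi> d)) \<longleftrightarrow> deriv_approx b (Phi_funs \<Phi> d)"
  "ideal (perp b (least_space b (Phi_polys a b \<Phi> d))) (germ_ring b) \<longleftrightarrow> deriv_approx b (Phi_funs \<Phi> d)"
  "ideal (taylor_kernel X a b \<Phi> d) (X_germ_ring X a) \<longleftrightarrow> deriv_approx b (Phi_funs \<Phi> d)"
  "D_invariant (bos_calvi a b \<Phi> d) \<longleftrightarrow> deriv_approx b (Phi_funs \<Phi> d)"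
proof -
  let ?L = "cpoly.span (fun_least b ` Phi_funs \<Phi> d)"
  obtain K where K: "?L \<subseteq> polys_le K" by (rule least_span_param_polys_le)
  have L: "cpoly.subspace ?L" by (rule cpoly.subspace_span)
  show 1: "D_invariant (least_space b (Phi_polys a b \<Phi> d)) \<longleftrightarrow> deriv_approx b (Phi_funs \<Phi> d)"
    unfolding least_space_eq by (rule D_invariant_least_span_iff[OF germ_space_param])
  have 2: "mult_closed b (fun_perp b ?L) \<longleftrightarrow> deriv_approx b (Phi_funs \<Phi> d)"
    using 1 D_invariant_iff_mult_closed[OF L K, of b] by (simp add: least_space_eq)
  show "ideal (perp b (least_space b (Phi_polys a b \<Phi> d))) (germ_ring b) \<longleftrightarrow> deriv_approx b (Phi_funs \<Phi> d)"
    by (simp add: least_space_eq ideal_perp_iff 2)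
  show "ideal (taylor_kernel X a b \<Phi> d) (X_germ_ring X a) \<longleftrightarrow> deriv_approx b (Phi_funs \<Phi> d)"
    by (simp add: taylor_kernel_eq bos_calvi_eq ideal_X_perp_iff 2)
  \<comment> \<open>The ideal criterion is applied a second time, now at a in the variables \<xi>:
    the adjoint keeps the degree bound, and the annihilator of the image is the preimage of the
    annihilator under \<phi>.\<close>
  have "adjoint_map a b \<Phi> ` ?L \<subseteq> polys_le K" using K adjoint_map_polys_le by blast
  then show "D_invariant (bos_calvi a b \<Phi> d) \<longleftrightarrow> deriv_approx b (Phi_funs \<Phi> d)"
    using D_invariant_iff_mult_closed[OF subspace_adjoint_image[OF L], of K a]
    by (simp add: bos_calvi_eq fun_perp_adjoint_image mult_closed_subst_perp 2)
qed

end

subsection \<open>Existence of local parametrisations\<close>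

text \<open>In a straightening chart \<open>X\<close> is the coordinate plane of \<open>J\<close>,
  and the n free coordinates parametrise it.\<close>

lemma local_parametrisation_exists:
  fixes X \<Omega> :: "(complex ^ 'm::finite) set"
  assumes "complex_submanifold CARD('n::finite) \<Omega> X" "a \<in> X"
  obtains b \<Phi> where "local_parametrisation X a (b :: complex ^ 'n) \<Phi>"
proof -
  obtain U V \<psi> \<psi>' J where *: "open U" "a \<in> U" "open V" "homeomorphism U V \<psi> \<psi>'"
    "holo_map_on \<psi> U" "holo_map_on \<psi>' V" "card J = CARD('n)"
    "\<psi> ` (X \<inter> U) = V \<inter> {w::complex ^ 'm. \<forall>j. j \<notin> J \<longrightarrow> w $ j = 0}"
    using assms(1)[unfolded complex_submanifold_def, THEN conjunct2, THEN conjunct2, rule_format, OF assms(2)]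
    by (elim exE conjE)
  obtain h where h: "bij_betw h (UNIV :: 'n set) J"
    using finite_same_card_bij[of "UNIV :: 'n set" J] *(7) by auto
  \<comment> \<open>The copy of n-space in the coordinates of \<open>J\<close>, which are numbered
    by the bijection \<open>h\<close>.\<close>
  define emb :: "complex ^ 'n \<Rightarrow> complex ^ 'm" where "emb t = (\<chi> j. if j \<in> J then t $ inv_into UNIV h j else 0)" for t
  have inv_h: "inv_into UNIV h (h i) = i" for i using h by (simp add: bij_betw_def)
  have h_inv: "h (inv_into UNIV h j) = j" if "j \<in> J" for j
    using h that by (auto simp: bij_betw_def f_inv_into_f)
  have hJ: "h i \<in> J" for i using h by (auto simp: bij_betw_def)
  define \<Phi> where "\<Phi> t = \<psi>' (emb t)" for t
  \<comment> \<open>Discarding the coordinates outside \<open>J\<close> makes sense on all of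
    \<open>U\<close>, which provides the inverse as a holomorphic map on an ambient open
    set.\<close>
  define \<Psi> :: "complex ^ 'm \<Rightarrow> complex ^ 'n" where "\<Psi> x = (\<chi> i. \<psi> x $ h i)" for x
  define W where "W = emb -` V"
  have emb_diff: "complex_diff_at (\<lambda>t. emb t $ j) t" for j t
    by (cases "j \<in> J") (auto simp: emb_def)
  have emb_holo: "holo_map_at emb t" for t
    unfolding holo_map_at_def holo_at_def by (intro allI always_eventually emb_diff)
  have W: "open W"
    unfolding W_def using *(3) continuous_at_imp_continuous_on[of UNIV emb] holo_map_at_isCont[OF emb_holo]
    by (intro open_vimage) auto
  have emb_eq: "emb (\<Psi> x) = \<psi> x" if "x \<in> X \<inter> U" for x
  proof -
    have "\<psi> x \<in> V \<inter> {w. \<forall>j. j \<notin> J \<longrightarrow> w $ j = 0}" using that *(8) by blast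
    then show ?thesis by (auto simp: emb_def \<Psi>_def vec_eq_iff h_inv)
  qed
  have \<psi>': "\<psi>' (\<psi> x) = x" if "x \<in> U" for x using *(4) that by (simp add: homeomorphism_def)
  have emb_img: "\<exists>x\<in>X \<inter> U. emb t = \<psi> x" if "t \<in> W" for t
  proof -
    have "emb t \<in> V \<inter> {w. \<forall>j. j \<notin> J \<longrightarrow> w $ j = 0}" using that by (auto simp: W_def emb_def)
    then show ?thesis unfolding *(8)[symmetric] by blast
  qed
  have holoW: "holo_map_on \<Phi> W"
    unfolding holo_map_on_def
  proof (intro allI ballI)
    fix j t assume "t \<in> W"
    then show "complex_diff_at (\<lambda>t. \<Phi> t $ j) t"
      unfolding \<Phi>_def using complex_diff_at_compose(1)[of "\<lambda>y. \<psi>' y $ j" emb t] *(6) emb_diff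
      by (simp add: holo_map_on_def W_def)
  qed
  have holoU: "holo_map_on \<Psi> U"
    using *(5) by (simp add: holo_map_on_def \<Psi>_def)
  have 1: "\<Psi> (\<Phi> t) = t" "\<Phi> t \<in> X \<inter> U" if t: "t \<in> W" for t
  proof -
    obtain x where x: "x \<in> X \<inter> U" "emb t = \<psi> x" using emb_img[OF t] by blast
    then have "\<Phi> t = x" by (simp add: \<Phi>_def \<psi>')
    then show "\<Phi> t \<in> X \<inter> U" using x(1) by simp
    have "\<Psi> x = (\<chi> i. emb t $ h i)" by (simp add: \<Psi>_def x(2))
    then show "\<Psi> (\<Phi> t) = t" unfolding \<open>\<Phi> t = x\<close> by (simp add: emb_def hJ inv_h)
  qed
  have 2: "\<Phi> (\<Psi> x) = x" "\<Psi> x \<in> W" if x: "x \<in> X \<inter> U" for x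
  proof -
    show "\<Phi> (\<Psi> x) = x" using x by (simp add: \<Phi>_def emb_eq[OF x] \<psi>')
    have "\<psi> x \<in> V" using x *(8) by blast
    then show "\<Psi> x \<in> W" by (simp add: W_def emb_eq[OF x])
  qed
  have "continuous_on W \<Phi>"
    using holo_map_at_isCont[OF holo_map_at_holo_map_on[OF W _ holoW]] by (intro continuous_at_imp_continuous_on) auto
  moreover have "continuous_on U \<Psi>"
    using holo_map_at_isCont[OF holo_map_at_holo_map_on[OF *(1) _ holoU]] by (intro continuous_at_imp_continuous_on) auto
  then have "continuous_on (X \<inter> U) \<Psi>" by (rule continuous_on_subset) auto
  ultimately have "homeomorphism W (X \<inter> U) \<Phi> \<Psi>"
    using 1 2 by (intro homeomorphismI) auto
  then have "local_parametrisation X a (\<Psi> a) \<Phi>"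
    unfolding local_parametrisation_def using W *(1,2) holoW holoU 2[of a] assms(2) by blast
  then show thesis by (rule that)
qed

theorem proposition10p7:
  fixes X \<Omega> :: "(complex ^ 'm::finite) set" and a :: "complex ^ 'm" and d :: nat
  assumes "complex_submanifold CARD('n::finite) \<Omega> X" and "a \<in> X"
  shows "let
      C1 = (\<lambda>(b :: complex ^ 'n) \<Phi>. D_invariant (least_space b (Phi_polys a b \<Phi> d)));
      C2 = (\<lambda>(b :: complex ^ 'n) \<Phi>. ideal (perp b (least_space b (Phi_polys a b \<Phi> d))) (germ_ring b));
      C3 = (\<lambda>(b :: complex ^ 'n) \<Phi>. ideal (taylor_kernel X a b \<Phi> d) (X_germ_ring X a));
      C4 = (\<lambda>(b :: complex ^ 'n) \<Phi>. D_invariant (bos_calvi a b \<Phi> d));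
      for_all = (\<lambda>C. \<forall>(b :: complex ^ 'n) \<Phi>. local_parametrisation X a b \<Phi> \<longrightarrow> C b \<Phi>);
      for_some = (\<lambda>C. \<exists>(b :: complex ^ 'n) \<Phi>. local_parametrisation X a b \<Phi> \<and> C b \<Phi>)
    in
      for_all (\<lambda>b \<Phi>. taylor_kernel X a b \<Phi> d = X_perp X a b \<Phi> (bos_calvi a b \<Phi> d)) \<and>
      (for_all C1 \<longleftrightarrow> for_all C2) \<and>
      (for_all C1 \<longleftrightarrow> for_all C3) \<and>
      (for_all C1 \<longleftrightarrow> for_all C4) \<and>
      (for_all C1 \<longleftrightarrow> for_some C1) \<and>
      (for_all C2 \<longleftrightarrow> for_some C2) \<and>
      (for_all C3 \<longleftrightarrow> for_some C3) \<and>
      (for_all C4 \<longleftrightarrow> for_some C4) \<and>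
      (\<forall>(b :: complex ^ 'n) \<Phi>. local_parametrisation X a b \<Phi> \<and> bundle_point_param b \<Phi> d \<longrightarrow>
         for_all C1 \<and> for_all C2 \<and> for_all C3 \<and> for_all C4)"
proof -
  define D where "D b \<Phi> \<longleftrightarrow> deriv_approx b (Phi_funs \<Phi> d)" for b :: "complex ^ 'n" and \<Phi> :: "complex ^ 'n \<Rightarrow> complex ^ 'm"
  have ker: "taylor_kernel X a b \<Phi> d = X_perp X a b \<Phi> (bos_calvi a b \<Phi> d)"
    if "local_parametrisation X a b \<Phi>" for b :: "complex ^ 'n" and \<Phi>
    using that by (elim local_parametrisation_param_pair) (rule taylor_kernel_eq)
  have C: "D_invariant (least_space b (Phi_polys a b \<Phi> d)) \<longleftrightarrow> D b \<Phi>"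
    "ideal (perp b (least_space b (Phi_polys a b \<Phi> d))) (germ_ring b) \<longleftrightarrow> D b \<Phi>"
    "ideal (taylor_kernel X a b \<Phi> d) (X_germ_ring X a) \<longleftrightarrow> D b \<Phi>"
    "D_invariant (bos_calvi a b \<Phi> d) \<longleftrightarrow> D b \<Phi>"
    if lp: "local_parametrisation X a b \<Phi>" for b :: "complex ^ 'n" and \<Phi>
  proof -
    obtain \<Psi> where "param_pair X a b \<Phi> \<Psi>" using lp by (rule local_parametrisation_param_pair)
    note least_space_conditions[OF this, of d]
    then show "D_invariant (least_space b (Phi_polys a b \<Phi> d)) \<longleftrightarrow> D b \<Phi>"
      "ideal (perp b (least_space b (Phi_polys a b \<Phi> d))) (germ_ring b) \<longleftrightarrow> D b \<Phi>"
      "ideal (taylor_kernel X a b \<Phi> d) (X_germ_ring X a) \<longleftrightarrow> D b \<Phi>"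
      "D_invariant (bos_calvi a b \<Phi> d) \<longleftrightarrow> D b \<Phi>"
      by (simp_all only: D_def)
  qed
  have D_indep: "D b' \<Phi>'" if lp: "local_parametrisation X a b \<Phi>" "local_parametrisation X a b' \<Phi>'" and "D b \<Phi>"
    for b b' :: "complex ^ 'n" and \<Phi> \<Phi>'
  proof -
    obtain \<Psi> where \<Psi>: "param_pair X a b \<Phi> \<Psi>" using lp(1) by (rule local_parametrisation_param_pair)
    obtain \<Psi>' where \<Psi>': "param_pair X a b' \<Phi>' \<Psi>'" using lp(2) by (rule local_parametrisation_param_pair)
    show ?thesis using \<open>D b \<Phi>\<close> deriv_approx_parametrisation[OF \<Psi> \<Psi>'] by (simp add: D_def)
  qed
  \<comment> \<open>Without a parametrisation the universal statements would hold vacuously and the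
    existential ones would fail.\<close>
  obtain b0 :: "complex ^ 'n" and \<Phi>0 where ex: "local_parametrisation X a b0 \<Phi>0"
    using local_parametrisation_exists[OF assms] by blast
  have bundle_D: "D b \<Phi>" if "bundle_point_param b \<Phi> d" for b \<Phi>
    using that unfolding D_def by (rule bundle_point_param_deriv_approx)
  \<comment> \<open>\<open>D\<close> does not depend on the parametrisation, so both quantified
    forms of each condition reduce to \<open>D\<close> at the fixed one, and all the equivalences
    become trivial.\<close>
  have all: "(\<forall>b \<Phi>. local_parametrisation X a b \<Phi> \<longrightarrow> P b \<Phi>) \<longleftrightarrow> D b0 \<Phi>0"
    and some: "(\<exists>b \<Phi>. local_parametrisation X a b \<Phi> \<and> P b \<Phi>) \<longleftrightarrow> D b0 \<Phi>0"
    if "\<And>b \<Phi>. local_parametrisation X a b \<Phi> \<Longrightarrow> P b \<Phi> \<longleftrightarrow> D b \<Phi>" for P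
    using that ex D_indep by blast+
  show ?thesis
    unfolding Let_def
    by (simp only: all[OF C(1)] all[OF C(2)] all[OF C(3)] all[OF C(4)]
      some[OF C(1)] some[OF C(2)] some[OF C(3)] some[OF C(4)])
      (use ker ex D_indep bundle_D in blast)
qed

end
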